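(* Let $\mathbb K$ be an algebraically closed field of characteristic zero and let $N\ge2$, $D\ge2$ be integers. Let $\mathcal A$ be an $N$-homogeneous Koszul algebra of finite global dimension $D$ which is Gorenstein, and suppose $q=\dim(\mathcal A_1)\geq 2$. Then $\mathcal A=\mathcal A(W,N)$ for some preregular $m$-linear form $W$ on $\mathbb K^q$ such that: - if $N\ge3$, then $m=Np+1$ and $D=2p+1$ for some integer $p\ge1$; - if $N=2$, then $m=D$.
   Context: All algebras are associative unital algebras over $\mathbb K$. **Homogeneous algebras.** An $N$-homogeneous algebra is a graded algebra $\mathcal A=A(E,R)=T(E)/(R)$, where $E$ is a finite-dimensional vector space placed in degree $1$ (so $\mathcal A_1=E$), $T(E)$ is its tensor algebra, and $(R)$ is the two-sided ideal generated by a subspace $R\subset E^{\otimes N}$ (the space of relations). It is connected, $\mathcal A_0=\mathbb K$, and $\mathbb K$ denotes also the trivial $\mathcal A$-module $\mathcal A/\bigoplus_{n\ge1}\mathcal A_n$. **Koszulity.** Let $K_n=E^{\otimes n}$ for $0\le n\le N-1$ and $K_n=\bigcap_{r+s=n-N}E^{\otimes r}\otimes R\otimes E^{\otimes s}\subset E^{\otimes n}$ for $n\ge N$. The maps $a\otimes(v_1\otimes v_2\otimes\cdots\otimes v_n)\mapsto av_1\otimes(v_2\otimes\cdots\otimes v_n)$ induce left $\mathcal A$-module homomorphisms $d:\mathcal A\otimes K_n\to\mathcal A\otimes K_{n-1}$ with $d^N=0$. The Koszul complex of $\mathcal A$ is $$\cdots\stackrel{d}{\to}\mathcal A\otimes K_{2N}\stackrel{d^{N-1}}{\to}\mathcal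 A\otimes K_{N+1}\stackrel{d}{\to}\mathcal A\otimes K_N\stackrel{d^{N-1}}{\to}\mathcal A\otimes K_1\stackrel{d}{\to}\mathcal A\to0$$ (the maps are alternately $d$ and $d^{N-1}$; the modules are $\mathcal A\otimes K_{Nk}$ in homological degree $2k$ and $\mathcal A\otimes K_{Nk+1}$ in homological degree $2k+1$). $\mathcal A$ is Koszul if this complex is acyclic in homological degrees $\ge1$ (so that it is a free resolution of the trivial left module $\mathbb K$). **Global dimension, Gorenstein.** The global dimension of $\mathcal A$ is the projective dimension of the trivial module $\mathbb K$. An algebra $\mathcal A$ of finite global dimension $D$ is Gorenstein if $\mathrm{Ext}^n_{\mathcal A}(\mathbb K,\mathcal A)=0$ for $n\neq D$ and $\mathrm{Ext}^D_{\mathcal A}(\mathbb K,\mathcal A)\simeq\mathbb K$ (one-dimensional). **Preregular forms.** Let $V$ be a vector space and $m\ge2$. An $m$-linear form $W$ on $V$ is preregular iff: (i) if $X\in V$ satisfies $W(X,X_1,\dots,X_{m-1})=0$ for all $X_1,\dots,X_{m-1}\in V$, then $X=0$; (ii) there is $Q_W\in GL(V)$ such that $W(X_1,\dots,X_{m-1},X_m)=W(Q_WX_m,X_1,\dots,X_{m-1})$ for all $X_1,\dots,X_m\in V$. **The algebra $\mathcal A(W,N)$.** Let $m\ge N\ge2$ and let $W\neq0$ be an $m$-linear form on $\mathbb K^q$ with components $W_{\lambda_1\dots\lambda_m}=W(e_{\lambda_1},\dots,e_{\lambda_m})$ in the canonical basis. Then $\mathcal A(W,N)=A(E,R)$ is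 the $N$-homogeneous algebra generated by $x^1,\dots,x^q$ with relations $\sum_{\mu_1,\dots,\mu_N}W_{\lambda_1\dots\lambda_{m-N}\mu_1\dots\mu_N}x^{\mu_1}\cdots x^{\mu_N}=0$ for all $\lambda_1,\dots,\lambda_{m-N}\in\{1,\dots,q\}$; that is, $E=\bigoplus_\lambda\mathbb Kx^\lambda$ and $R\subset E^{\otimes N}$ is the span of the elements $\sum_{\mu_i} W_{\lambda_1\dots\lambda_{m-N}\mu_1\dots\mu_N}x^{\mu_1}\otimes\cdots\otimes x^{\mu_N}$. In the statement "$\mathcal A=\mathcal A(W,N)$", $\mathcal A_1$ is identified with the dual of $\mathbb K^q$ by the choice of a basis $(x^\lambda)$ of $\mathcal A_1$ (regarded as the dual basis of $(e_\lambda)$). *)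

theory Defs
  imports
    "HOL-Analysis.Analysis"
    "HOL-Algebra.QuotRing"
    "HOL-Algebra.Module"
    "HOL-Library.Function_Algebras"
    "HOL-Library.Extended_Nat"
    "HOL-Computational_Algebra.Polynomial"
begin

section \<open>Associative unital algebras\<close>

text \<open>
  The record type \<open>('k, 'a) module\<close> of HOL-Algebra carries a ring structure on \<open>'a\<close> together with
  scalars from \<open>'k\<close>.  The library locale \<open>algebra\<close> asks for commutativity, hence this variant,
  in which the ground field is a type.
\<close>

locale unital_algebra = ring A for A :: "('k::field, 'a) module" (structure) +
  assumes scale_closed: "a \<in> carrier A \<Longrightarrow> c \<odot> a \<in> carrier A"
    and scale_add_left: "a \<in> carrier A \<Longrightarrow> (c + d) \<odot> a = c \<odot> a \<oplus> d \<odot> a"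
    and scale_add_right: "a \<in> carrier A \<Longrightarrow> b \<in> carrier A \<Longrightarrow> c \<odot> (a \<oplus> b) = c \<odot> a \<oplus> c \<odot> b"
    and scale_assoc: "a \<in> carrier A \<Longrightarrow> (c * d) \<odot> a = c \<odot> (d \<odot> a)"
    and scale_one: "a \<in> carrier A \<Longrightarrow> 1 \<odot> a = a"
    and scale_mult_left: "a \<in> carrier A \<Longrightarrow> b \<in> carrier A \<Longrightarrow> (c \<odot> a) \<otimes> b = c \<odot> (a \<otimes> b)"
    and scale_mult_right: "a \<in> carrier A \<Longrightarrow> b \<in> carrier A \<Longrightarrow> a \<otimes> (c \<odot> b) = c \<odot> (a \<otimes> b)"


section \<open>The tensor algebra of a space with basis \<open>'q\<close>\<close>

text \<open>
  Let \<open>E\<close> be the vector space with basis \<open>(x\<^sup>\<lambda>)\<close> indexed by the finite type \<open>'q\<close>.  The words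
  \<open>[\<lambda>1, \<dots>, \<lambda>n]\<close>, standing for the tensors of basis vectors, form a basis of the \<open>n\<close>-th tensor power
  of \<open>E\<close>.  An element of \<open>T(E)\<close> is represented by its coefficient function on words.  Note that the
  multiplication of \<open>T(E)\<close> is concatenation, i.e. convolution of coefficient functions, and not the
  pointwise product of HOL-Library.Function_Algebras.
\<close>

global_interpretation tens: vector_space "\<lambda>(c::'k::field) (f::'q list \<Rightarrow> 'k) w. c * f w"
  by unfold_locales (auto simp: fun_eq_iff algebra_simps)

definition tensor_algebra :: "('k::field, 'q list \<Rightarrow> 'k) module" where
  "tensor_algebra =
    \<lparr>carrier = {f. finite {w. f w \<noteq> 0}},
     mult = (\<lambda>f g w. \<Sum>i\<le>length w. f (take i w) * g (drop i w)),
     one = (\<lambda>w. if w = [] then 1 else 0),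
     zero = (\<lambda>w. 0),
     add = (\<lambda>f g w. f w + g w),
     smult = (\<lambda>c f w. c * f w)\<rparr>"

definition tensor_power :: "nat \<Rightarrow> ('q::finite list \<Rightarrow> 'k::field) set" where
  "tensor_power n = {f. \<forall>w. f w \<noteq> 0 \<longrightarrow> length w = n}"


section \<open>Homogeneous algebras\<close>

definition word_prod :: "('k::field, 'a) module \<Rightarrow> ('q \<Rightarrow> 'a) \<Rightarrow> 'q list \<Rightarrow> 'a" where
  "word_prod A x w = foldr (\<lambda>i a. x i \<otimes>\<^bsub>A\<^esub> a) w \<one>\<^bsub>A\<^esub>"

text \<open>The algebra homomorphism from \<open>T(E)\<close> to \<open>A\<close> that sends the basis vector \<open>\<lambda>\<close> of \<open>E\<close> to \<open>x \<lambda>\<close>.\<close>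

definition evaluate :: "('k::field, 'a) module \<Rightarrow> ('q \<Rightarrow> 'a) \<Rightarrow> ('q list \<Rightarrow> 'k) \<Rightarrow> 'a" where
  "evaluate A x f = (\<Oplus>\<^bsub>A\<^esub>w\<in>{w. f w \<noteq> 0}. f w \<odot>\<^bsub>A\<^esub> word_prod A x w)"

text \<open>
  \<open>A = A(E,R) = T(E)/(R)\<close>, where \<open>x\<close> is the chosen basis of \<open>E = A\<^sub>1\<close>: the homomorphism from \<open>T(E)\<close> to \<open>A\<close>
  is onto and its kernel is the two-sided ideal generated by \<open>R\<close>.  As the relations have degree
  \<open>N \<ge> 2\<close>, the family \<open>x\<close> is then indeed a basis of \<open>A\<^sub>1\<close>, so that the dimension of \<open>A\<^sub>1\<close> is \<open>CARD('q)\<close>.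
\<close>

definition homogeneous_algebra ::
    "nat \<Rightarrow> ('k::field, 'a) module \<Rightarrow> ('q::finite \<Rightarrow> 'a) \<Rightarrow> ('q list \<Rightarrow> 'k) set \<Rightarrow> bool" where
  "homogeneous_algebra N A x R \<longleftrightarrow>
     unital_algebra A \<and> 2 \<le> N \<and>
     tens.subspace R \<and> R \<subseteq> tensor_power N \<and>
     range x \<subseteq> carrier A \<and>
     evaluate A x ` carrier tensor_algebra = carrier A \<and>
     {f \<in> carrier tensor_algebra. evaluate A x f = \<zero>\<^bsub>A\<^esub>} = Idl\<^bsub>tensor_algebra\<^esub> R"


section \<open>The Koszul complex\<close>

definition koszul_space ::
    "nat \<Rightarrow> ('q::finite list \<Rightarrow> 'k::field) set \<Rightarrow> nat \<Rightarrow> ('q list \<Rightarrow> 'k) set" where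
  "koszul_space N R n =
    (if n < N then tensor_power n
     else \<Inter>r\<in>{0..n - N}.
       tens.span {u \<otimes>\<^bsub>tensor_algebra\<^esub> \<rho> \<otimes>\<^bsub>tensor_algebra\<^esub> v | u \<rho> v.
         u \<in> tensor_power r \<and> \<rho> \<in> R \<and> v \<in> tensor_power (n - N - r)})"

text \<open>
  Elements of the tensor product of \<open>A\<close> with the \<open>n\<close>-th tensor power of \<open>E\<close> are represented by their
  coefficients in \<open>A\<close> with respect to the basis of words of length \<open>n\<close>.  As \<open>\<^bold>K\<close> is a field, the
  tensor product of \<open>A\<close> with \<open>K\<^sub>n\<close> is a subspace, namely the set of the sums of
  the elements \<open>a j \<otimes> k j\<close> below.
\<close>

definition koszul_module ::
    "nat \<Rightarrow> ('k::field, 'a) module \<Rightarrow> ('q::finite list \<Rightarrow> 'k) set \<Rightarrow> nat \<Rightarrow> ('q list \<Rightarrow> 'a) set" where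
  "koszul_module N A R n =
    {(\<lambda>w. \<Oplus>\<^bsub>A\<^esub>j\<in>{..<l}. k j w \<odot>\<^bsub>A\<^esub> a j) | l (a :: nat \<Rightarrow> 'a) (k :: nat \<Rightarrow> 'q list \<Rightarrow> 'k).
       \<forall>j<l. a j \<in> carrier A \<and> k j \<in> koszul_space N R n}"

text \<open>The map \<open>a \<otimes> (v\<^sub>1 \<otimes> v\<^sub>2 \<otimes> \<dots> \<otimes> v\<^sub>n) \<mapsto> a v\<^sub>1 \<otimes> (v\<^sub>2 \<otimes> \<dots> \<otimes> v\<^sub>n)\<close> in coefficients.\<close>

definition koszul_d ::
    "('k::field, 'a) module \<Rightarrow> ('q::finite \<Rightarrow> 'a) \<Rightarrow> ('q list \<Rightarrow> 'a) \<Rightarrow> 'q list \<Rightarrow> 'a" where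
  "koszul_d A x f w = (\<Oplus>\<^bsub>A\<^esub>i\<in>UNIV. f (i # w) \<otimes>\<^bsub>A\<^esub> x i)"

definition koszul_degree :: "nat \<Rightarrow> nat \<Rightarrow> nat" where
  "koszul_degree N j = (if even j then N * (j div 2) else N * (j div 2) + 1)"

text \<open>The differential leaving homological degree \<open>j \<ge> 1\<close>.\<close>

definition koszul_diff ::
    "nat \<Rightarrow> ('k::field, 'a) module \<Rightarrow> ('q::finite \<Rightarrow> 'a) \<Rightarrow> nat \<Rightarrow> ('q list \<Rightarrow> 'a) \<Rightarrow> 'q list \<Rightarrow> 'a" where
  "koszul_diff N A x j = (if even j then koszul_d A x ^^ (N - 1) else koszul_d A x)"

definition koszul ::
    "nat \<Rightarrow> ('k::field, 'a) module \<Rightarrow> ('q::finite \<Rightarrow> 'a) \<Rightarrow> ('q list \<Rightarrow> 'k) set \<Rightarrow> bool" where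
  "koszul N A x R \<longleftrightarrow>
    (\<forall>j\<ge>1. {f \<in> koszul_module N A R (koszul_degree N j). koszul_diff N A x j f = (\<lambda>w. \<zero>\<^bsub>A\<^esub>)} =
       koszul_diff N A x (j + 1) ` koszul_module N A R (koszul_degree N (j + 1)))"


section \<open>Left modules, projective resolutions and Ext\<close>

text \<open>
  The library locale \<open>module\<close> asks for a commutative ring of scalars.  In all module records below
  the fields \<open>mult\<close> and \<open>one\<close> play no role.
\<close>

locale left_module = R?: ring A + M?: abelian_group M
  for A :: "('a, 'z) ring_scheme" and M :: "('a, 'm) module" +
  assumes "a \<in> carrier A \<Longrightarrow> m \<in> carrier M \<Longrightarrow> a \<odot>\<^bsub>M\<^esub> m \<in> carrier M"
    and "a \<in> carrier A \<Longrightarrow> b \<in> carrier A \<Longrightarrow> m \<in> carrier M \<Longrightarrow>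
      (a \<oplus>\<^bsub>A\<^esub> b) \<odot>\<^bsub>M\<^esub> m = a \<odot>\<^bsub>M\<^esub> m \<oplus>\<^bsub>M\<^esub> b \<odot>\<^bsub>M\<^esub> m"
    and "a \<in> carrier A \<Longrightarrow> m \<in> carrier M \<Longrightarrow> m' \<in> carrier M \<Longrightarrow>
      a \<odot>\<^bsub>M\<^esub> (m \<oplus>\<^bsub>M\<^esub> m') = a \<odot>\<^bsub>M\<^esub> m \<oplus>\<^bsub>M\<^esub> a \<odot>\<^bsub>M\<^esub> m'"
    and "a \<in> carrier A \<Longrightarrow> b \<in> carrier A \<Longrightarrow> m \<in> carrier M \<Longrightarrow>
      (a \<otimes>\<^bsub>A\<^esub> b) \<odot>\<^bsub>M\<^esub> m = a \<odot>\<^bsub>M\<^esub> (b \<odot>\<^bsub>M\<^esub> m)"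
    and "m \<in> carrier M \<Longrightarrow> \<one>\<^bsub>A\<^esub> \<odot>\<^bsub>M\<^esub> m = m"

definition left_module_hom ::
    "('a, 'z) ring_scheme \<Rightarrow> ('a, 'm) module \<Rightarrow> ('a, 'n) module \<Rightarrow> ('m \<Rightarrow> 'n) set" where
  "left_module_hom A M M' =
    {h \<in> carrier M \<rightarrow> carrier M'.
       (\<forall>m\<in>carrier M. \<forall>m'\<in>carrier M. h (m \<oplus>\<^bsub>M\<^esub> m') = h m \<oplus>\<^bsub>M'\<^esub> h m') \<and>
       (\<forall>a\<in>carrier A. \<forall>m\<in>carrier M. h (a \<odot>\<^bsub>M\<^esub> m) = a \<odot>\<^bsub>M'\<^esub> h m)}"

definition regular_module :: "('a, 'z) ring_scheme \<Rightarrow> ('a, 'a) module" where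
  "regular_module A =
    \<lparr>carrier = carrier A, mult = undefined, one = undefined, zero = \<zero>\<^bsub>A\<^esub>, add = (\<oplus>\<^bsub>A\<^esub>),
     smult = (\<otimes>\<^bsub>A\<^esub>)\<rparr>"

definition free_module :: "('a, 'z) ring_scheme \<Rightarrow> 'x set \<Rightarrow> ('a, 'x \<Rightarrow> 'a) module" where
  "free_module A X =
    \<lparr>carrier = {f. (\<forall>i. f i \<in> carrier A) \<and> finite {i. f i \<noteq> \<zero>\<^bsub>A\<^esub>} \<and> {i. f i \<noteq> \<zero>\<^bsub>A\<^esub>} \<subseteq> X},
     mult = undefined, one = undefined,
     zero = (\<lambda>i. \<zero>\<^bsub>A\<^esub>), add = (\<lambda>f g i. f i \<oplus>\<^bsub>A\<^esub> g i), smult = (\<lambda>a f i. a \<otimes>\<^bsub>A\<^esub> f i)\<rparr>"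

text \<open>The scalars may come from \<open>A\<close> or from the ground field, so this covers left ideals and
  subspaces alike.\<close>

definition quotient_module :: "('s, 'm) module \<Rightarrow> 'm set \<Rightarrow> ('s, 'm set) module" where
  "quotient_module M U =
    \<lparr>carrier = a_rcosets\<^bsub>M\<^esub> U, mult = undefined, one = undefined, zero = U, add = set_add M,
     smult = (\<lambda>c X. \<Union>m\<in>X. U +>\<^bsub>M\<^esub> (c \<odot>\<^bsub>M\<^esub> m))\<rparr>"

text \<open>
  A projective module is a direct summand of a free module.  Index sets within the type of the
  elements of \<open>P\<close> suffice, since \<open>P\<close> is a quotient of the free module on \<open>carrier P\<close>.
\<close>

definition projective_module :: "('a, 'z) ring_scheme \<Rightarrow> ('a, 'm) module \<Rightarrow> bool" where
  "projective_module A P \<longleftrightarrow> left_module A P \<and>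
    (\<exists>(X :: 'm set) \<iota> \<pi>.
       \<iota> \<in> left_module_hom A P (free_module A X) \<and> \<pi> \<in> left_module_hom A (free_module A X) P \<and>
       (\<forall>m\<in>carrier P. \<pi> (\<iota> m) = m))"

text \<open>A resolution \<open>\<dots> \<rightarrow> P 2 \<rightarrow> P 1 \<rightarrow> P 0 \<rightarrow> M \<rightarrow> 0\<close> with maps \<open>\<delta> n\<close> from \<open>P (n + 1)\<close> to \<open>P n\<close> and \<open>\<epsilon>\<close> from \<open>P 0\<close> to \<open>M\<close>.\<close>

definition projective_resolution ::
    "('a, 'z) ring_scheme \<Rightarrow> ('a, 'm) module \<Rightarrow> (nat \<Rightarrow> ('a, 'p) module) \<Rightarrow>
     (nat \<Rightarrow> 'p \<Rightarrow> 'p) \<Rightarrow> ('p \<Rightarrow> 'm) \<Rightarrow> bool" where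
  "projective_resolution A M P \<delta> \<epsilon> \<longleftrightarrow>
    (\<forall>n. projective_module A (P n)) \<and>
    (\<forall>n. \<delta> n \<in> left_module_hom A (P (Suc n)) (P n)) \<and>
    \<epsilon> \<in> left_module_hom A (P 0) M \<and>
    \<epsilon> ` carrier (P 0) = carrier M \<and>
    {y \<in> carrier (P 0). \<epsilon> y = \<zero>\<^bsub>M\<^esub>} = \<delta> 0 ` carrier (P 1) \<and>
    (\<forall>n. {y \<in> carrier (P (Suc n)). \<delta> n y = \<zero>\<^bsub>P n\<^esub>} = \<delta> (Suc n) ` carrier (P (Suc (Suc n))))"

text \<open>\<open>Hom\<^sub>A(M, A)\<close> as a vector space over the ground field; homomorphisms are made extensional.\<close>

definition hom_to_algebra :: "('k::field, 'a) module \<Rightarrow> ('a, 'm) module \<Rightarrow> ('k, 'm \<Rightarrow> 'a) module" where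
  "hom_to_algebra A M =
    \<lparr>carrier = left_module_hom A M (regular_module A) \<inter> extensional (carrier M),
     mult = undefined, one = undefined,
     zero = (\<lambda>m\<in>carrier M. \<zero>\<^bsub>A\<^esub>),
     add = (\<lambda>g h. \<lambda>m\<in>carrier M. g m \<oplus>\<^bsub>A\<^esub> h m),
     smult = (\<lambda>c h. \<lambda>m\<in>carrier M. c \<odot>\<^bsub>A\<^esub> h m)\<rparr>"

definition dual_cocycles ::
    "('k::field, 'a) module \<Rightarrow> (nat \<Rightarrow> ('a, 'p) module) \<Rightarrow> (nat \<Rightarrow> 'p \<Rightarrow> 'p) \<Rightarrow> nat \<Rightarrow> ('p \<Rightarrow> 'a) set" where
  "dual_cocycles A P \<delta> n =
    {h \<in> carrier (hom_to_algebra A (P n)). \<forall>y\<in>carrier (P (Suc n)). h (\<delta> n y) = \<zero>\<^bsub>A\<^esub>}"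

definition dual_coboundaries ::
    "('k::field, 'a) module \<Rightarrow> (nat \<Rightarrow> ('a, 'p) module) \<Rightarrow> (nat \<Rightarrow> 'p \<Rightarrow> 'p) \<Rightarrow> nat \<Rightarrow> ('p \<Rightarrow> 'a) set" where
  "dual_coboundaries A P \<delta> n =
    (case n of
       0 \<Rightarrow> {\<zero>\<^bsub>hom_to_algebra A (P 0)\<^esub>}
     | Suc i \<Rightarrow> (\<lambda>g. \<lambda>y\<in>carrier (P (Suc i)). g (\<delta> i y)) ` carrier (hom_to_algebra A (P i)))"

text \<open>
  \<open>Ext\<^sup>n\<^sub>A(M, A)\<close> is the \<open>n\<close>-th cohomology of \<open>Hom\<^sub>A(P, A)\<close> for a chosen projective resolution \<open>P\<close> of
  \<open>M\<close>.  The elements of the modules \<open>P n\<close> are taken from the type \<open>'p\<close>, which has to be large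
  enough for a resolution to exist.
\<close>

definition Ext_algebra ::
    "('k::field, 'a) module \<Rightarrow> ('a, 'm) module \<Rightarrow> nat \<Rightarrow> ('k, ('p \<Rightarrow> 'a) set) module" where
  "Ext_algebra A M n =
    (let (P, \<delta>, \<epsilon>) = (SOME (P :: nat \<Rightarrow> ('a, 'p) module, \<delta>, \<epsilon>). projective_resolution A M P \<delta> \<epsilon>)
     in quotient_module ((hom_to_algebra A (P n)) \<lparr>carrier := dual_cocycles A P \<delta> n\<rparr>)
          (dual_coboundaries A P \<delta> n))"


section \<open>Global dimension and the Gorenstein property\<close>

text \<open>The ideal \<open>\<Oplus>\<^sub>n\<^sub>\<ge>\<^sub>1 A\<^sub>n\<close>, i.e. the image of the elements of \<open>T(E)\<close> without constant term.\<close>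

definition augmentation_ideal :: "('k::field, 'a) module \<Rightarrow> ('q \<Rightarrow> 'a) \<Rightarrow> 'a set" where
  "augmentation_ideal A x = evaluate A x ` {f \<in> carrier tensor_algebra. f [] = 0}"

definition trivial_module :: "('k::field, 'a) module \<Rightarrow> ('q \<Rightarrow> 'a) \<Rightarrow> ('a, 'a set) module" where
  "trivial_module A x = quotient_module (regular_module A) (augmentation_ideal A x)"

text \<open>
  The modules in a resolution of the trivial module are taken with elements in \<open>'q list \<Rightarrow> 'a\<close>.  This
  is no restriction: \<open>A\<close> has countable dimension over the ground field, so the trivial module has a
  resolution by submodules of the free module on the (countably infinitely many) words, and by
  Schanuel's lemma the projective dimension is attained by such a resolution, cut off at a syzygy.
\<close>

definition global_dimension :: "('k::field, 'a) module \<Rightarrow> ('q \<Rightarrow> 'a) \<Rightarrow> enat" where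
  "global_dimension A x =
    Inf {enat d | d. \<exists>(P :: nat \<Rightarrow> ('a, 'q list \<Rightarrow> 'a) module) \<delta> \<epsilon>.
           projective_resolution A (trivial_module A x) P \<delta> \<epsilon> \<and>
           (\<forall>n>d. carrier (P n) = {\<zero>\<^bsub>P n\<^esub>})}"

definition gorenstein :: "('k::field, 'a) module \<Rightarrow> ('q \<Rightarrow> 'a) \<Rightarrow> nat \<Rightarrow> bool" where
  "gorenstein A x D \<longleftrightarrow>
    (let Ext = (Ext_algebra A (trivial_module A x) :: nat \<Rightarrow> ('k, (('q list \<Rightarrow> 'a) \<Rightarrow> 'a) set) module)
     in (\<forall>n. n \<noteq> D \<longrightarrow> carrier (Ext n) = {\<zero>\<^bsub>Ext n\<^esub>}) \<and>
        (\<exists>\<phi>. bij_betw \<phi> (carrier (Ext D)) (UNIV :: 'k set) \<and>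
             (\<forall>u\<in>carrier (Ext D). \<forall>v\<in>carrier (Ext D). \<phi> (u \<oplus>\<^bsub>Ext D\<^esub> v) = \<phi> u + \<phi> v) \<and>
             (\<forall>c. \<forall>u\<in>carrier (Ext D). \<phi> (c \<odot>\<^bsub>Ext D\<^esub> u) = c * \<phi> u)))"


section \<open>Multilinear forms and the algebra \<open>A(W, N)\<close>\<close>

text \<open>An \<open>m\<close>-linear form takes the list of its arguments; its values on lists of any length other
  than \<open>m\<close> are irrelevant.\<close>

definition multilinear_form :: "nat \<Rightarrow> (('k::field ^ 'q) list \<Rightarrow> 'k) \<Rightarrow> bool" where
  "multilinear_form m W \<longleftrightarrow>
    (\<forall>Xs. length Xs = m \<longrightarrow> (\<forall>i<m. Vector_Spaces.linear (*s) (*) (\<lambda>X. W (Xs[i := X]))))"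

definition preregular :: "nat \<Rightarrow> (('k::field ^ 'q) list \<Rightarrow> 'k) \<Rightarrow> bool" where
  "preregular m W \<longleftrightarrow>
    2 \<le> m \<and> multilinear_form m W \<and>
    (\<forall>X. (\<forall>Xs. length Xs = m - 1 \<longrightarrow> W (X # Xs) = 0) \<longrightarrow> X = 0) \<and>
    (\<exists>Q. Vector_Spaces.linear (*s) (*s) Q \<and> bij Q \<and>
         (\<forall>Xs X. length Xs = m - 1 \<longrightarrow> W (Xs @ [X]) = W (Q X # Xs)))"

definition form_component :: "(('k::field ^ 'q::finite) list \<Rightarrow> 'k) \<Rightarrow> 'q list \<Rightarrow> 'k" where
  "form_component W ls = W (map (\<lambda>i. axis i 1) ls)"

definition form_relations ::
    "nat \<Rightarrow> (('k::field ^ 'q::finite) list \<Rightarrow> 'k) \<Rightarrow> nat \<Rightarrow> ('q list \<Rightarrow> 'k) set" where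
  "form_relations m W N =
    tens.span {(\<lambda>ms. if length ms = N then form_component W (ls @ ms) else 0) | ls.
      length ls = m - N}"

text \<open>\<open>A = A(W, N)\<close>, with the basis \<open>x\<close> of \<open>A\<^sub>1\<close> regarded as the dual of the canonical basis of \<open>\<^bold>K\<^sup>q\<close>.\<close>

definition is_form_algebra ::
    "('k::field, 'a) module \<Rightarrow> ('q::finite \<Rightarrow> 'a) \<Rightarrow> nat \<Rightarrow> (('k ^ 'q) list \<Rightarrow> 'k) \<Rightarrow> nat \<Rightarrow> bool" where
  "is_form_algebra A x m W N \<longleftrightarrow>
    2 \<le> N \<and> N \<le> m \<and> (\<exists>Xs. length Xs = m \<and> W Xs \<noteq> 0) \<and> multilinear_form m W \<and>
    homogeneous_algebra N A x (form_relations m W N)"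

end

(*
  The Koszul complex C is a projective resolution of the trivial module, so by comparison of
  resolutions a homomorphism C_n -> A that vanishes on boundaries is a boundary for n ~= D, and any
  two such homomorphisms are dependent modulo boundaries for n = D. Boundaries take values in the
  augmentation ideal, since the differentials have positive degree. Applied to the functionals
  id (x) c with c in the dual of K_nu(n), this forces D to be the last degree with K_nu(D) ~= 0,
  makes K_nu(D) a line spanned by a tensor w of degree m = nu(D), and shows that for n < D the space
  K_nu(n) is spanned by the contractions of K_nu(n+1) on the left, hence by those of w. For n = 2
  this says that the relations are those of A(w, N), and for n = 1 that w is nondegenerate in its
  last argument. The homomorphism that sends w to a generator x^i is congruent to zero modulo
  boundaries, so x^i is of the form g(d w). By degree reasons the top differential is then linear in
  the generators, which means that D is odd or N = 2, and w is nondegenerate in its first argument.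
  Finally the contractions of w on the right lie in K_nu(D-1), which is spanned by the contractions
  on the left. This is the twisted cyclicity of w.
*)
theory Submission
  imports Defs
begin

section \<open>Left modules\<close>

text \<open>Two obstacles shape the proof. First, \<open>Ext_algebra\<close> is the cohomology of a
  resolution picked by \<open>SOME\<close>, about which only exactness and projectivity are known.
  No cohomology group is therefore computed: cocycles on the Koszul complex are pulled back to the
  chosen resolution, and coboundaries are brought back along a homotopy equivalence. Second,
  \<open>A\<close> is an abstract record without a grading. The degree is replaced by the
  functionals \<open>coef w\<close> for words shorter than \<open>N\<close>, which are well defined
  because the ideal of relations lives in length at least \<open>N\<close>. The argument rests on
  two of them: \<open>coef []\<close> is the augmentation, and \<open>coef [l]\<close> is a linear
  coefficient, a derivation with respect to the augmentation. Minimality of the Koszul complex means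
  that \<open>coef []\<close> kills all values of the differentials. Elements of
  \<open>A (x) K_n\<close> are functions on words; a linear projector onto \<open>K_n\<close>,
  written as a matrix of scalars, also acts on functions with values in \<open>A\<close>. This makes
  the modules projective and extends functionals from \<open>A (x) K_n\<close> to a free
  module.\<close>

lemma left_moduleI:
  assumes "ring A" "abelian_group M"
    and "\<And>a m. a \<in> carrier A \<Longrightarrow> m \<in> carrier M \<Longrightarrow> a \<odot>\<^bsub>M\<^esub> m \<in> carrier M"
    and "\<And>a b m. a \<in> carrier A \<Longrightarrow> b \<in> carrier A \<Longrightarrow> m \<in> carrier M \<Longrightarrow>
      (a \<oplus>\<^bsub>A\<^esub> b) \<odot>\<^bsub>M\<^esub> m = a \<odot>\<^bsub>M\<^esub> m \<oplus>\<^bsub>M\<^esub> b \<odot>\<^bsub>M\<^esub> m"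
    and "\<And>a m m'. a \<in> carrier A \<Longrightarrow> m \<in> carrier M \<Longrightarrow> m' \<in> carrier M \<Longrightarrow>
      a \<odot>\<^bsub>M\<^esub> (m \<oplus>\<^bsub>M\<^esub> m') = a \<odot>\<^bsub>M\<^esub> m \<oplus>\<^bsub>M\<^esub> a \<odot>\<^bsub>M\<^esub> m'"
    and "\<And>a b m. a \<in> carrier A \<Longrightarrow> b \<in> carrier A \<Longrightarrow> m \<in> carrier M \<Longrightarrow>
      (a \<otimes>\<^bsub>A\<^esub> b) \<odot>\<^bsub>M\<^esub> m = a \<odot>\<^bsub>M\<^esub> (b \<odot>\<^bsub>M\<^esub> m)"
    and "\<And>m. m \<in> carrier M \<Longrightarrow> \<one>\<^bsub>A\<^esub> \<odot>\<^bsub>M\<^esub> m = m"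
  shows "left_module A M"
  using assms by (simp add: left_module_def left_module_axioms_def)

context left_module
begin

text \<open>The assumptions of the locale carry no names; these are the names under which they are
  used.\<close>

lemma
  shows smult_closed [simp]: "a \<in> carrier A \<Longrightarrow> m \<in> carrier M \<Longrightarrow> a \<odot>\<^bsub>M\<^esub> m \<in> carrier M"
    and smult_l_distr: "a \<in> carrier A \<Longrightarrow> b \<in> carrier A \<Longrightarrow> m \<in> carrier M \<Longrightarrow>
      (a \<oplus>\<^bsub>A\<^esub> b) \<odot>\<^bsub>M\<^esub> m = a \<odot>\<^bsub>M\<^esub> m \<oplus>\<^bsub>M\<^esub> b \<odot>\<^bsub>M\<^esub> m"
    and smult_r_distr: "a \<in> carrier A \<Longrightarrow> m \<in> carrier M \<Longrightarrow> m' \<in> carrier M \<Longrightarrow>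
      a \<odot>\<^bsub>M\<^esub> (m \<oplus>\<^bsub>M\<^esub> m') = a \<odot>\<^bsub>M\<^esub> m \<oplus>\<^bsub>M\<^esub> a \<odot>\<^bsub>M\<^esub> m'"
    and smult_assoc: "a \<in> carrier A \<Longrightarrow> b \<in> carrier A \<Longrightarrow> m \<in> carrier M \<Longrightarrow>
      (a \<otimes>\<^bsub>A\<^esub> b) \<odot>\<^bsub>M\<^esub> m = a \<odot>\<^bsub>M\<^esub> (b \<odot>\<^bsub>M\<^esub> m)"
    and smult_one: "m \<in> carrier M \<Longrightarrow> \<one>\<^bsub>A\<^esub> \<odot>\<^bsub>M\<^esub> m = m"
  using left_module_axioms by (simp_all add: left_module_def left_module_axioms_def)

lemma smult_zero [simp]:
  assumes "m \<in> carrier M"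
  shows "\<zero>\<^bsub>A\<^esub> \<odot>\<^bsub>M\<^esub> m = \<zero>\<^bsub>M\<^esub>"
proof -
  have "\<zero>\<^bsub>A\<^esub> \<odot>\<^bsub>M\<^esub> m \<oplus>\<^bsub>M\<^esub> \<zero>\<^bsub>A\<^esub> \<odot>\<^bsub>M\<^esub> m = \<zero>\<^bsub>A\<^esub> \<odot>\<^bsub>M\<^esub> m \<oplus>\<^bsub>M\<^esub> \<zero>\<^bsub>M\<^esub>"
    using assms by (simp add: smult_l_distr[symmetric])
  then show ?thesis using assms by (metis M.add.l_cancel_one M.r_zero R.zero_closed smult_closed)
qed

lemma smult_r_zero [simp]:
  assumes "a \<in> carrier A"
  shows "a \<odot>\<^bsub>M\<^esub> \<zero>\<^bsub>M\<^esub> = \<zero>\<^bsub>M\<^esub>"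
proof -
  have "a \<odot>\<^bsub>M\<^esub> \<zero>\<^bsub>M\<^esub> \<oplus>\<^bsub>M\<^esub> a \<odot>\<^bsub>M\<^esub> \<zero>\<^bsub>M\<^esub> = a \<odot>\<^bsub>M\<^esub> \<zero>\<^bsub>M\<^esub> \<oplus>\<^bsub>M\<^esub> \<zero>\<^bsub>M\<^esub>"
    using assms by (simp add: smult_r_distr[symmetric])
  then show ?thesis using assms by (metis M.add.l_cancel_one M.r_zero M.zero_closed smult_closed)
qed

lemma smult_minus:
  assumes "a \<in> carrier A" "m \<in> carrier M"
  shows "a \<odot>\<^bsub>M\<^esub> (\<ominus>\<^bsub>M\<^esub> m) = \<ominus>\<^bsub>M\<^esub> (a \<odot>\<^bsub>M\<^esub> m)"
proof -
  have "a \<odot>\<^bsub>M\<^esub> (\<ominus>\<^bsub>M\<^esub> m) \<oplus>\<^bsub>M\<^esub> a \<odot>\<^bsub>M\<^esub> m = \<zero>\<^bsub>M\<^esub>"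
    using assms by (simp add: smult_r_distr[symmetric] M.l_neg)
  then show ?thesis using assms by (metis M.add.inv_equality M.a_inv_closed smult_closed)
qed

lemma smult_finsum:
  assumes "finite S" "f \<in> S \<rightarrow> carrier M" "a \<in> carrier A"
  shows "a \<odot>\<^bsub>M\<^esub> finsum M f S = finsum M (\<lambda>i. a \<odot>\<^bsub>M\<^esub> f i) S"
  using assms
proof (induction S rule: finite_induct)
  case (insert i S)
  then have "f \<in> S \<rightarrow> carrier M" "f i \<in> carrier M" by auto
  moreover from this insert have "(\<lambda>i. a \<odot>\<^bsub>M\<^esub> f i) \<in> S \<rightarrow> carrier M"
    by (simp add: Pi_iff)
  ultimately show ?case using insert by (simp add: smult_r_distr)
qed simp

end

lemma left_module_homI:
  assumes "\<And>m. m \<in> carrier M \<Longrightarrow> h m \<in> carrier L"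
    and "\<And>m m'. m \<in> carrier M \<Longrightarrow> m' \<in> carrier M \<Longrightarrow> h (m \<oplus>\<^bsub>M\<^esub> m') = h m \<oplus>\<^bsub>L\<^esub> h m'"
    and "\<And>a m. a \<in> carrier A \<Longrightarrow> m \<in> carrier M \<Longrightarrow> h (a \<odot>\<^bsub>M\<^esub> m) = a \<odot>\<^bsub>L\<^esub> h m"
  shows "h \<in> left_module_hom A M L"
  using assms by (auto simp: left_module_hom_def)

lemma left_module_homD:
  assumes "h \<in> left_module_hom A M L"
  shows "m \<in> carrier M \<Longrightarrow> h m \<in> carrier L"
    and "m \<in> carrier M \<Longrightarrow> m' \<in> carrier M \<Longrightarrow> h (m \<oplus>\<^bsub>M\<^esub> m') = h m \<oplus>\<^bsub>L\<^esub> h m'"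
    and "a \<in> carrier A \<Longrightarrow> m \<in> carrier M \<Longrightarrow> h (a \<odot>\<^bsub>M\<^esub> m) = a \<odot>\<^bsub>L\<^esub> h m"
  using assms by (auto simp: left_module_hom_def)

lemma left_module_hom_zero:
  assumes h: "h \<in> left_module_hom A M L" and "left_module A M" "left_module A L"
  shows "h \<zero>\<^bsub>M\<^esub> = \<zero>\<^bsub>L\<^esub>"
proof -
  interpret M: left_module A M by fact
  interpret L: left_module A L by fact
  have "h (\<zero>\<^bsub>A\<^esub> \<odot>\<^bsub>M\<^esub> \<zero>\<^bsub>M\<^esub>) = \<zero>\<^bsub>A\<^esub> \<odot>\<^bsub>L\<^esub> h \<zero>\<^bsub>M\<^esub>"
    using left_module_homD(3)[OF h, of "\<zero>\<^bsub>A\<^esub>" "\<zero>\<^bsub>M\<^esub>"] by simp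
  then show ?thesis using left_module_homD(1)[OF h, of "\<zero>\<^bsub>M\<^esub>"] by simp
qed

lemma left_module_hom_minus:
  assumes h: "h \<in> left_module_hom A M L" and "left_module A M" "left_module A L" and m: "m \<in> carrier M"
  shows "h (\<ominus>\<^bsub>M\<^esub> m) = \<ominus>\<^bsub>L\<^esub> h m"
proof -
  interpret M: left_module A M by fact
  interpret L: left_module A L by fact
  have "h (\<ominus>\<^bsub>M\<^esub> m) \<oplus>\<^bsub>L\<^esub> h m = \<zero>\<^bsub>L\<^esub>"
    using left_module_homD(2)[OF h, of "\<ominus>\<^bsub>M\<^esub> m" m] m left_module_hom_zero[OF assms(1-3)]
    by (simp add: M.M.l_neg)
  then show ?thesis using m left_module_homD(1)[OF h] by (metis L.M.add.inv_equality M.M.a_inv_closed)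
qed

lemma left_module_hom_diff:
  assumes h: "h \<in> left_module_hom A M L" and "left_module A M" "left_module A L"
    and m: "m \<in> carrier M" "m' \<in> carrier M"
  shows "h (m \<ominus>\<^bsub>M\<^esub> m') = h m \<ominus>\<^bsub>L\<^esub> h m'"
proof -
  interpret M: left_module A M by fact
  interpret L: left_module A L by fact
  show ?thesis
    using left_module_homD(2)[OF h, of m "\<ominus>\<^bsub>M\<^esub> m'"] m left_module_hom_minus[OF assms(1-3)]
    by (simp add: a_minus_def)
qed

lemma left_module_hom_finsum:
  assumes h: "h \<in> left_module_hom A M L" and "left_module A M" "left_module A L"
    and "finite S" "f \<in> S \<rightarrow> carrier M"
  shows "h (finsum M f S) = finsum L (\<lambda>i. h (f i)) S"
proof -
  interpret M: left_module A M by fact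
  interpret L: left_module A L by fact
  show ?thesis using assms(4,5)
  proof (induction S rule: finite_induct)
    case empty
    then show ?case using left_module_hom_zero[OF assms(1-3)] by simp
  next
    case (insert i S)
    then have "f \<in> S \<rightarrow> carrier M" "f i \<in> carrier M" by auto
    moreover from this have "(\<lambda>i. h (f i)) \<in> S \<rightarrow> carrier L" "h (f i) \<in> carrier L"
      using left_module_homD(1)[OF h] by auto
    ultimately show ?case using insert left_module_homD(2)[OF h] by simp
  qed
qed

lemma left_module_hom_comp:
  assumes "g \<in> left_module_hom A M L" "h \<in> left_module_hom A L L'"
  shows "(\<lambda>m. h (g m)) \<in> left_module_hom A M L'"
  using assms by (simp add: left_module_hom_def Pi_iff)

lemma left_module_hom_sub:
  assumes g: "g \<in> left_module_hom A M L" and h: "h \<in> left_module_hom A M L" and L: "left_module A L"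
  shows "(\<lambda>m. g m \<ominus>\<^bsub>L\<^esub> h m) \<in> left_module_hom A M L"
proof -
  interpret L: left_module A L by fact
  note gD = left_module_homD[OF g] and hD = left_module_homD[OF h]
  show ?thesis
  proof (rule left_module_homI)
    fix m m' assume m: "m \<in> carrier M" "m' \<in> carrier M"
    show "g m \<ominus>\<^bsub>L\<^esub> h m \<in> carrier L" using m gD hD by simp
    show "g (m \<oplus>\<^bsub>M\<^esub> m') \<ominus>\<^bsub>L\<^esub> h (m \<oplus>\<^bsub>M\<^esub> m') = (g m \<ominus>\<^bsub>L\<^esub> h m) \<oplus>\<^bsub>L\<^esub> (g m' \<ominus>\<^bsub>L\<^esub> h m')"
      using m gD hD by (simp add: a_minus_def L.M.minus_add L.M.a_ac)
  next
    fix a m assume m: "a \<in> carrier A" "m \<in> carrier M"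
    show "g (a \<odot>\<^bsub>M\<^esub> m) \<ominus>\<^bsub>L\<^esub> h (a \<odot>\<^bsub>M\<^esub> m) = a \<odot>\<^bsub>L\<^esub> (g m \<ominus>\<^bsub>L\<^esub> h m)"
      using m gD hD by (simp add: a_minus_def L.smult_r_distr L.smult_minus)
  qed
qed

lemma left_module_regular:
  assumes "ring A"
  shows "left_module A (regular_module A)"
proof -
  interpret ring A by fact
  have "abelian_group (regular_module A)"
  proof (rule abelian_groupI)
    fix a assume "a \<in> carrier (regular_module A)"
    then show "\<exists>b\<in>carrier (regular_module A). b \<oplus>\<^bsub>regular_module A\<^esub> a = \<zero>\<^bsub>regular_module A\<^esub>"
      by (intro bexI[of _ "\<ominus>\<^bsub>A\<^esub> a"]) (simp_all add: regular_module_def l_neg)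
  qed (simp_all add: regular_module_def a_ac)
  then show ?thesis
    by (intro left_moduleI) (simp_all add: regular_module_def assms l_distr r_distr m_assoc)
qed

section \<open>Free and projective modules\<close>

lemma free_module_carrier:
  "f \<in> carrier (free_module A X) \<longleftrightarrow>
    (\<forall>i. f i \<in> carrier A) \<and> finite {i. f i \<noteq> \<zero>\<^bsub>A\<^esub>} \<and> (\<forall>i. f i \<noteq> \<zero>\<^bsub>A\<^esub> \<longrightarrow> i \<in> X)"
  by (auto simp: free_module_def)

lemma free_module_ops:
  "\<zero>\<^bsub>free_module A X\<^esub> = (\<lambda>i. \<zero>\<^bsub>A\<^esub>)"
  "f \<oplus>\<^bsub>free_module A X\<^esub> g = (\<lambda>i. f i \<oplus>\<^bsub>A\<^esub> g i)"
  "a \<odot>\<^bsub>free_module A X\<^esub> f = (\<lambda>i. a \<otimes>\<^bsub>A\<^esub> f i)"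
  by (simp_all add: free_module_def)

lemma left_module_free:
  assumes "ring A"
  shows "left_module A (free_module A X)"
proof -
  interpret ring A by fact
  have add: "(\<lambda>i. f i \<oplus>\<^bsub>A\<^esub> g i) \<in> carrier (free_module A X)"
    if f: "f \<in> carrier (free_module A X)" and g: "g \<in> carrier (free_module A X)" for f g
  proof -
    have *: "f i \<noteq> \<zero>\<^bsub>A\<^esub> \<or> g i \<noteq> \<zero>\<^bsub>A\<^esub>" if "f i \<oplus>\<^bsub>A\<^esub> g i \<noteq> \<zero>\<^bsub>A\<^esub>" for i
      using that by (metis r_zero zero_closed)
    have "finite {i. f i \<oplus>\<^bsub>A\<^esub> g i \<noteq> \<zero>\<^bsub>A\<^esub>}"
      by (rule finite_subset[of _ "{i. f i \<noteq> \<zero>\<^bsub>A\<^esub>} \<union> {i. g i \<noteq> \<zero>\<^bsub>A\<^esub>}"])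
        (use * f g in \<open>auto simp: free_module_carrier\<close>)
    then show ?thesis using f g * unfolding free_module_carrier by blast
  qed
  have smult: "(\<lambda>i. a \<otimes>\<^bsub>A\<^esub> f i) \<in> carrier (free_module A X)"
    if f: "f \<in> carrier (free_module A X)" and a: "a \<in> carrier A" for a f
  proof -
    have *: "f i \<noteq> \<zero>\<^bsub>A\<^esub>" if "a \<otimes>\<^bsub>A\<^esub> f i \<noteq> \<zero>\<^bsub>A\<^esub>" for i
      using that a by (metis r_null)
    have "finite {i. a \<otimes>\<^bsub>A\<^esub> f i \<noteq> \<zero>\<^bsub>A\<^esub>}"
      by (rule finite_subset[of _ "{i. f i \<noteq> \<zero>\<^bsub>A\<^esub>}"]) (use * f in \<open>auto simp: free_module_carrier\<close>)
    then show ?thesis using f a * by (simp add: free_module_carrier)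
  qed
  have neg: "(\<lambda>i. \<ominus>\<^bsub>A\<^esub> f i) \<in> carrier (free_module A X)"
    if f: "f \<in> carrier (free_module A X)" for f
  proof -
    have *: "f i \<noteq> \<zero>\<^bsub>A\<^esub>" if "\<ominus>\<^bsub>A\<^esub> f i \<noteq> \<zero>\<^bsub>A\<^esub>" for i
      using that by (metis minus_zero)
    have "finite {i. \<ominus>\<^bsub>A\<^esub> f i \<noteq> \<zero>\<^bsub>A\<^esub>}"
      by (rule finite_subset[of _ "{i. f i \<noteq> \<zero>\<^bsub>A\<^esub>}"]) (use * f in \<open>auto simp: free_module_carrier\<close>)
    then show ?thesis using f * by (simp add: free_module_carrier)
  qed
  have "abelian_group (free_module A X)"
  proof (rule abelian_groupI)
    fix f assume f: "f \<in> carrier (free_module A X)"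
    then show "\<exists>g\<in>carrier (free_module A X). g \<oplus>\<^bsub>free_module A X\<^esub> f = \<zero>\<^bsub>free_module A X\<^esub>"
      by (intro bexI[OF _ neg[OF f]]) (simp add: free_module_ops free_module_carrier l_neg)
  next
    fix f g assume "f \<in> carrier (free_module A X)" "g \<in> carrier (free_module A X)"
    then show "f \<oplus>\<^bsub>free_module A X\<^esub> g \<in> carrier (free_module A X)"
      using add[of f g] by (simp add: free_module_ops)
  qed (simp_all add: free_module_ops free_module_carrier a_ac)
  then show ?thesis
    using smult
    by (intro left_moduleI) (simp_all add: free_module_ops free_module_carrier assms l_distr r_distr m_assoc)
qed

definition free_unit :: "('a, 'z) ring_scheme \<Rightarrow> 'x \<Rightarrow> 'x \<Rightarrow> 'a" where
  "free_unit A i = (\<lambda>j. if j = i then \<one>\<^bsub>A\<^esub> else \<zero>\<^bsub>A\<^esub>)"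

lemma free_unit_closed:
  assumes "ring A" "i \<in> X"
  shows "free_unit A i \<in> carrier (free_module A X)"
proof -
  interpret ring A by fact
  have "finite {j. free_unit A i j \<noteq> \<zero>\<^bsub>A\<^esub>}"
    by (rule finite_subset[of _ "{i}"]) (auto simp: free_unit_def)
  then show ?thesis using assms(2) by (auto simp: free_module_def free_unit_def)
qed

text \<open>Induction on \<open>S\<close> strips one coordinate at a time, which is why
  \<open>S\<close> is any finite set between the support and \<open>X\<close> and not the support
  itself.\<close>

lemma free_module_hom_eval:
  assumes k: "k \<in> left_module_hom A (free_module A X) M" and M: "left_module A M"
    and f: "f \<in> carrier (free_module A X)"
    and S: "finite S" "{i. f i \<noteq> \<zero>\<^bsub>A\<^esub>} \<subseteq> S" "S \<subseteq> X"
  shows "k f = finsum M (\<lambda>i. f i \<odot>\<^bsub>M\<^esub> k (free_unit A i)) S"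
proof -
  interpret M: left_module A M by fact
  let ?F = "free_module A X"
  have "ring A" by (rule M.R.ring_axioms)
  interpret F: left_module A ?F by (rule left_module_free) fact
  note kD = left_module_homD[OF k]
  show ?thesis
    using S f
  proof (induction S arbitrary: f rule: finite_induct)
    case empty
    then have "f = \<zero>\<^bsub>?F\<^esub>" by (auto simp: free_module_def)
    then show ?case using left_module_hom_zero[OF k F.left_module_axioms M] by simp
  next
    case (insert i S)
    let ?g = "f(i := \<zero>\<^bsub>A\<^esub>)"
    have fi: "f i \<in> carrier A" "i \<in> X" using insert.prems by (auto simp: free_module_def)
    have u: "free_unit A i \<in> carrier ?F" by (rule free_unit_closed) fact+
    have "finite {j. ?g j \<noteq> \<zero>\<^bsub>A\<^esub>}"
      by (rule finite_subset[OF _ \<open>finite S\<close>]) (use insert.prems in auto)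
    then have g: "?g \<in> carrier ?F" "{j. ?g j \<noteq> \<zero>\<^bsub>A\<^esub>} \<subseteq> S"
      using insert.prems by (auto simp: free_module_def split: if_splits)
    have feq: "f = ?g \<oplus>\<^bsub>?F\<^esub> f i \<odot>\<^bsub>?F\<^esub> free_unit A i"
      using insert.prems by (auto simp: free_module_def free_unit_def fun_eq_iff)
    have "k (free_unit A j) \<in> carrier M" if "j \<in> S" for j
      using that insert.prems by (intro kD(1) free_unit_closed[OF \<open>ring A\<close>]) auto
    moreover have "f j \<in> carrier A" for j using insert.prems by (auto simp: free_module_def)
    ultimately have mem: "(\<lambda>j. f j \<odot>\<^bsub>M\<^esub> k (free_unit A j)) \<in> S \<rightarrow> carrier M" by auto
    have "k f = k ?g \<oplus>\<^bsub>M\<^esub> f i \<odot>\<^bsub>M\<^esub> k (free_unit A i)"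
      by (subst feq, subst kD(2)) (use g u fi kD(3) in \<open>auto simp del: fun_upd_apply simp: F.smult_closed\<close>)
    also have "k ?g = finsum M (\<lambda>i. ?g i \<odot>\<^bsub>M\<^esub> k (free_unit A i)) S"
      by (rule insert.IH[OF g(2) _ g(1)]) (use insert.prems in auto)
    also have "\<dots> = finsum M (\<lambda>i. f i \<odot>\<^bsub>M\<^esub> k (free_unit A i)) S"
      by (rule M.M.finsum_cong') (use mem insert.hyps in auto)
    finally show ?case
      using insert.hyps mem fi u kD(1) by (simp add: M.M.finsum_insert M.M.a_comm M.M.finsum_closed)
  qed
qed

text \<open>The universal property of the free module: prescribed images \<open>y i\<close> of the
  unit vectors extend linearly.\<close>

lemma free_module_lift:
  assumes L: "left_module A L" and y: "\<And>i. i \<in> X \<Longrightarrow> y i \<in> carrier L"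
  shows "(\<lambda>f. finsum L (\<lambda>i. f i \<odot>\<^bsub>L\<^esub> y i) {i. f i \<noteq> \<zero>\<^bsub>A\<^esub>}) \<in> left_module_hom A (free_module A X) L"
    (is "?h \<in> _")
proof -
  interpret L: left_module A L by fact
  let ?F = "free_module A X"
  interpret F: left_module A ?F by (rule left_module_free) (rule L.R.ring_axioms)
  have fin: "finite {i. f i \<noteq> \<zero>\<^bsub>A\<^esub>}" "{i. f i \<noteq> \<zero>\<^bsub>A\<^esub>} \<subseteq> X" "\<And>i. f i \<in> carrier A" if "f \<in> carrier ?F" for f
    using that by (auto simp: free_module_def)
  have mem: "(\<lambda>i. f i \<odot>\<^bsub>L\<^esub> y i) \<in> S \<rightarrow> carrier L" if "f \<in> carrier ?F" "S \<subseteq> X" for f S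
    using fin[OF that(1)] that(2) y by auto
  \<comment> \<open>Additivity compares sums over three different supports; this allows all of them
    to be taken over one common finite set.\<close>
  have ext: "?h f = finsum L (\<lambda>i. f i \<odot>\<^bsub>L\<^esub> y i) S"
    if f: "f \<in> carrier ?F" and S: "finite S" "S \<subseteq> X" "{i. f i \<noteq> \<zero>\<^bsub>A\<^esub>} \<subseteq> S" for f S
    by (rule L.M.add.finprod_mono_neutral_cong_left) (use fin[OF f] mem[OF f] S y in auto)
  show ?thesis
  proof (rule left_module_homI)
    fix f assume "f \<in> carrier ?F"
    then show "?h f \<in> carrier L" using mem fin by (intro L.M.finsum_closed) auto
  next
    fix f g assume f: "f \<in> carrier ?F" and g: "g \<in> carrier ?F"
    let ?S = "{i. f i \<noteq> \<zero>\<^bsub>A\<^esub>} \<union> {i. g i \<noteq> \<zero>\<^bsub>A\<^esub>}"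
    have S: "finite ?S" "?S \<subseteq> X" using fin[OF f] fin[OF g] by auto
    have fg: "(f \<oplus>\<^bsub>?F\<^esub> g) i = f i \<oplus>\<^bsub>A\<^esub> g i" for i by (simp add: free_module_def)
    have "?h (f \<oplus>\<^bsub>?F\<^esub> g) = finsum L (\<lambda>i. (f \<oplus>\<^bsub>?F\<^esub> g) i \<odot>\<^bsub>L\<^esub> y i) ?S"
      by (rule ext[OF F.M.a_closed[OF f g] S]) (auto simp: fg)
    also have "\<dots> = finsum L (\<lambda>i. f i \<odot>\<^bsub>L\<^esub> y i \<oplus>\<^bsub>L\<^esub> g i \<odot>\<^bsub>L\<^esub> y i) ?S"
      using S y fin[OF f] fin[OF g] mem[OF f] mem[OF g]
      by (intro L.M.finsum_cong') (auto simp: fg L.smult_l_distr subset_iff)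
    also have "\<dots> = finsum L (\<lambda>i. f i \<odot>\<^bsub>L\<^esub> y i) ?S \<oplus>\<^bsub>L\<^esub> finsum L (\<lambda>i. g i \<odot>\<^bsub>L\<^esub> y i) ?S"
      by (rule L.M.finsum_addf) (rule mem[OF f S(2)], rule mem[OF g S(2)])
    also have "finsum L (\<lambda>i. f i \<odot>\<^bsub>L\<^esub> y i) ?S = ?h f"
      by (rule ext[OF f S, symmetric]) auto
    also have "finsum L (\<lambda>i. g i \<odot>\<^bsub>L\<^esub> y i) ?S = ?h g"
      by (rule ext[OF g S, symmetric]) auto
    finally show "?h (f \<oplus>\<^bsub>?F\<^esub> g) = ?h f \<oplus>\<^bsub>L\<^esub> ?h g" .
  next
    fix a f assume a: "a \<in> carrier A" and f: "f \<in> carrier ?F"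
    let ?S = "{i. f i \<noteq> \<zero>\<^bsub>A\<^esub>}"
    have fg: "(a \<odot>\<^bsub>?F\<^esub> f) i = a \<otimes>\<^bsub>A\<^esub> f i" for i by (simp add: free_module_def)
    have "?h (a \<odot>\<^bsub>?F\<^esub> f) = finsum L (\<lambda>i. (a \<odot>\<^bsub>?F\<^esub> f) i \<odot>\<^bsub>L\<^esub> y i) ?S"
      by (rule ext[OF F.smult_closed[OF a f]]) (use a fin[OF f] in \<open>auto simp: fg\<close>)
    also have "\<dots> = finsum L (\<lambda>i. a \<odot>\<^bsub>L\<^esub> (f i \<odot>\<^bsub>L\<^esub> y i)) ?S"
      using a fin[OF f] mem[OF f] y by (intro L.M.finsum_cong') (auto simp: fg L.smult_assoc subset_iff)
    also have "\<dots> = a \<odot>\<^bsub>L\<^esub> ?h f"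
      using a fin[OF f] mem[OF f] by (intro L.smult_finsum[symmetric]) auto
    finally show "?h (a \<odot>\<^bsub>?F\<^esub> f) = a \<odot>\<^bsub>L\<^esub> ?h f" .
  qed
qed

text \<open>The image of \<open>h\<close> is only required to lie in the image of \<open>g\<close>,
  so that the lemma applies to a differential mapping onto the cycles without making the cycles a
  module. Preimages \<open>y i\<close> are chosen for the unit vectors of a free module of which
  \<open>P\<close> is a summand, extended linearly, and restricted along
  \<open>\<iota>\<close>.\<close>

lemma projective_lift:
  assumes P: "projective_module A P" and L: "left_module A L" and M: "left_module A M"
    and g: "g \<in> left_module_hom A L M" and h: "h \<in> left_module_hom A P M"
    and sub: "\<And>p. p \<in> carrier P \<Longrightarrow> h p \<in> g ` carrier L"
  shows "\<exists>h'\<in>left_module_hom A P L. \<forall>p\<in>carrier P. g (h' p) = h p"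
proof -
  interpret L: left_module A L by fact
  interpret M: left_module A M by fact
  from P obtain X :: "'c set" and \<iota> \<pi> where
    \<iota>: "\<iota> \<in> left_module_hom A P (free_module A X)" and \<pi>: "\<pi> \<in> left_module_hom A (free_module A X) P"
    and \<pi>\<iota>: "\<And>m. m \<in> carrier P \<Longrightarrow> \<pi> (\<iota> m) = m"
    unfolding projective_module_def by blast
  note hp = left_module_hom_comp[OF \<pi> h]
  have "\<exists>y\<in>carrier L. g y = h (\<pi> (free_unit A i))" if "i \<in> X" for i
    using sub[OF left_module_homD(1)[OF \<pi> free_unit_closed[OF L.R.ring_axioms that]]] by force
  then obtain y where y: "\<And>i. i \<in> X \<Longrightarrow> y i \<in> carrier L \<and> g (y i) = h (\<pi> (free_unit A i))"
    by metis
  let ?k = "\<lambda>f. finsum L (\<lambda>i. f i \<odot>\<^bsub>L\<^esub> y i) {i. f i \<noteq> \<zero>\<^bsub>A\<^esub>}"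
  have k: "?k \<in> left_module_hom A (free_module A X) L"
    by (rule free_module_lift) (use L y in auto)
  show ?thesis
  proof (intro bexI ballI)
    show "(\<lambda>p. ?k (\<iota> p)) \<in> left_module_hom A P L" by (rule left_module_hom_comp[OF \<iota> k])
  next
    fix p assume p: "p \<in> carrier P"
    let ?f = "\<iota> p"
    let ?S = "{i. ?f i \<noteq> \<zero>\<^bsub>A\<^esub>}"
    have f: "?f \<in> carrier (free_module A X)" using left_module_homD(1)[OF \<iota> p] .
    then have S: "finite ?S" "?S \<subseteq> X" "\<And>i. ?f i \<in> carrier A" by (auto simp: free_module_def)
    have "g (?k ?f) = finsum M (\<lambda>i. g (?f i \<odot>\<^bsub>L\<^esub> y i)) ?S"
      by (rule left_module_hom_finsum[OF g L M]) (use S y in auto)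
    also have "\<dots> = finsum M (\<lambda>i. ?f i \<odot>\<^bsub>M\<^esub> h (\<pi> (free_unit A i))) ?S"
      using S y left_module_homD(3)[OF g] left_module_homD(1)[OF g] left_module_homD(1)[OF hp free_unit_closed[OF L.R.ring_axioms]]
      by (intro M.M.finsum_cong') (auto simp: subset_iff)
    also have "\<dots> = h (\<pi> ?f)"
      by (rule free_module_hom_eval[OF hp M f, symmetric]) (use S in auto)
    finally show "g (?k ?f) = h p" using \<pi>\<iota>[OF p] by simp
  qed
qed

section \<open>Comparison of projective resolutions\<close>

lemma (in abelian_group) minus_self: "x \<in> carrier G \<Longrightarrow> x \<ominus> x = \<zero>"
  by (simp add: a_minus_def r_neg)

lemma (in abelian_group) diff_zero: "x \<in> carrier G \<Longrightarrow> x \<ominus> \<zero> = x"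
  by (simp add: a_minus_def)

text \<open>Each exactness condition is split into its two inclusions, in a form usable as
  rules.\<close>

lemma projective_resolutionD:
  fixes M :: "('a, 'm) module" and P :: "nat \<Rightarrow> ('a, 'p) module"
  assumes res: "projective_resolution A M P \<delta> \<epsilon>"
  shows "projective_module A (P n)" "left_module A (P n)"
    "\<delta> n \<in> left_module_hom A (P (Suc n)) (P n)"
    "\<epsilon> \<in> left_module_hom A (P 0) M"
    "\<epsilon> ` carrier (P 0) = carrier M"
    "y \<in> carrier (P 0) \<Longrightarrow> \<epsilon> y = \<zero>\<^bsub>M\<^esub> \<Longrightarrow> y \<in> \<delta> 0 ` carrier (P (Suc 0))"
    "y \<in> carrier (P (Suc n)) \<Longrightarrow> \<delta> n y = \<zero>\<^bsub>P n\<^esub> \<Longrightarrow> y \<in> \<delta> (Suc n) ` carrier (P (Suc (Suc n)))"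
    "y \<in> carrier (P (Suc 0)) \<Longrightarrow> \<epsilon> (\<delta> 0 y) = \<zero>\<^bsub>M\<^esub>"
    "y \<in> carrier (P (Suc (Suc n))) \<Longrightarrow> \<delta> n (\<delta> (Suc n) y) = \<zero>\<^bsub>P n\<^esub>"
proof -
  from res have proj: "\<And>n. projective_module A (P n)"
    and hom: "\<And>n. \<delta> n \<in> left_module_hom A (P (Suc n)) (P n)"
    and eps: "\<epsilon> \<in> left_module_hom A (P 0) M" "\<epsilon> ` carrier (P 0) = carrier M"
    and ex0: "{y \<in> carrier (P 0). \<epsilon> y = \<zero>\<^bsub>M\<^esub>} = \<delta> 0 ` carrier (P (Suc 0))"
    and ex: "\<And>n. {y \<in> carrier (P (Suc n)). \<delta> n y = \<zero>\<^bsub>P n\<^esub>} = \<delta> (Suc n) ` carrier (P (Suc (Suc n)))"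
    unfolding projective_resolution_def by (simp_all only: One_nat_def)
  show "projective_module A (P n)" "left_module A (P n)"
    "\<delta> n \<in> left_module_hom A (P (Suc n)) (P n)" "\<epsilon> \<in> left_module_hom A (P 0) M"
    "\<epsilon> ` carrier (P 0) = carrier M"
    using proj hom eps by (auto simp: projective_module_def)
  show "y \<in> carrier (P 0) \<Longrightarrow> \<epsilon> y = \<zero>\<^bsub>M\<^esub> \<Longrightarrow> y \<in> \<delta> 0 ` carrier (P (Suc 0))"
    "y \<in> carrier (P (Suc 0)) \<Longrightarrow> \<epsilon> (\<delta> 0 y) = \<zero>\<^bsub>M\<^esub>"
    using ex0 by blast+
  show "y \<in> carrier (P (Suc n)) \<Longrightarrow> \<delta> n y = \<zero>\<^bsub>P n\<^esub> \<Longrightarrow> y \<in> \<delta> (Suc n) ` carrier (P (Suc (Suc n)))"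
    "y \<in> carrier (P (Suc (Suc n))) \<Longrightarrow> \<delta> n (\<delta> (Suc n) y) = \<zero>\<^bsub>P n\<^esub>"
    using ex[of n] by blast+
qed

text \<open>A resolution does not presuppose that the resolved object is a module, so the axioms are
  transported along the surjection. That \<open>h\<close> preserves zero is a premise because it
  follows from additivity only once \<open>M\<close> is known to be a group.\<close>

lemma left_module_hom_image:
  assumes P: "left_module A P" and h: "h \<in> left_module_hom A P M"
    and onto: "h ` carrier P = carrier M" and zero: "h \<zero>\<^bsub>P\<^esub> = \<zero>\<^bsub>M\<^esub>"
  shows "left_module A M"
proof -
  interpret P: left_module A P by fact
  note hD = left_module_homD[OF h]
  have lift: "\<exists>p\<in>carrier P. m = h p" if "m \<in> carrier M" for m
    using that onto by blast
  have "abelian_group M"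
  proof (rule abelian_groupI)
    fix m assume "m \<in> carrier M"
    then obtain p where p: "p \<in> carrier P" "m = h p" using lift by blast
    then show "\<exists>m'\<in>carrier M. m' \<oplus>\<^bsub>M\<^esub> m = \<zero>\<^bsub>M\<^esub>"
      using hD(1)[of "\<ominus>\<^bsub>P\<^esub> p"] hD(2)[of "\<ominus>\<^bsub>P\<^esub> p" p] zero
      by (intro bexI[of _ "h (\<ominus>\<^bsub>P\<^esub> p)"]) (auto simp: P.M.l_neg)
  next
    fix m m' assume "m \<in> carrier M" "m' \<in> carrier M"
    then obtain p p' where p: "p \<in> carrier P" "m = h p" "p' \<in> carrier P" "m' = h p'" using lift by meson
    then show "m \<oplus>\<^bsub>M\<^esub> m' \<in> carrier M" "m \<oplus>\<^bsub>M\<^esub> m' = m' \<oplus>\<^bsub>M\<^esub> m"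
      using hD(1)[of "p \<oplus>\<^bsub>P\<^esub> p'"] by (auto simp: hD(2)[symmetric] P.M.a_comm)
  next
    fix m m' m'' assume "m \<in> carrier M" "m' \<in> carrier M" "m'' \<in> carrier M"
    then obtain p p' p'' where "p \<in> carrier P" "m = h p" "p' \<in> carrier P" "m' = h p'"
      "p'' \<in> carrier P" "m'' = h p''" using lift by meson
    then show "m \<oplus>\<^bsub>M\<^esub> m' \<oplus>\<^bsub>M\<^esub> m'' = m \<oplus>\<^bsub>M\<^esub> (m' \<oplus>\<^bsub>M\<^esub> m'')"
      by (auto simp: hD(2)[symmetric] P.M.a_assoc)
  next
    show "\<zero>\<^bsub>M\<^esub> \<in> carrier M" using hD(1)[of "\<zero>\<^bsub>P\<^esub>"] zero by simp
  next
    fix m assume "m \<in> carrier M"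
    then obtain p where p: "p \<in> carrier P" "m = h p" using lift by blast
    then show "\<zero>\<^bsub>M\<^esub> \<oplus>\<^bsub>M\<^esub> m = m" by (simp add: zero[symmetric] hD(2)[symmetric])
  qed
  then show ?thesis
  proof (rule left_moduleI[OF P.R.ring_axioms])
    fix a m assume a: "a \<in> carrier A" and "m \<in> carrier M"
    then obtain p where p: "p \<in> carrier P" "m = h p" using lift by blast
    show "a \<odot>\<^bsub>M\<^esub> m \<in> carrier M" using p a hD(1)[of "a \<odot>\<^bsub>P\<^esub> p"] by (simp add: hD(3)[symmetric])
    fix m' assume "m' \<in> carrier M"
    then obtain p' where p': "p' \<in> carrier P" "m' = h p'" using lift by blast
    show "a \<odot>\<^bsub>M\<^esub> (m \<oplus>\<^bsub>M\<^esub> m') = a \<odot>\<^bsub>M\<^esub> m \<oplus>\<^bsub>M\<^esub> a \<odot>\<^bsub>M\<^esub> m'"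
      using p p' a by (simp add: hD(2,3)[symmetric] P.smult_r_distr)
  next
    fix a b m assume ab: "a \<in> carrier A" "b \<in> carrier A" and "m \<in> carrier M"
    then obtain p where p: "p \<in> carrier P" "m = h p" using lift by blast
    show "(a \<oplus>\<^bsub>A\<^esub> b) \<odot>\<^bsub>M\<^esub> m = a \<odot>\<^bsub>M\<^esub> m \<oplus>\<^bsub>M\<^esub> b \<odot>\<^bsub>M\<^esub> m"
      using p ab by (simp add: hD(2,3)[symmetric] P.smult_l_distr)
    show "(a \<otimes>\<^bsub>A\<^esub> b) \<odot>\<^bsub>M\<^esub> m = a \<odot>\<^bsub>M\<^esub> (b \<odot>\<^bsub>M\<^esub> m)"
      using p ab by (simp add: hD(2,3)[symmetric] P.smult_assoc)
  next
    fix m assume "m \<in> carrier M"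
    then obtain p where p: "p \<in> carrier P" "m = h p" using lift by blast
    then show "\<one>\<^bsub>A\<^esub> \<odot>\<^bsub>M\<^esub> m = m" by (simp add: hD(3)[symmetric] P.smult_one)
  qed
qed

lemma left_module_resolved:
  assumes res: "projective_resolution A M P \<delta> \<epsilon>"
  shows "left_module A M"
proof -
  note D = projective_resolutionD[OF res]
  interpret P0: left_module A "P 0" by (rule D)
  interpret P1: left_module A "P (Suc 0)" by (rule D)
  \<comment> \<open>Zero of \<open>P 0\<close> is the image of zero under the first differential,
    hence a cycle by exactness.\<close>
  have "\<epsilon> \<zero>\<^bsub>P 0\<^esub> = \<zero>\<^bsub>M\<^esub>"
    using D(8)[of "\<zero>\<^bsub>P (Suc 0)\<^esub>"] left_module_hom_zero[OF D(3)[of 0]]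
    by (simp add: D)
  then show ?thesis using D by (intro left_module_hom_image[OF _ D(4,5)]) auto
qed

lemma resolution_chain_map:
  assumes P: "projective_resolution A M P \<delta> \<epsilon>" and Q: "projective_resolution A M Q \<delta>' \<eta>"
  obtains F where "\<And>n. F n \<in> left_module_hom A (P n) (Q n)"
    and "\<And>p. p \<in> carrier (P 0) \<Longrightarrow> \<eta> (F 0 p) = \<epsilon> p"
    and "\<And>n p. p \<in> carrier (P (Suc n)) \<Longrightarrow> \<delta>' n (F (Suc n) p) = F n (\<delta> n p)"
proof -
  note PD = projective_resolutionD[OF P] and QD = projective_resolutionD[OF Q]
  have M: "left_module A M" using left_module_resolved[OF P] .
  \<comment> \<open>The invariant of the dependent choice: besides being a homomorphism,
    \<open>f\<close> sends boundaries to boundaries, which is exactly what lifting the next map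
    requires.\<close>
  define S where "S n f \<longleftrightarrow> f \<in> left_module_hom A (P n) (Q n) \<and>
    (\<forall>p\<in>carrier (P (Suc n)). f (\<delta> n p) \<in> \<delta>' n ` carrier (Q (Suc n)))
    \<and> (n = 0 \<longrightarrow> (\<forall>p\<in>carrier (P 0). \<eta> (f p) = \<epsilon> p))" for n f
  have "\<exists>F. \<forall>n. S n (F n) \<and> (\<forall>p\<in>carrier (P (Suc n)). \<delta>' n (F (Suc n) p) = F n (\<delta> n p))"
  proof (rule dependent_nat_choice)
    have "\<exists>f\<in>left_module_hom A (P 0) (Q 0). \<forall>p\<in>carrier (P 0). \<eta> (f p) = \<epsilon> p"
      by (rule projective_lift[OF PD(1) QD(2) M QD(4) PD(4)])
        (use PD(5) QD(5) in auto)
    then obtain f where f: "f \<in> left_module_hom A (P 0) (Q 0)" "\<forall>p\<in>carrier (P 0). \<eta> (f p) = \<epsilon> p"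
      by blast
    have "f (\<delta> 0 p) \<in> \<delta>' 0 ` carrier (Q (Suc 0))" if "p \<in> carrier (P (Suc 0))" for p
      using that f left_module_homD(1)[OF PD(3)] left_module_homD(1)[OF f(1)] PD(8) by (intro QD(6)) auto
    with f show "\<exists>f. S 0 f" by (auto simp: S_def)
  next
    fix f n assume "S n f"
    then have f: "f \<in> left_module_hom A (P n) (Q n)"
      "\<And>p. p \<in> carrier (P (Suc n)) \<Longrightarrow> f (\<delta> n p) \<in> \<delta>' n ` carrier (Q (Suc n))" by (auto simp: S_def)
    from projective_lift[OF PD(1) QD(2) QD(2) QD(3) left_module_hom_comp[OF PD(3) f(1)] f(2)]
    obtain f' where f': "f' \<in> left_module_hom A (P (Suc n)) (Q (Suc n))"
      "\<And>p. p \<in> carrier (P (Suc n)) \<Longrightarrow> \<delta>' n (f' p) = f (\<delta> n p)" by blast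
    have "f' (\<delta> (Suc n) p) \<in> \<delta>' (Suc n) ` carrier (Q (Suc (Suc n)))"
      if "p \<in> carrier (P (Suc (Suc n)))" for p
      using that f' left_module_homD(1)[OF PD(3)] left_module_homD(1)[OF f'(1)] PD(9)
        left_module_hom_zero[OF f(1) PD(2) QD(2)]
      by (intro QD(7)) auto
    then show "\<exists>f'. S (Suc n) f' \<and> (\<forall>p\<in>carrier (P (Suc n)). \<delta>' n (f' p) = f (\<delta> n p))"
      using f' by (intro exI[of _ f']) (simp add: S_def)
  qed
  then show ?thesis using that unfolding S_def by blast
qed

text \<open>A chain map that covers zero on \<open>M\<close> is null-homotopic; it is applied below
  to the difference of the identity and a composite of comparison maps.\<close>

lemma resolution_null_homotopy:
  assumes P: "projective_resolution A M P \<delta> \<epsilon>" and Q: "projective_resolution A M Q \<delta>' \<eta>"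
    and T: "\<And>n. T n \<in> left_module_hom A (P n) (Q n)"
    and T0: "\<And>p. p \<in> carrier (P 0) \<Longrightarrow> \<eta> (T 0 p) = \<zero>\<^bsub>M\<^esub>"
    and TS: "\<And>n p. p \<in> carrier (P (Suc n)) \<Longrightarrow> \<delta>' n (T (Suc n) p) = T n (\<delta> n p)"
  obtains s where "\<And>n. s n \<in> left_module_hom A (P n) (Q (Suc n))"
    and "\<And>p. p \<in> carrier (P 0) \<Longrightarrow> T 0 p = \<delta>' 0 (s 0 p)"
    and "\<And>n p. p \<in> carrier (P (Suc n)) \<Longrightarrow>
      T (Suc n) p = \<delta>' (Suc n) (s (Suc n) p) \<oplus>\<^bsub>Q (Suc n)\<^esub> s n (\<delta> n p)"
proof -
  note PD = projective_resolutionD[OF P] and QD = projective_resolutionD[OF Q]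
  note dhom = left_module_homD[OF PD(3)]
  \<comment> \<open>The invariant says that the part of \<open>T (Suc n)\<close> not yet accounted
    for by \<open>s\<close> consists of cycles; by exactness it then lifts to the next homotopy
    map.\<close>
  define S where "S n s \<longleftrightarrow> s \<in> left_module_hom A (P n) (Q (Suc n)) \<and>
    (\<forall>p\<in>carrier (P (Suc n)). \<delta>' n (T (Suc n) p \<ominus>\<^bsub>Q (Suc n)\<^esub> s (\<delta> n p)) = \<zero>\<^bsub>Q n\<^esub>)
    \<and> (n = 0 \<longrightarrow> (\<forall>p\<in>carrier (P 0). T 0 p = \<delta>' 0 (s p)))" for n s
  have "\<exists>s. \<forall>n. S n (s n) \<and> (\<forall>p\<in>carrier (P (Suc n)).
    \<delta>' (Suc n) (s (Suc n) p) = T (Suc n) p \<ominus>\<^bsub>Q (Suc n)\<^esub> s n (\<delta> n p))"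
  proof (rule dependent_nat_choice)
    interpret Q0: left_module A "Q 0" by (rule QD)
    interpret Q1: left_module A "Q (Suc 0)" by (rule QD)
    have "\<exists>s\<in>left_module_hom A (P 0) (Q (Suc 0)). \<forall>p\<in>carrier (P 0). \<delta>' 0 (s p) = T 0 p"
      by (rule projective_lift[OF PD(1) QD(2) QD(2) QD(3) T])
        (use QD(6) T0 left_module_homD(1)[OF T] in auto)
    then obtain s where s: "s \<in> left_module_hom A (P 0) (Q (Suc 0))"
      "\<And>p. p \<in> carrier (P 0) \<Longrightarrow> \<delta>' 0 (s p) = T 0 p" by blast
    have "\<delta>' 0 (T (Suc 0) p \<ominus>\<^bsub>Q (Suc 0)\<^esub> s (\<delta> 0 p)) = \<zero>\<^bsub>Q 0\<^esub>"
      if p: "p \<in> carrier (P (Suc 0))" for p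
      using p dhom(1)[OF p] s left_module_homD(1)[OF T] left_module_homD(1)[OF s(1)] TS[OF p]
      by (simp add: left_module_hom_diff[OF QD(3) QD(2) QD(2)] Q0.M.minus_self)
    with s show "\<exists>s. S 0 s" by (auto simp: S_def)
  next
    fix s n assume "S n s"
    then have s: "s \<in> left_module_hom A (P n) (Q (Suc n))"
      "\<And>p. p \<in> carrier (P (Suc n)) \<Longrightarrow> \<delta>' n (T (Suc n) p \<ominus>\<^bsub>Q (Suc n)\<^esub> s (\<delta> n p)) = \<zero>\<^bsub>Q n\<^esub>"
      by (auto simp: S_def)
    interpret Q1: left_module A "Q (Suc n)" by (rule QD)
    interpret Q2: left_module A "Q (Suc (Suc n))" by (rule QD)
    let ?h = "\<lambda>p. T (Suc n) p \<ominus>\<^bsub>Q (Suc n)\<^esub> s (\<delta> n p)"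
    have h: "?h \<in> left_module_hom A (P (Suc n)) (Q (Suc n))"
      by (rule left_module_hom_sub[OF T left_module_hom_comp[OF PD(3) s(1)] QD(2)])
    have "?h p \<in> \<delta>' (Suc n) ` carrier (Q (Suc (Suc n)))" if "p \<in> carrier (P (Suc n))" for p
      using QD(7)[OF left_module_homD(1)[OF h that] s(2)[OF that]] .
    from projective_lift[OF PD(1) QD(2) QD(2) QD(3) h this]
    obtain s' where s': "s' \<in> left_module_hom A (P (Suc n)) (Q (Suc (Suc n)))"
      "\<And>p. p \<in> carrier (P (Suc n)) \<Longrightarrow> \<delta>' (Suc n) (s' p) = ?h p" by blast
    have "\<delta>' (Suc n) (T (Suc (Suc n)) p \<ominus>\<^bsub>Q (Suc (Suc n))\<^esub> s' (\<delta> (Suc n) p)) = \<zero>\<^bsub>Q (Suc n)\<^esub>"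
      if p: "p \<in> carrier (P (Suc (Suc n)))" for p
    proof -
      note Tc = left_module_homD(1)[OF T]
      show ?thesis
        unfolding left_module_hom_diff[OF QD(3) QD(2) QD(2) Tc[OF p] left_module_homD(1)[OF s'(1) dhom(1)[OF p]]]
          TS[OF p] s'(2)[OF dhom(1)[OF p]] PD(9)[OF p] left_module_hom_zero[OF s(1) PD(2) QD(2)]
        using Tc[OF dhom(1)[OF p]] by (simp only: Q1.M.diff_zero Q1.M.minus_self)
    qed
    then show "\<exists>s'. S (Suc n) s' \<and> (\<forall>p\<in>carrier (P (Suc n)). \<delta>' (Suc n) (s' p) = ?h p)"
      using s' by (intro exI[of _ s']) (simp add: S_def)
  qed
  then obtain s where s: "\<And>n. S n (s n)"
    "\<And>n p. p \<in> carrier (P (Suc n)) \<Longrightarrow>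
      \<delta>' (Suc n) (s (Suc n) p) = T (Suc n) p \<ominus>\<^bsub>Q (Suc n)\<^esub> s n (\<delta> n p)" by blast
  have shom: "s n \<in> left_module_hom A (P n) (Q (Suc n))" for n using s(1) by (simp add: S_def)
  show ?thesis
  proof (rule that[of s])
    show "T 0 p = \<delta>' 0 (s 0 p)" if "p \<in> carrier (P 0)" for p
      using s(1)[of 0] that by (simp add: S_def)
  next
    fix n p assume p: "p \<in> carrier (P (Suc n))"
    interpret Q1: left_module A "Q (Suc n)" by (rule QD)
    show "T (Suc n) p = \<delta>' (Suc n) (s (Suc n) p) \<oplus>\<^bsub>Q (Suc n)\<^esub> s n (\<delta> n p)"
      using left_module_homD(1)[OF T p] left_module_homD(1)[OF shom dhom(1)[OF p]] s(2)[OF p]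
      by (simp add: a_minus_def Q1.M.a_assoc Q1.M.l_neg)
  qed (rule shom)
qed

text \<open>The null homotopy of \<open>id - G F\<close>, with the equation solved for the identity
  so that homomorphisms can be applied to it term by term.\<close>

lemma resolution_homotopy_identity:
  assumes P: "projective_resolution A M P \<delta> \<epsilon>" and Q: "projective_resolution A M Q \<delta>' \<eta>"
  obtains F G s where "\<And>n. F n \<in> left_module_hom A (P n) (Q n)"
    and "\<And>n. G n \<in> left_module_hom A (Q n) (P n)"
    and "\<And>n. s n \<in> left_module_hom A (P n) (P (Suc n))"
    and "\<And>n p. p \<in> carrier (P (Suc n)) \<Longrightarrow> \<delta>' n (F (Suc n) p) = F n (\<delta> n p)"
    and "\<And>n p. p \<in> carrier (Q (Suc n)) \<Longrightarrow> \<delta> n (G (Suc n) p) = G n (\<delta>' n p)"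
    and "\<And>p. p \<in> carrier (P 0) \<Longrightarrow> p = G 0 (F 0 p) \<oplus>\<^bsub>P 0\<^esub> \<delta> 0 (s 0 p)"
    and "\<And>n p. p \<in> carrier (P (Suc n)) \<Longrightarrow>
      p = G (Suc n) (F (Suc n) p) \<oplus>\<^bsub>P (Suc n)\<^esub> (\<delta> (Suc n) (s (Suc n) p) \<oplus>\<^bsub>P (Suc n)\<^esub> s n (\<delta> n p))"
proof -
  note PD = projective_resolutionD[OF P] and QD = projective_resolutionD[OF Q]
  have M: "left_module A M" using left_module_resolved[OF P] .
  interpret M: left_module A M by fact
  obtain F where F: "\<And>n. F n \<in> left_module_hom A (P n) (Q n)"
    "\<And>p. p \<in> carrier (P 0) \<Longrightarrow> \<eta> (F 0 p) = \<epsilon> p"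
    "\<And>n p. p \<in> carrier (P (Suc n)) \<Longrightarrow> \<delta>' n (F (Suc n) p) = F n (\<delta> n p)"
    using resolution_chain_map[OF P Q] by metis
  obtain G where G: "\<And>n. G n \<in> left_module_hom A (Q n) (P n)"
    "\<And>p. p \<in> carrier (Q 0) \<Longrightarrow> \<epsilon> (G 0 p) = \<eta> p"
    "\<And>n p. p \<in> carrier (Q (Suc n)) \<Longrightarrow> \<delta> n (G (Suc n) p) = G n (\<delta>' n p)"
    using resolution_chain_map[OF Q P] by metis
  note Fc = left_module_homD(1)[OF F(1)] and Gc = left_module_homD(1)[OF G(1)]
  let ?T = "\<lambda>n p. p \<ominus>\<^bsub>P n\<^esub> G n (F n p)"
  have id: "(\<lambda>p. p) \<in> left_module_hom A (P n) (P n)" for n by (simp add: left_module_hom_def)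
  have T: "?T n \<in> left_module_hom A (P n) (P n)" for n
    by (rule left_module_hom_sub[OF id left_module_hom_comp[OF F(1) G(1)] PD(2)])
  have T0: "\<epsilon> (?T 0 p) = \<zero>\<^bsub>M\<^esub>" if "p \<in> carrier (P 0)" for p
    using that Fc Gc F G left_module_homD(1)[OF PD(4)]
    by (simp add: left_module_hom_diff[OF PD(4) PD(2) M] M.M.minus_self)
  have TS: "\<delta> n (?T (Suc n) p) = ?T n (\<delta> n p)" if "p \<in> carrier (P (Suc n))" for n p
    using that Fc Gc F G by (simp add: left_module_hom_diff[OF PD(3) PD(2) PD(2)])
  obtain s where s: "\<And>n. s n \<in> left_module_hom A (P n) (P (Suc n))"
    "\<And>p. p \<in> carrier (P 0) \<Longrightarrow> ?T 0 p = \<delta> 0 (s 0 p)"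
    "\<And>n p. p \<in> carrier (P (Suc n)) \<Longrightarrow>
      ?T (Suc n) p = \<delta> (Suc n) (s (Suc n) p) \<oplus>\<^bsub>P (Suc n)\<^esub> s n (\<delta> n p)"
    using resolution_null_homotopy[OF P P T T0 TS] by blast
  have cancel: "p = G n (F n p) \<oplus>\<^bsub>P n\<^esub> ?T n p" if p: "p \<in> carrier (P n)" for n p
  proof -
    interpret Pn: left_module A "P n" by (rule PD)
    show ?thesis using p Gc[OF Fc[OF p]] by (simp add: a_minus_def Pn.M.a_lcomm Pn.M.r_neg)
  qed
  have "p = G 0 (F 0 p) \<oplus>\<^bsub>P 0\<^esub> \<delta> 0 (s 0 p)" if "p \<in> carrier (P 0)" for p
    using cancel[OF that] unfolding s(2)[OF that] .
  moreover have "p = G (Suc n) (F (Suc n) p) \<oplus>\<^bsub>P (Suc n)\<^esub>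
    (\<delta> (Suc n) (s (Suc n) p) \<oplus>\<^bsub>P (Suc n)\<^esub> s n (\<delta> n p))" if "p \<in> carrier (P (Suc n))" for n p
    using cancel[OF that] unfolding s(3)[OF that] .
  ultimately show ?thesis using that[OF F(1) G(1) s(1) F(3) G(3)] by blast
qed

section \<open>Cohomology of the dual complex\<close>

lemma left_module_hom_add:
  assumes g: "g \<in> left_module_hom A M L" and h: "h \<in> left_module_hom A M L" and L: "left_module A L"
  shows "(\<lambda>m. g m \<oplus>\<^bsub>L\<^esub> h m) \<in> left_module_hom A M L"
proof -
  interpret L: left_module A L by fact
  note gD = left_module_homD[OF g] and hD = left_module_homD[OF h]
  show ?thesis
    by (rule left_module_homI) (use gD hD in \<open>simp_all add: L.M.a_ac L.smult_r_distr\<close>)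
qed

text \<open>Unlike \<open>dual_cocycles\<close>, this does not ask for extensionality: only values
  on the carrier matter, and functionals can be composed without restricting them. The same holds
  for \<open>coboundary\<close>.\<close>

definition cocycle where
  "cocycle A P \<delta> n h \<longleftrightarrow> h \<in> left_module_hom A (P n) (regular_module A) \<and>
    (\<forall>y\<in>carrier (P (Suc n)). h (\<delta> n y) = \<zero>\<^bsub>A\<^esub>)"

definition coboundary where
  "coboundary A P \<delta> n h \<longleftrightarrow> (case n of
      0 \<Rightarrow> \<forall>y\<in>carrier (P 0). h y = \<zero>\<^bsub>A\<^esub>
    | Suc i \<Rightarrow> \<exists>g\<in>left_module_hom A (P i) (regular_module A). \<forall>y\<in>carrier (P (Suc i)). h y = g (\<delta> i y))"

lemma regular_ops:
  "carrier (regular_module A) = carrier A" "\<zero>\<^bsub>regular_module A\<^esub> = \<zero>\<^bsub>A\<^esub>"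
  "a \<oplus>\<^bsub>regular_module A\<^esub> b = a \<oplus>\<^bsub>A\<^esub> b" "a \<odot>\<^bsub>regular_module A\<^esub> b = a \<otimes>\<^bsub>A\<^esub> b"
  by (simp_all add: regular_module_def)

text \<open>Pulling back along \<open>G\<close> is injective on cohomology. If \<open>h G\<close> is
  a coboundary, so is \<open>h G F\<close>, and \<open>h\<close> differs from it by
  \<open>h \<delta> s + h s \<delta>\<close>, where the first term vanishes for a cocycle and the
  second is a coboundary.\<close>

lemma cohomology_transfer:
  assumes P: "projective_resolution A M P \<delta> \<epsilon>" and Q: "projective_resolution A M Q \<delta>' \<eta>"
  obtains G where "\<And>n. G n \<in> left_module_hom A (Q n) (P n)"
    and "\<And>n h. cocycle A P \<delta> n h \<Longrightarrow> cocycle A Q \<delta>' n (\<lambda>y. h (G n y))"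
    and "\<And>n h. cocycle A P \<delta> n h \<Longrightarrow> coboundary A Q \<delta>' n (\<lambda>y. h (G n y)) \<Longrightarrow> coboundary A P \<delta> n h"
proof -
  note PD = projective_resolutionD[OF P] and QD = projective_resolutionD[OF Q]
  have "ring A" using PD(2) by (simp add: left_module_def)
  then interpret A: ring A .
  note reg = left_module_regular[OF \<open>ring A\<close>]
  obtain F G s where F: "\<And>n. F n \<in> left_module_hom A (P n) (Q n)"
    and G: "\<And>n. G n \<in> left_module_hom A (Q n) (P n)"
    and s: "\<And>n. s n \<in> left_module_hom A (P n) (P (Suc n))"
    and Fd: "\<And>n p. p \<in> carrier (P (Suc n)) \<Longrightarrow> \<delta>' n (F (Suc n) p) = F n (\<delta> n p)"
    and Gd: "\<And>n p. p \<in> carrier (Q (Suc n)) \<Longrightarrow> \<delta> n (G (Suc n) p) = G n (\<delta>' n p)"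
    and h0: "\<And>p. p \<in> carrier (P 0) \<Longrightarrow> p = G 0 (F 0 p) \<oplus>\<^bsub>P 0\<^esub> \<delta> 0 (s 0 p)"
    and hS: "\<And>n p. p \<in> carrier (P (Suc n)) \<Longrightarrow> p = G (Suc n) (F (Suc n) p)
      \<oplus>\<^bsub>P (Suc n)\<^esub> (\<delta> (Suc n) (s (Suc n) p) \<oplus>\<^bsub>P (Suc n)\<^esub> s n (\<delta> n p))"
    using resolution_homotopy_identity[OF P Q] by blast
  note Fc = left_module_homD(1)[OF F] and Gc = left_module_homD(1)[OF G]
    and sc = left_module_homD(1)[OF s] and dc = left_module_homD(1)[OF PD(3)]
  show ?thesis
  proof (rule that[of G, OF G])
    fix n h assume h: "cocycle A P \<delta> n h"
    then have hh: "h \<in> left_module_hom A (P n) (regular_module A)"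
      and hd: "\<And>y. y \<in> carrier (P (Suc n)) \<Longrightarrow> h (\<delta> n y) = \<zero>\<^bsub>A\<^esub>" by (auto simp: cocycle_def)
    note hD = left_module_homD[OF hh, unfolded regular_ops]
    show "cocycle A Q \<delta>' n (\<lambda>y. h (G n y))"
      using left_module_hom_comp[OF G hh] hd Gc by (simp add: cocycle_def Gd[symmetric])
    assume cb: "coboundary A Q \<delta>' n (\<lambda>y. h (G n y))"
    show "coboundary A P \<delta> n h"
    proof (cases n)
      case 0
      have "h p = \<zero>\<^bsub>A\<^esub>" if p: "p \<in> carrier (P 0)" for p
      proof -
        have "h p = h (G 0 (F 0 p)) \<oplus>\<^bsub>A\<^esub> h (\<delta> 0 (s 0 p))"
          using arg_cong[OF h0[OF p], of h] hD(2)[unfolded 0, OF Gc[OF Fc[OF p]] dc[OF sc[OF p]]]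
          by (rule trans)
        also have "\<dots> = \<zero>\<^bsub>A\<^esub>" using cb hd p Fc sc by (simp add: 0 coboundary_def)
        finally show ?thesis .
      qed
      then show ?thesis by (simp add: 0 coboundary_def)
    next
      case (Suc i)
      from cb obtain g where g: "g \<in> left_module_hom A (Q i) (regular_module A)"
        "\<And>y. y \<in> carrier (Q (Suc i)) \<Longrightarrow> h (G (Suc i) y) = g (\<delta>' i y)"
        by (auto simp: coboundary_def Suc)
      \<comment> \<open>The primitive of \<open>h\<close> is the primitive of \<open>h G\<close>
        carried back by \<open>F\<close>, corrected by the homotopy term.\<close>
      let ?g = "\<lambda>q. g (F i q) \<oplus>\<^bsub>regular_module A\<^esub> h (s i q)"
      have hs: "(\<lambda>q. h (s i q)) \<in> left_module_hom A (P i) (regular_module A)"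
        by (rule left_module_hom_comp[OF s hh[unfolded Suc]])
      have "?g \<in> left_module_hom A (P i) (regular_module A)"
        by (rule left_module_hom_add[OF left_module_hom_comp[OF F g(1)] hs reg])
      moreover have "h p = ?g (\<delta> i p)" if p: "p \<in> carrier (P (Suc i))" for p
      proof -
        interpret Pn: left_module A "P (Suc i)" by (rule PD)
        have "h p = h (G (Suc i) (F (Suc i) p)) \<oplus>\<^bsub>A\<^esub> (h (\<delta> (Suc i) (s (Suc i) p)) \<oplus>\<^bsub>A\<^esub> h (s i (\<delta> i p)))"
        proof -
          have c: "G (Suc i) (F (Suc i) p) \<in> carrier (P (Suc i))"
            "\<delta> (Suc i) (s (Suc i) p) \<in> carrier (P (Suc i))" "s i (\<delta> i p) \<in> carrier (P (Suc i))"
            using p Fc Gc sc dc by simp_all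
          show ?thesis
            using arg_cong[OF hS[OF p], of h] hD(2)[unfolded Suc] c Pn.M.a_closed by metis
        qed
        also have "\<dots> = g (F i (\<delta> i p)) \<oplus>\<^bsub>A\<^esub> h (s i (\<delta> i p))"
          using hd[unfolded Suc] g(2) Fd Fc sc dc p hD(1)[unfolded Suc] by simp
        finally show ?thesis by (simp add: regular_ops)
      qed
      ultimately show ?thesis unfolding coboundary_def Suc by auto
    qed
  qed
qed

text \<open>The set \<open>S\<close> of scalars is a parameter because the lemma serves both vector
  spaces (\<open>S = UNIV\<close>) and left modules (\<open>S = carrier A\<close>).\<close>

lemma quotient_module_ops:
  fixes M :: "('s, 'm) module"
  assumes M: "abelian_group M" and U: "additive_subgroup U M"
    and c: "\<And>c m. c \<in> S \<Longrightarrow> m \<in> carrier M \<Longrightarrow> c \<odot>\<^bsub>M\<^esub> m \<in> carrier M"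
    and add: "\<And>c m m'. c \<in> S \<Longrightarrow> m \<in> carrier M \<Longrightarrow> m' \<in> carrier M \<Longrightarrow>
      c \<odot>\<^bsub>M\<^esub> (m \<oplus>\<^bsub>M\<^esub> m') = c \<odot>\<^bsub>M\<^esub> m \<oplus>\<^bsub>M\<^esub> c \<odot>\<^bsub>M\<^esub> m'"
    and cU: "\<And>c u. c \<in> S \<Longrightarrow> u \<in> U \<Longrightarrow> c \<odot>\<^bsub>M\<^esub> u \<in> U"
  shows "m \<in> carrier M \<Longrightarrow> U +>\<^bsub>M\<^esub> m \<in> carrier (quotient_module M U)"
    and "X \<in> carrier (quotient_module M U) \<Longrightarrow> \<exists>m\<in>carrier M. X = U +>\<^bsub>M\<^esub> m"
    and "m \<in> carrier M \<Longrightarrow> m' \<in> carrier M \<Longrightarrow>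
      (U +>\<^bsub>M\<^esub> m) \<oplus>\<^bsub>quotient_module M U\<^esub> (U +>\<^bsub>M\<^esub> m') = U +>\<^bsub>M\<^esub> (m \<oplus>\<^bsub>M\<^esub> m')"
    and "d \<in> S \<Longrightarrow> m \<in> carrier M \<Longrightarrow>
      d \<odot>\<^bsub>quotient_module M U\<^esub> (U +>\<^bsub>M\<^esub> m) = U +>\<^bsub>M\<^esub> (d \<odot>\<^bsub>M\<^esub> m)"
    and "m \<in> carrier M \<Longrightarrow> U +>\<^bsub>M\<^esub> m = \<zero>\<^bsub>quotient_module M U\<^esub> \<longleftrightarrow> m \<in> U"
proof -
  interpret M: abelian_group M by fact
  interpret U: abelian_subgroup U M by (rule abelian_subgroupI3[OF U M])
  have UM: "U \<subseteq> carrier M" by (rule U.a_subset)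
  show "U +>\<^bsub>M\<^esub> m \<in> carrier (quotient_module M U)" if "m \<in> carrier M"
    using that UM by (simp add: quotient_module_def M.a_rcosetsI)
  show "\<exists>m\<in>carrier M. X = U +>\<^bsub>M\<^esub> m" if "X \<in> carrier (quotient_module M U)"
    using that by (auto simp: quotient_module_def A_RCOSETS_def')
  show "(U +>\<^bsub>M\<^esub> m) \<oplus>\<^bsub>quotient_module M U\<^esub> (U +>\<^bsub>M\<^esub> m') = U +>\<^bsub>M\<^esub> (m \<oplus>\<^bsub>M\<^esub> m')"
    if "m \<in> carrier M" "m' \<in> carrier M"
    using that by (simp add: quotient_module_def U.a_rcos_sum)
  show "U +>\<^bsub>M\<^esub> m = \<zero>\<^bsub>quotient_module M U\<^esub> \<longleftrightarrow> m \<in> U" if "m \<in> carrier M"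
    using M.a_coset_join1[OF _ that U.a_subgroup] M.a_coset_join2[OF that U.a_subgroup]
    by (auto simp: quotient_module_def)
  show "d \<odot>\<^bsub>quotient_module M U\<^esub> (U +>\<^bsub>M\<^esub> m) = U +>\<^bsub>M\<^esub> (d \<odot>\<^bsub>M\<^esub> m)"
    if d: "d \<in> S" and m: "m \<in> carrier M"
  proof -
    \<comment> \<open>Scalar multiplication of a coset is a union over its representatives; all
      members of that union coincide, so it is a single coset.\<close>
    have "U +>\<^bsub>M\<^esub> (d \<odot>\<^bsub>M\<^esub> m') = U +>\<^bsub>M\<^esub> (d \<odot>\<^bsub>M\<^esub> m)" if m': "m' \<in> U +>\<^bsub>M\<^esub> m" for m'
    proof -
      from m' obtain u where u: "u \<in> U" "m' = u \<oplus>\<^bsub>M\<^esub> m" by (auto simp: a_r_coset_def')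
      then have "d \<odot>\<^bsub>M\<^esub> m' = d \<odot>\<^bsub>M\<^esub> u \<oplus>\<^bsub>M\<^esub> d \<odot>\<^bsub>M\<^esub> m" using UM d m add by auto
      then have "d \<odot>\<^bsub>M\<^esub> m' \<in> U +>\<^bsub>M\<^esub> (d \<odot>\<^bsub>M\<^esub> m)" using cU d u by (auto simp: a_r_coset_def')
      then show ?thesis by (rule M.a_repr_independence[OF _ c[OF d m] U.a_subgroup, symmetric])
    qed
    moreover have "m \<in> U +>\<^bsub>M\<^esub> m" using m by (rule U.a_rcos_self)
    ultimately have "(\<Union>m'\<in>U +>\<^bsub>M\<^esub> m. U +>\<^bsub>M\<^esub> (d \<odot>\<^bsub>M\<^esub> m')) = U +>\<^bsub>M\<^esub> (d \<odot>\<^bsub>M\<^esub> m)" by blast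
    then show ?thesis by (simp add: quotient_module_def)
  qed
qed

section \<open>Linear combinations of cocycles, and Ext as cocycles modulo coboundaries\<close>

context unital_algebra
begin

abbreviation "functionals M \<equiv> left_module_hom A M (regular_module A)"

lemma smult_0_left: "a \<in> carrier A \<Longrightarrow> 0 \<odot> a = \<zero>"
  by (metis add.l_cancel_one scale_add_left scale_closed add.right_neutral)

lemma smult_0_right: "c \<odot> \<zero> = \<zero>"
  by (metis add.l_cancel_one r_zero scale_add_right scale_closed zero_closed)

lemma smult_neg_one: "a \<in> carrier A \<Longrightarrow> (- 1) \<odot> a = \<ominus> a"
  by (metis add.inv_equality left_minus scale_add_left scale_closed scale_one smult_0_left)

lemma hom_combination:
  assumes "g \<in> functionals M" "h \<in> functionals M"
  shows "(\<lambda>m. c \<odot> g m \<oplus> d \<odot> h m) \<in> functionals M"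
  using left_module_homD[OF assms(1), unfolded regular_ops] left_module_homD[OF assms(2), unfolded regular_ops]
  by (intro left_module_homI)
    (simp_all add: regular_ops scale_closed scale_add_right scale_mult_right r_distr a_ac)

lemma cocycle_combination:
  assumes "cocycle A P \<delta> n g" "cocycle A P \<delta> n h"
  shows "cocycle A P \<delta> n (\<lambda>m. c \<odot> g m \<oplus> d \<odot> h m)"
  using assms by (simp add: cocycle_def hom_combination smult_0_right)

lemma cocycle_zero: "cocycle A P \<delta> n (\<lambda>m. \<zero>)"
  by (auto simp: cocycle_def left_module_hom_def regular_ops)

lemma coboundary_combination:
  assumes "coboundary A P \<delta> n g" "coboundary A P \<delta> n h"
  shows "coboundary A P \<delta> n (\<lambda>m. c \<odot> g m \<oplus> d \<odot> h m)"
proof (cases n)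
  case 0
  then show ?thesis using assms by (simp add: coboundary_def smult_0_right)
next
  case (Suc i)
  from assms obtain g' h' where g': "g' \<in> functionals (P i)"
    "h' \<in> functionals (P i)"
    "\<forall>y\<in>carrier (P (Suc i)). g y = g' (\<delta> i y)" "\<forall>y\<in>carrier (P (Suc i)). h y = h' (\<delta> i y)"
    by (auto simp: coboundary_def Suc)
  show ?thesis unfolding coboundary_def Suc
    using hom_combination[OF g'(1,2)] g'(3,4) by auto
qed

lemma coboundary_zero: "coboundary A P \<delta> n (\<lambda>m. \<zero>)"
proof (cases n)
  case (Suc i)
  have "(\<lambda>m. \<zero>) \<in> functionals (P i)"
    by (auto simp: left_module_hom_def regular_ops)
  then show ?thesis unfolding coboundary_def Suc by auto
qed (simp add: coboundary_def)

lemma cocycle_cong: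
  assumes "left_module A (P n)" "\<delta> n \<in> left_module_hom A (P (Suc n)) (P n)"
    "\<And>y. y \<in> carrier (P n) \<Longrightarrow> g y = h y"
  shows "cocycle A P \<delta> n g \<longleftrightarrow> cocycle A P \<delta> n h"
proof -
  interpret Pn: left_module A "P n" by fact
  show ?thesis
    using assms(3) left_module_homD(1)[OF assms(2)]
    by (simp add: cocycle_def left_module_hom_def Pi_iff)
qed

lemma coboundary_cong:
  assumes "\<And>y. y \<in> carrier (P n) \<Longrightarrow> g y = h y"
  shows "coboundary A P \<delta> n g \<longleftrightarrow> coboundary A P \<delta> n h"
  using assms by (auto simp: coboundary_def split: nat.split)

lemma dual_cocycles_iff:
  "h \<in> dual_cocycles A P \<delta> n \<longleftrightarrow> cocycle A P \<delta> n h \<and> h \<in> extensional (carrier (P n))"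
  by (auto simp: dual_cocycles_def cocycle_def hom_to_algebra_def)

lemma dual_coboundaries_iff:
  assumes "\<And>i. left_module A (P i)" and "\<And>i. \<delta> i \<in> left_module_hom A (P (Suc i)) (P i)"
  shows "h \<in> dual_coboundaries A P \<delta> n \<longleftrightarrow> coboundary A P \<delta> n h \<and> h \<in> extensional (carrier (P n))"
proof (cases n)
  case 0
  show ?thesis
    unfolding 0 dual_coboundaries_def coboundary_def hom_to_algebra_def
    by (auto intro!: extensionalityI[of _ "carrier (P 0)"])
next
  case (Suc i)
  show ?thesis
  proof
    assume "h \<in> dual_coboundaries A P \<delta> n"
    then show "coboundary A P \<delta> n h \<and> h \<in> extensional (carrier (P n))"
      by (auto simp: Suc dual_coboundaries_def coboundary_def hom_to_algebra_def)
  next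
    assume "coboundary A P \<delta> n h \<and> h \<in> extensional (carrier (P n))"
    then obtain g where g: "g \<in> functionals (P i)"
      "\<And>y. y \<in> carrier (P (Suc i)) \<Longrightarrow> h y = g (\<delta> i y)" and h: "h \<in> extensional (carrier (P (Suc i)))"
      by (auto simp: coboundary_def Suc)
    note dc = left_module_homD(1)[OF assms(2)]
    show "h \<in> dual_coboundaries A P \<delta> n"
      unfolding Suc dual_coboundaries_def nat.case
    proof (rule image_eqI)
      show "h = (\<lambda>y\<in>carrier (P (Suc i)). restrict g (carrier (P i)) (\<delta> i y))"
        using h g(2) dc[of _ i] by (intro extensionalityI[OF h]) auto
      show "restrict g (carrier (P i)) \<in> carrier (hom_to_algebra A (P i))"
      proof -
        interpret Pi: left_module A "P i" by (rule assms)
        show ?thesis using left_module_homD[OF g(1)]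
          by (auto simp: hom_to_algebra_def intro!: left_module_homI)
      qed
    qed
  qed
qed

text \<open>That coboundaries are cocycles is a premise of the second claim, because it rests on the
  vanishing of composed differentials, which \<open>PD\<close> does not contain.\<close>

lemma
  fixes P :: "nat \<Rightarrow> ('a, 'p) module" and \<delta> n
  assumes PD: "\<And>i. left_module A (P i)" "\<And>i. \<delta> i \<in> left_module_hom A (P (Suc i)) (P i)"
  defines "V \<equiv> (hom_to_algebra A (P n)) \<lparr>carrier := dual_cocycles A P \<delta> n\<rparr>"
  shows abelian_group_dual_cocycles: "abelian_group V"
    and additive_subgroup_dual_coboundaries:
      "(\<And>h. coboundary A P \<delta> n h \<Longrightarrow> cocycle A P \<delta> n h) \<Longrightarrow>
        additive_subgroup (dual_coboundaries A P \<delta> n) V"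
proof -
  note cong = cocycle_cong[where P = P and \<delta> = \<delta> and n = n, OF PD(1) PD(2)]
  have c: "h \<in> carrier V \<longleftrightarrow> cocycle A P \<delta> n h \<and> h \<in> extensional (carrier (P n))" for h
    by (simp add: V_def dual_cocycles_iff)
  have val: "h y \<in> carrier A" if "h \<in> carrier V" "y \<in> carrier (P n)" for h y
    using that c left_module_homD(1)[of h A "P n" "regular_module A" y] by (simp add: cocycle_def regular_ops)
  have add: "g \<oplus>\<^bsub>V\<^esub> h = (\<lambda>y\<in>carrier (P n). g y \<oplus> h y)" for g h
    by (simp add: V_def hom_to_algebra_def)
  have zero: "\<zero>\<^bsub>V\<^esub> = (\<lambda>y\<in>carrier (P n). \<zero>)" by (simp add: V_def hom_to_algebra_def)
  have comb: "(\<lambda>y\<in>carrier (P n). d \<odot> g y \<oplus> e \<odot> h y) \<in> carrier V"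
    if "g \<in> carrier V" "h \<in> carrier V" for d e g h
    using cocycle_combination[of P \<delta> n g h d e] that c
      cong[of "\<lambda>y\<in>carrier (P n). d \<odot> g y \<oplus> e \<odot> h y" "\<lambda>y. d \<odot> g y \<oplus> e \<odot> h y"] by simp
  have z: "\<zero>\<^bsub>V\<^esub> \<in> carrier V"
    using cocycle_zero[of P \<delta> n] cong[of "\<lambda>y\<in>carrier (P n). \<zero>" "\<lambda>y. \<zero>"] by (simp add: c zero)
  show V: "abelian_group V"
  proof (rule abelian_groupI)
    fix g h assume gh: "g \<in> carrier V" "h \<in> carrier V"
    have "g \<oplus>\<^bsub>V\<^esub> h = (\<lambda>y\<in>carrier (P n). 1 \<odot> g y \<oplus> 1 \<odot> h y)"
      unfolding add using val gh by (intro restrict_ext) (simp add: scale_one)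
    then show "g \<oplus>\<^bsub>V\<^esub> h \<in> carrier V" using comb[OF gh] by simp
    show "g \<oplus>\<^bsub>V\<^esub> h = h \<oplus>\<^bsub>V\<^esub> g"
      unfolding add using val gh by (intro restrict_ext) (simp add: a_comm)
    fix k assume k: "k \<in> carrier V"
    show "g \<oplus>\<^bsub>V\<^esub> h \<oplus>\<^bsub>V\<^esub> k = g \<oplus>\<^bsub>V\<^esub> (h \<oplus>\<^bsub>V\<^esub> k)"
      unfolding add using val gh k by (intro restrict_ext) (simp add: a_assoc)
  next
    fix g assume g: "g \<in> carrier V"
    have e: "g \<in> extensional (carrier (P n))" using g c by simp
    show "\<zero>\<^bsub>V\<^esub> \<oplus>\<^bsub>V\<^esub> g = g"
      unfolding add zero using val g by (intro extensionalityI[OF _ e]) auto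
    show "\<exists>h\<in>carrier V. h \<oplus>\<^bsub>V\<^esub> g = \<zero>\<^bsub>V\<^esub>"
    \<comment> \<open>Sums and negatives are all treated as instances of the two-term combination
      \<open>comb\<close>; the negative of \<open>g\<close> is \<open>- 1\<close> times
      \<open>g\<close> plus \<open>0\<close> times \<open>g\<close>.\<close>
    proof (rule bexI[OF _ comb[OF g g, of "- 1" 0]])
      show "(\<lambda>y\<in>carrier (P n). (- 1) \<odot> g y \<oplus> 0 \<odot> g y) \<oplus>\<^bsub>V\<^esub> g = \<zero>\<^bsub>V\<^esub>"
        unfolding add zero using val g
        by (intro restrict_ext) (simp add: smult_neg_one smult_0_left l_neg)
    qed
  qed (rule z)
  assume B: "\<And>h. coboundary A P \<delta> n h \<Longrightarrow> cocycle A P \<delta> n h"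
  have b: "h \<in> dual_coboundaries A P \<delta> n \<longleftrightarrow> coboundary A P \<delta> n h \<and> h \<in> extensional (carrier (P n))" for h
    by (rule dual_coboundaries_iff[where P = P and \<delta> = \<delta>, OF PD])
  interpret V: abelian_group V by (rule V)
  have sub: "dual_coboundaries A P \<delta> n \<subseteq> carrier V" using b c B by blast
  have bcomb: "(\<lambda>y\<in>carrier (P n). d \<odot> g y \<oplus> e \<odot> h y) \<in> dual_coboundaries A P \<delta> n"
    if "g \<in> dual_coboundaries A P \<delta> n" "h \<in> dual_coboundaries A P \<delta> n" for d e g h
    using coboundary_combination[of P \<delta> n g h d e] that b
      coboundary_cong[of P n "\<lambda>y\<in>carrier (P n). d \<odot> g y \<oplus> e \<odot> h y" "\<lambda>y. d \<odot> g y \<oplus> e \<odot> h y"] by simp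
  show "additive_subgroup (dual_coboundaries A P \<delta> n) V"
  proof (rule additive_subgroup.intro, rule V.add.subgroupI)
    show "dual_coboundaries A P \<delta> n \<subseteq> carrier V" by (rule sub)
    show "dual_coboundaries A P \<delta> n \<noteq> {}"
      using coboundary_zero[of P \<delta> n] b[of "\<lambda>y\<in>carrier (P n). \<zero>"]
        coboundary_cong[of P n "\<lambda>y\<in>carrier (P n). \<zero>" "\<lambda>y. \<zero>"] by auto
  next
    fix g assume g: "g \<in> dual_coboundaries A P \<delta> n"
    then have gV: "g \<in> carrier V" using sub by auto
    let ?g = "\<lambda>y\<in>carrier (P n). (- 1) \<odot> g y \<oplus> 0 \<odot> g y"
    have "?g \<oplus>\<^bsub>V\<^esub> g = \<zero>\<^bsub>V\<^esub>"
      unfolding add zero using val gV by (intro restrict_ext) (simp add: smult_neg_one smult_0_left l_neg)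
    then have "\<ominus>\<^bsub>V\<^esub> g = ?g" using comb[OF gV gV] gV by (intro V.minus_equality) auto
    then show "\<ominus>\<^bsub>V\<^esub> g \<in> dual_coboundaries A P \<delta> n" using bcomb[OF g g] by simp
  next
    fix g h assume gh: "g \<in> dual_coboundaries A P \<delta> n" "h \<in> dual_coboundaries A P \<delta> n"
    have "g \<oplus>\<^bsub>V\<^esub> h = (\<lambda>y\<in>carrier (P n). 1 \<odot> g y \<oplus> 1 \<odot> h y)"
      unfolding add using val[of g] val[of h] gh sub by (intro restrict_ext) (simp add: scale_one subset_iff)
    then show "g \<oplus>\<^bsub>V\<^esub> h \<in> dual_coboundaries A P \<delta> n" using bcomb[OF gh] by simp
  qed
qed

lemma coboundary_cocycle:
  assumes P: "projective_resolution A M P \<delta> \<epsilon>" and h: "coboundary A P \<delta> n h"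
  shows "cocycle A P \<delta> n h"
proof -
  note PD = projective_resolutionD[OF P]
  note dc = left_module_homD(1)[OF PD(3)]
  show ?thesis
  proof (cases n)
    case 0
    then have "cocycle A P \<delta> n h \<longleftrightarrow> cocycle A P \<delta> n (\<lambda>_. \<zero>)"
      using h by (intro cocycle_cong[where P = P and \<delta> = \<delta>, OF PD(2,3)]) (simp add: coboundary_def)
    then show ?thesis by (simp add: cocycle_zero)
  next
    case (Suc i)
    then obtain g where g: "g \<in> functionals (P i)"
      "\<And>y. y \<in> carrier (P n) \<Longrightarrow> h y = g (\<delta> i y)" using h by (auto simp: coboundary_def)
    have "cocycle A P \<delta> n (\<lambda>y. g (\<delta> i y))"
      using left_module_hom_comp[OF PD(3) g(1)] PD(9)
        left_module_hom_zero[OF g(1) PD(2) left_module_regular[OF ring_axioms]]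
      by (simp add: cocycle_def Suc regular_ops)
    then show ?thesis using cocycle_cong[where P = P and \<delta> = \<delta>, OF PD(2,3), of n h "\<lambda>y. g (\<delta> i y)"] g(2) by simp
  qed
qed

context
  fixes M :: "('a, 'm) module" and P :: "nat \<Rightarrow> ('a, 'p) module" and \<delta> \<epsilon> n Ext
  assumes res: "projective_resolution A M P \<delta> \<epsilon>"
  defines "Ext \<equiv> quotient_module ((hom_to_algebra A (P n)) \<lparr>carrier := dual_cocycles A P \<delta> n\<rparr>)
    (dual_coboundaries A P \<delta> n)"
begin

interpretation V: abelian_group "(hom_to_algebra A (P n)) \<lparr>carrier := dual_cocycles A P \<delta> n\<rparr>"
  by (rule abelian_group_dual_cocycles) (rule projective_resolutionD[OF res])+

text \<open>All later use of Ext goes through the linear map \<open>cl\<close>, whose kernel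
  consists of the coboundaries; cosets and restrictions to the carrier stay inside this
  proof.\<close>

lemma cohomology_class:
  obtains cl where
    "\<And>h. cocycle A P \<delta> n h \<Longrightarrow> cl h \<in> carrier Ext"
    "\<And>h. cocycle A P \<delta> n h \<Longrightarrow> cl h = \<zero>\<^bsub>Ext\<^esub> \<longleftrightarrow> coboundary A P \<delta> n h"
    "\<And>g h c d. cocycle A P \<delta> n g \<Longrightarrow> cocycle A P \<delta> n h \<Longrightarrow>
      cl (\<lambda>y. c \<odot> g y \<oplus> d \<odot> h y) = c \<odot>\<^bsub>Ext\<^esub> cl g \<oplus>\<^bsub>Ext\<^esub> d \<odot>\<^bsub>Ext\<^esub> cl h"
    "\<And>c h. cocycle A P \<delta> n h \<Longrightarrow> c \<odot>\<^bsub>Ext\<^esub> cl h \<in> carrier Ext"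
proof -
  let ?V = "(hom_to_algebra A (P n)) \<lparr>carrier := dual_cocycles A P \<delta> n\<rparr>"
  let ?B = "dual_coboundaries A P \<delta> n"
  let ?r = "\<lambda>h. restrict h (carrier (P n))"
  note PD = projective_resolutionD[OF res]
  note cong = cocycle_cong[where P = P and \<delta> = \<delta> and n = n, OF PD(2) PD(3)]
  have B: "additive_subgroup ?B ?V"
    by (rule additive_subgroup_dual_coboundaries[OF PD(2,3) coboundary_cocycle[OF res]])
  have c: "h \<in> carrier ?V \<longleftrightarrow> cocycle A P \<delta> n h \<and> h \<in> extensional (carrier (P n))" for h
    by (simp add: dual_cocycles_iff)
  have b: "h \<in> ?B \<longleftrightarrow> coboundary A P \<delta> n h \<and> h \<in> extensional (carrier (P n))" for h
    by (rule dual_coboundaries_iff[where P = P and \<delta> = \<delta>, OF PD(2,3)])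
  have rc: "?r h \<in> carrier ?V" if "cocycle A P \<delta> n h" for h
    using that c cong[of "?r h" h] by simp
  have smult: "d \<odot>\<^bsub>?V\<^esub> h = ?r (\<lambda>y. d \<odot> h y)" for d h by (simp add: hom_to_algebra_def)
  have add: "g \<oplus>\<^bsub>?V\<^esub> h = ?r (\<lambda>y. g y \<oplus> h y)" for g h by (simp add: hom_to_algebra_def)
  have val: "h y \<in> carrier A" if "cocycle A P \<delta> n h" "y \<in> carrier (P n)" for h y
    using that left_module_homD(1)[of h A "P n" "regular_module A" y] by (simp add: cocycle_def regular_ops)
  have cs: "cocycle A P \<delta> n (\<lambda>y. d \<odot> h y)" if "cocycle A P \<delta> n h" for d h
    using cocycle_combination[OF that that, of d 0] val[OF that]
      cong[of "\<lambda>y. d \<odot> h y" "\<lambda>y. d \<odot> h y \<oplus> 0 \<odot> h y"]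
    by (simp add: smult_0_left scale_closed)
  have s1: "d \<odot>\<^bsub>?V\<^esub> h \<in> carrier ?V" if "h \<in> carrier ?V" for d h
    using rc[OF cs] that by (simp only: smult c)
  have s2: "d \<odot>\<^bsub>?V\<^esub> (g \<oplus>\<^bsub>?V\<^esub> h) = d \<odot>\<^bsub>?V\<^esub> g \<oplus>\<^bsub>?V\<^esub> d \<odot>\<^bsub>?V\<^esub> h"
    if "g \<in> carrier ?V" "h \<in> carrier ?V" for d g h
    unfolding smult add using that val unfolding c
    by (intro restrict_ext) (simp add: scale_add_right)
  have s3: "d \<odot>\<^bsub>?V\<^esub> h \<in> ?B" if "h \<in> ?B" for d h
  proof -
    have h: "coboundary A P \<delta> n h" "cocycle A P \<delta> n h" using that b coboundary_cocycle[OF res] by auto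
    have "coboundary A P \<delta> n (\<lambda>y. d \<odot> h y)"
      using coboundary_combination[OF h(1) h(1), of d 0] val[OF h(2)]
        coboundary_cong[of P n "\<lambda>y. d \<odot> h y" "\<lambda>y. d \<odot> h y \<oplus> 0 \<odot> h y"]
      by (simp add: smult_0_left scale_closed)
    then show ?thesis unfolding smult b
      using coboundary_cong[of P n "\<lambda>y. d \<odot> h y" "?r (\<lambda>y. d \<odot> h y)"] by simp
  qed
  note Q = quotient_module_ops[where S = UNIV, OF V.abelian_group_axioms B s1 s2 s3, folded Ext_def, simplified]
  show ?thesis
  proof (rule that[of "\<lambda>h. ?B +>\<^bsub>?V\<^esub> ?r h"])
    fix g h d e assume g: "cocycle A P \<delta> n g" and h: "cocycle A P \<delta> n h"
    have "?r (\<lambda>y. d \<odot> g y \<oplus> e \<odot> h y) = d \<odot>\<^bsub>?V\<^esub> ?r g \<oplus>\<^bsub>?V\<^esub> e \<odot>\<^bsub>?V\<^esub> ?r h"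
      unfolding smult add by (intro restrict_ext) simp
    then show "?B +>\<^bsub>?V\<^esub> ?r (\<lambda>y. d \<odot> g y \<oplus> e \<odot> h y) =
        d \<odot>\<^bsub>Ext\<^esub> (?B +>\<^bsub>?V\<^esub> ?r g) \<oplus>\<^bsub>Ext\<^esub> e \<odot>\<^bsub>Ext\<^esub> (?B +>\<^bsub>?V\<^esub> ?r h)"
      using Q(3)[of "d \<odot>\<^bsub>?V\<^esub> ?r g" "e \<odot>\<^bsub>?V\<^esub> ?r h"] Q(4) rc[OF g] rc[OF h] s1 by simp
  next
    fix h assume h: "cocycle A P \<delta> n h"
    show "?B +>\<^bsub>?V\<^esub> ?r h \<in> carrier Ext" using Q(1) rc[OF h] by simp
    show "?B +>\<^bsub>?V\<^esub> ?r h = \<zero>\<^bsub>Ext\<^esub> \<longleftrightarrow> coboundary A P \<delta> n h"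
      using Q(5) rc[OF h] b[of "?r h"] coboundary_cong[of P n h "?r h"] by simp
    fix d show "d \<odot>\<^bsub>Ext\<^esub> (?B +>\<^bsub>?V\<^esub> ?r h) \<in> carrier Ext"
      using Q(1)[of "d \<odot>\<^bsub>?V\<^esub> ?r h"] Q(4) rc[OF h] s1 by simp
  qed
qed

lemma cocycle_is_coboundary:
  assumes "carrier Ext = {\<zero>\<^bsub>Ext\<^esub>}" "cocycle A P \<delta> n h"
  shows "coboundary A P \<delta> n h"
  using cohomology_class assms by (metis singletonD)

text \<open>The map \<open>\<phi>\<close> identifies Ext with the ground field, where any two
  elements are dependent; injectivity of \<open>\<phi>\<close> turns the relation between values
  into one between classes.\<close>

lemma cocycles_dependent:
  assumes \<phi>: "bij_betw \<phi> (carrier Ext) (UNIV :: 'k set)"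
    and add: "\<And>u v. u \<in> carrier Ext \<Longrightarrow> v \<in> carrier Ext \<Longrightarrow> \<phi> (u \<oplus>\<^bsub>Ext\<^esub> v) = \<phi> u + \<phi> v"
    and smult: "\<And>c u. u \<in> carrier Ext \<Longrightarrow> \<phi> (c \<odot>\<^bsub>Ext\<^esub> u) = c * \<phi> u"
    and g: "cocycle A P \<delta> n g" and h: "cocycle A P \<delta> n h"
  obtains c d where "c \<noteq> 0 \<or> d \<noteq> 0" "coboundary A P \<delta> n (\<lambda>y. c \<odot> g y \<oplus> d \<odot> h y)"
proof -
  obtain cl where cl: "\<And>h. cocycle A P \<delta> n h \<Longrightarrow> cl h \<in> carrier Ext"
    "\<And>h. cocycle A P \<delta> n h \<Longrightarrow> cl h = \<zero>\<^bsub>Ext\<^esub> \<longleftrightarrow> coboundary A P \<delta> n h"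
    "\<And>g h c d. cocycle A P \<delta> n g \<Longrightarrow> cocycle A P \<delta> n h \<Longrightarrow>
      cl (\<lambda>y. c \<odot> g y \<oplus> d \<odot> h y) = c \<odot>\<^bsub>Ext\<^esub> cl g \<oplus>\<^bsub>Ext\<^esub> d \<odot>\<^bsub>Ext\<^esub> cl h"
    "\<And>c h. cocycle A P \<delta> n h \<Longrightarrow> c \<odot>\<^bsub>Ext\<^esub> cl h \<in> carrier Ext"
    using cohomology_class by blast
  have val: "\<phi> (cl (\<lambda>y. c \<odot> g y \<oplus> d \<odot> h y)) = c * \<phi> (cl g) + d * \<phi> (cl h)" for c d
    using cl g h add smult by simp
  \<comment> \<open>That \<open>\<phi>\<close> sends zero to \<open>0\<close> is not given; it is
    computed on the class of the combination \<open>0 g + 0 g\<close>.\<close>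
  have z: "cl (\<lambda>y. 0 \<odot> g y \<oplus> 0 \<odot> g y) = \<zero>\<^bsub>Ext\<^esub>"
    using cl(2)[OF cocycle_combination[OF g g, of 0 0]] g
      coboundary_cong[of P n "\<lambda>y. 0 \<odot> g y \<oplus> 0 \<odot> g y" "\<lambda>y. \<zero>"] coboundary_zero[of P \<delta> n]
      left_module_homD(1)[of g A "P n" "regular_module A"]
    by (simp add: cocycle_def regular_ops smult_0_left)
  have "\<phi> (cl (\<lambda>y. 0 \<odot> g y \<oplus> 0 \<odot> g y)) = 0"
    using cl(3)[OF g g, of 0 0] cl(1)[OF g] cl(4)[OF g] add smult by simp
  then have z0: "\<phi> \<zero>\<^bsub>Ext\<^esub> = 0" "\<zero>\<^bsub>Ext\<^esub> \<in> carrier Ext"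
    using z cl(1)[OF cocycle_combination[OF g g, of 0 0]] by simp_all
  \<comment> \<open>The coefficients are the crosswise values of \<open>\<phi>\<close>, unless the
    first value is \<open>0\<close>, when \<open>(1, 0)\<close> ensures that they are not both
    zero.\<close>
  obtain c d where cd: "c \<noteq> 0 \<or> d \<noteq> 0" "c * \<phi> (cl g) + d * \<phi> (cl h) = 0"
  proof (cases "\<phi> (cl g) = 0")
    case True
    then show ?thesis by (intro that[of 1 0]) auto
  next
    case False
    then show ?thesis by (intro that[of "\<phi> (cl h)" "- \<phi> (cl g)"]) auto
  qed
  have co: "cocycle A P \<delta> n (\<lambda>y. c \<odot> g y \<oplus> d \<odot> h y)" by (rule cocycle_combination[OF g h])
  have "cl (\<lambda>y. c \<odot> g y \<oplus> d \<odot> h y) = \<zero>\<^bsub>Ext\<^esub>"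
    using \<phi> cd(2) val[of c d] z0 cl(1)[OF co] by (metis bij_betw_inv_into_left)
  then show ?thesis using cl(2)[OF co] that cd(1) by simp
qed

end

end

section \<open>The tensor algebra\<close>

lemma finite_words [simp]: "finite {w :: 'q::finite list. length w = n}"
  using finite_lists_length_eq[of "UNIV :: 'q set" n] by simp

definition conv :: "('q list \<Rightarrow> 'k::field) \<Rightarrow> ('q list \<Rightarrow> 'k) \<Rightarrow> 'q list \<Rightarrow> 'k" where
  "conv f g w = (\<Sum>i\<le>length w. f (take i w) * g (drop i w))"

lemma conv_Nil [simp]: "conv f g [] = f [] * g []"
  by (simp add: conv_def)

text \<open>Separating the cut before the first letter turns convolution into a recursion on words;
  associativity and the unit laws then follow by induction.\<close>

lemma conv_Cons [simp]: "conv f g (a # w) = f [] * g (a # w) + conv (\<lambda>v. f (a # v)) g w"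
  by (simp add: conv_def sum.atMost_Suc_shift del: sum.atMost_Suc)

lemma conv_add_left: "conv (\<lambda>w. f w + g w) h w = conv f h w + conv g h w"
  by (simp add: conv_def algebra_simps sum.distrib)

lemma conv_add_right: "conv f (\<lambda>w. g w + h w) w = conv f g w + conv f h w"
  by (simp add: conv_def algebra_simps sum.distrib)

lemma conv_scale_left: "conv (\<lambda>w. c * f w) g w = c * conv f g w"
  by (simp add: conv_def sum_distrib_left mult.assoc)

lemma conv_assoc: "conv (conv f g) h w = conv f (conv g h) w"
proof (induction w arbitrary: f)
  case (Cons a w)
  have "conv (\<lambda>v. conv f g (a # v)) h w = f [] * conv (\<lambda>v. g (a # v)) h w + conv (conv (\<lambda>v. f (a # v)) g) h w"
    by (simp add: conv_add_left conv_scale_left)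
  then show ?case using Cons by (simp add: algebra_simps)
qed simp

lemma conv_one_left: "conv (\<lambda>w. if w = [] then 1 else 0) f w = f w"
proof -
  have "conv (\<lambda>w. 0) f w = 0" for w by (simp add: conv_def)
  then show ?thesis by (cases w) auto
qed

lemma conv_one_right: "conv f (\<lambda>w. if w = [] then 1 else 0) w = f w"
  by (induction w arbitrary: f) auto

lemma conv_support: "{w. conv f g w \<noteq> 0} \<subseteq> (\<lambda>(u, v). u @ v) ` ({w. f w \<noteq> 0} \<times> {w. g w \<noteq> 0})"
proof
  fix w assume "w \<in> {w. conv f g w \<noteq> 0}"
  then have "(\<Sum>i\<le>length w. f (take i w) * g (drop i w)) \<noteq> 0" by (simp add: conv_def)
  then obtain i where "f (take i w) * g (drop i w) \<noteq> 0"
    by (rule sum.not_neutral_contains_not_neutral)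
  then show "w \<in> (\<lambda>(u, v). u @ v) ` ({w. f w \<noteq> 0} \<times> {w. g w \<noteq> 0})"
    by (intro rev_image_eqI[of "(take i w, drop i w)"]) simp_all
qed

lemma tensor_algebra_simps:
  "carrier tensor_algebra = {f :: 'q list \<Rightarrow> 'k::field. finite {w. f w \<noteq> 0}}"
  "f \<otimes>\<^bsub>tensor_algebra\<^esub> g = conv f g"
  "\<one>\<^bsub>tensor_algebra\<^esub> = (\<lambda>w. if w = [] then 1 else (0::'k))"
  "\<zero>\<^bsub>tensor_algebra\<^esub> = (\<lambda>w. (0::'k))"
  "f \<oplus>\<^bsub>tensor_algebra\<^esub> g = (\<lambda>w. f w + g w)"
  by (auto simp: tensor_algebra_def conv_def)

lemma ring_tensor_algebra: "ring (tensor_algebra :: ('k::field, 'q list \<Rightarrow> 'k) module)"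
proof (rule ringI)
  show "abelian_group (tensor_algebra :: ('k, 'q list \<Rightarrow> 'k) module)"
  proof (rule abelian_groupI)
    fix f :: "'q list \<Rightarrow> 'k" assume "f \<in> carrier tensor_algebra"
    then show "\<exists>g\<in>carrier tensor_algebra. g \<oplus>\<^bsub>tensor_algebra\<^esub> f = \<zero>\<^bsub>tensor_algebra\<^esub>"
      by (intro bexI[of _ "\<lambda>w. - f w"]) (auto simp: tensor_algebra_simps)
  next
    fix f g :: "'q list \<Rightarrow> 'k" assume "f \<in> carrier tensor_algebra" "g \<in> carrier tensor_algebra"
    then have "finite ({w. f w \<noteq> 0} \<union> {w. g w \<noteq> 0})" by (simp add: tensor_algebra_simps)
    then show "f \<oplus>\<^bsub>tensor_algebra\<^esub> g \<in> carrier tensor_algebra"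
      unfolding tensor_algebra_simps mem_Collect_eq by (rule rev_finite_subset) auto
  qed (auto simp: tensor_algebra_simps algebra_simps)
  show "monoid (tensor_algebra :: ('k, 'q list \<Rightarrow> 'k) module)"
  proof (rule monoidI)
    fix f g :: "'q list \<Rightarrow> 'k" assume "f \<in> carrier tensor_algebra" "g \<in> carrier tensor_algebra"
    then show "f \<otimes>\<^bsub>tensor_algebra\<^esub> g \<in> carrier tensor_algebra"
      using finite_subset[OF conv_support[of f g]] by (simp add: tensor_algebra_simps)
  next
    have "finite {w :: 'q list. (if w = [] then 1 else 0 :: 'k) \<noteq> 0}"
      by (rule finite_subset[of _ "{[]}"]) auto
    then show "\<one>\<^bsub>tensor_algebra\<^esub> \<in> carrier (tensor_algebra :: ('k, 'q list \<Rightarrow> 'k) module)"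
      by (simp add: tensor_algebra_simps)
  qed (simp_all add: tensor_algebra_simps fun_eq_iff conv_assoc conv_one_left conv_one_right)
qed (simp_all add: tensor_algebra_simps fun_eq_iff conv_add_left conv_add_right)

text \<open>This ideal contains the relations, hence the ideal generated by them; it bounds the
  kernel of \<open>evaluate\<close> from above.\<close>

lemma ideal_long_words:
  "ideal {f :: 'q list \<Rightarrow> 'k::field. finite {w. f w \<noteq> 0} \<and> (\<forall>w. length w < N \<longrightarrow> f w = 0)} tensor_algebra"
  (is "ideal ?J ?T")
proof (rule idealI[OF ring_tensor_algebra])
  interpret T: ring ?T by (rule ring_tensor_algebra)
  have J: "?J = {f \<in> carrier ?T. \<forall>w. length w < N \<longrightarrow> f w = 0}" by (auto simp: tensor_algebra_simps)
  have inv: "\<ominus>\<^bsub>?T\<^esub> f = (\<lambda>w. - f w)" if "f \<in> carrier ?T" for f :: "'q list \<Rightarrow> 'k"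
    using that by (intro T.minus_equality) (auto simp: tensor_algebra_simps)
  show "subgroup ?J (add_monoid ?T)"
  proof (rule T.add.subgroupI)
    fix f g :: "'q list \<Rightarrow> 'k" assume "f \<in> ?J" "g \<in> ?J"
    then show "f \<oplus>\<^bsub>?T\<^esub> g \<in> ?J"
      using T.a_closed[of f g] unfolding J by (auto simp: tensor_algebra_simps(5))
  next
    fix f :: "'q list \<Rightarrow> 'k" assume "f \<in> ?J"
    then show "\<ominus>\<^bsub>?T\<^esub> f \<in> ?J"
      using T.a_inv_closed[of f] unfolding J by (auto simp: inv)
  qed (auto simp: tensor_algebra_simps intro: exI[of _ "\<lambda>w. 0"])
next
  interpret T: ring ?T by (rule ring_tensor_algebra)
  have J: "?J = {f \<in> carrier ?T. \<forall>w. length w < N \<longrightarrow> f w = 0}" by (auto simp: tensor_algebra_simps)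
  fix f g :: "'q list \<Rightarrow> 'k" assume f: "f \<in> ?J" and g: "g \<in> carrier ?T"
  have "conv g f w = 0" "conv f g w = 0" if "length w < N" for w
    using f that by (auto simp: conv_def intro!: sum.neutral)
  then show "g \<otimes>\<^bsub>?T\<^esub> f \<in> ?J" "f \<otimes>\<^bsub>?T\<^esub> g \<in> ?J"
    using T.m_closed[of f g] T.m_closed[of g f] f g unfolding J by (auto simp: tensor_algebra_simps(2))
qed

section \<open>Coefficients in degrees below \<open>N\<close>\<close>

locale homogeneous = unital_algebra A for A :: "('k::field, 'a) module" (structure) +
  fixes x :: "'q::finite \<Rightarrow> 'a" and R :: "('q list \<Rightarrow> 'k) set" and N :: nat
  assumes homogeneous: "homogeneous_algebra N A x R"
begin

lemma N_ge_2: "2 \<le> N"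
  using homogeneous by (simp add: homogeneous_algebra_def)

lemma gen_closed [simp]: "x i \<in> carrier A"
  using homogeneous by (auto simp: homogeneous_algebra_def)

lemma word_prod_Nil [simp]: "word_prod A x [] = \<one>"
  by (simp add: word_prod_def)

lemma word_prod_Cons [simp]: "word_prod A x (i # w) = x i \<otimes> word_prod A x w"
  by (simp add: word_prod_def)

lemma word_prod_closed [simp]: "word_prod A x w \<in> carrier A"
  by (induction w) auto

lemma evaluate_superset:
  assumes "finite S" "{w. f w \<noteq> 0} \<subseteq> S"
  shows "evaluate A x f = (\<Oplus>w\<in>S. f w \<odot> word_prod A x w)"
  unfolding evaluate_def
  by (rule add.finprod_mono_neutral_cong_left)
    (use assms in \<open>auto simp: smult_0_left scale_closed\<close>)

lemma evaluate_closed [simp]: "evaluate A x f \<in> carrier A"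
  unfolding evaluate_def by (intro finsum_closed) (auto simp: scale_closed)

lemma evaluate_add:
  assumes "f \<in> carrier tensor_algebra" "g \<in> carrier tensor_algebra"
  shows "evaluate A x (\<lambda>w. f w + g w) = evaluate A x f \<oplus> evaluate A x g"
proof -
  let ?S = "{w. f w \<noteq> 0} \<union> {w. g w \<noteq> 0}"
  have S: "finite ?S" using assms by (simp add: tensor_algebra_simps)
  have "evaluate A x (\<lambda>w. f w + g w) = (\<Oplus>w\<in>?S. (f w + g w) \<odot> word_prod A x w)"
    by (rule evaluate_superset[OF S]) auto
  also have "\<dots> = (\<Oplus>w\<in>?S. f w \<odot> word_prod A x w \<oplus> g w \<odot> word_prod A x w)"
    by (intro finsum_cong') (auto simp: scale_add_left scale_closed)
  also have "\<dots> = (\<Oplus>w\<in>?S. f w \<odot> word_prod A x w) \<oplus> (\<Oplus>w\<in>?S. g w \<odot> word_prod A x w)"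
    by (intro finsum_addf) (auto simp: scale_closed)
  also have "\<dots> = evaluate A x f \<oplus> evaluate A x g"
    using evaluate_superset[OF S, of f] evaluate_superset[OF S, of g] by simp
  finally show ?thesis .
qed

lemma scale_finsum:
  assumes "finite S" "f \<in> S \<rightarrow> carrier A"
  shows "c \<odot> (\<Oplus>i\<in>S. f i) = (\<Oplus>i\<in>S. c \<odot> f i)"
  using assms
proof (induction S rule: finite_induct)
  case (insert i S)
  then have "f \<in> S \<rightarrow> carrier A" "f i \<in> carrier A" "(\<lambda>i. c \<odot> f i) \<in> S \<rightarrow> carrier A"
    by (auto simp: scale_closed Pi_iff)
  with insert show ?case by (simp add: scale_add_right scale_closed)
qed (simp add: smult_0_right)

lemma evaluate_scale:
  assumes "f \<in> carrier tensor_algebra"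
  shows "evaluate A x (\<lambda>w. c * f w) = c \<odot> evaluate A x f"
proof -
  let ?S = "{w. f w \<noteq> 0}"
  have S: "finite ?S" using assms by (simp add: tensor_algebra_simps)
  have "evaluate A x (\<lambda>w. c * f w) = (\<Oplus>w\<in>?S. (c * f w) \<odot> word_prod A x w)"
    by (rule evaluate_superset[OF S]) auto
  also have "\<dots> = (\<Oplus>w\<in>?S. c \<odot> (f w \<odot> word_prod A x w))"
    by (intro finsum_cong') (auto simp: scale_assoc scale_closed)
  also have "\<dots> = c \<odot> evaluate A x f"
    unfolding evaluate_def by (rule scale_finsum[OF S, symmetric]) (auto simp: scale_closed)
  finally show ?thesis .
qed

definition unit_tensor :: "'q list \<Rightarrow> 'q list \<Rightarrow> 'k" where
  "unit_tensor v = (\<lambda>w. if w = v then 1 else 0)"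

lemma unit_tensor_closed: "unit_tensor v \<in> carrier tensor_algebra"
  by (auto simp: tensor_algebra_simps unit_tensor_def)

lemma evaluate_unit: "evaluate A x (unit_tensor v) = word_prod A x v"
  by (subst evaluate_superset[of "{v}"]) (auto simp: unit_tensor_def scale_one)

text \<open>Left multiplication by the basis vector \<open>i\<close> in the tensor algebra. On
  functionals it is dual to deleting a leading letter \<open>i\<close>.\<close>

definition shift :: "'q \<Rightarrow> ('q list \<Rightarrow> 'k) \<Rightarrow> 'q list \<Rightarrow> 'k" where
  "shift i f w = (case w of [] \<Rightarrow> 0 | j # v \<Rightarrow> if j = i then f v else 0)"

lemma shift_support: "{w. shift i f w \<noteq> 0} = Cons i ` {w. f w \<noteq> 0}"
proof -
  have "shift i f w \<noteq> 0 \<longleftrightarrow> (\<exists>v. w = i # v \<and> f v \<noteq> 0)" for w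
    by (cases w) (auto simp: shift_def)
  then show ?thesis by (auto simp: image_iff)
qed

lemma shift_closed:
  assumes "f \<in> carrier tensor_algebra"
  shows "shift i f \<in> carrier tensor_algebra"
  using assms by (simp add: tensor_algebra_simps shift_support)

lemma evaluate_shift:
  assumes "f \<in> carrier tensor_algebra"
  shows "evaluate A x (shift i f) = x i \<otimes> evaluate A x f"
proof -
  let ?S = "{w. f w \<noteq> 0}"
  have S: "finite ?S" using assms by (simp add: tensor_algebra_simps)
  have "evaluate A x (shift i f) = (\<Oplus>w\<in>Cons i ` ?S. shift i f w \<odot> word_prod A x w)"
    by (rule evaluate_superset) (use S in \<open>simp_all add: shift_support\<close>)
  also have "\<dots> = (\<Oplus>v\<in>?S. shift i f (i # v) \<odot> word_prod A x (i # v))"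
    by (rule finsum_reindex) (auto simp: scale_closed)
  also have "\<dots> = (\<Oplus>v\<in>?S. x i \<otimes> (f v \<odot> word_prod A x v))"
    by (intro finsum_cong') (auto simp: shift_def scale_closed scale_mult_right)
  also have "\<dots> = x i \<otimes> evaluate A x f"
    unfolding evaluate_def by (rule finsum_rdistr[OF S, symmetric]) (auto simp: scale_closed)
  finally show ?thesis .
qed

lemma evaluate_onto: "a \<in> carrier A \<Longrightarrow> \<exists>f\<in>carrier tensor_algebra. evaluate A x f = a"
proof -
  assume "a \<in> carrier A"
  then have "a \<in> evaluate A x ` carrier tensor_algebra"
    using homogeneous by (simp add: homogeneous_algebra_def)
  then show ?thesis by blast
qed

text \<open>The kernel is generated by relations of length \<open>N\<close>, so it lies in the ideal
  of \<open>ideal_long_words\<close>.\<close>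

lemma evaluate_kernel:
  assumes "f \<in> carrier tensor_algebra" "evaluate A x f = \<zero>" "length w < N"
  shows "f w = 0"
proof -
  interpret T: ring "tensor_algebra :: ('k, 'q list \<Rightarrow> 'k) module" by (rule ring_tensor_algebra)
  have len: "length w = N" if "f \<in> R" "f w \<noteq> 0" for f w
    using homogeneous that unfolding homogeneous_algebra_def tensor_power_def by blast
  have fin: "finite {w. f w \<noteq> 0}" if "f \<in> R" for f
    by (rule finite_subset[OF _ finite_words[of N]]) (use len[OF that] in blast)
  have "R \<subseteq> {f. finite {w. f w \<noteq> 0} \<and> (\<forall>w. length w < N \<longrightarrow> f w = 0)}"
    using len fin by (intro subsetI CollectI conjI allI impI) (simp, metis less_irrefl)
  then have "Idl\<^bsub>tensor_algebra\<^esub> R \<subseteq> {f. finite {w. f w \<noteq> 0} \<and> (\<forall>w. length w < N \<longrightarrow> f w = 0)}"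
    by (rule T.genideal_minimal[OF ideal_long_words])
  moreover have "f \<in> Idl\<^bsub>tensor_algebra\<^esub> R"
    using assms(1,2) homogeneous unfolding homogeneous_algebra_def by blast
  ultimately show ?thesis using assms(3) by auto
qed

text \<open>Well defined for words of length less than \<open>N\<close>, as the relations have degree \<open>N\<close>.\<close>

definition coef :: "'q list \<Rightarrow> 'a \<Rightarrow> 'k" where
  "coef w a = (SOME f. f \<in> carrier tensor_algebra \<and> evaluate A x f = a) w"

text \<open>Two representatives of one element differ by an element of the kernel, which vanishes on
  short words; so the choice made in \<open>coef\<close> does not matter.\<close>

lemma coef_evaluate:
  assumes f: "f \<in> carrier tensor_algebra" and w: "length w < N"
  shows "coef w (evaluate A x f) = f w"
proof -
  interpret T: ring "tensor_algebra :: ('k, 'q list \<Rightarrow> 'k) module" by (rule ring_tensor_algebra)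
  let ?g = "SOME g. g \<in> carrier tensor_algebra \<and> evaluate A x g = evaluate A x f"
  have "?g \<in> carrier tensor_algebra \<and> evaluate A x ?g = evaluate A x f"
    by (rule someI[of _ f]) (use f in simp)
  then have g: "?g \<in> carrier tensor_algebra" "evaluate A x ?g = evaluate A x f" by auto
  have mf: "(\<lambda>w. - 1 * f w) \<in> carrier tensor_algebra" using f by (simp add: tensor_algebra_simps)
  have "evaluate A x (\<lambda>w. ?g w + - 1 * f w) = \<zero>"
    using evaluate_add[OF g(1) mf] evaluate_scale[OF f, of "- 1"] g(2)
    by (simp add: smult_neg_one r_neg)
  moreover have "(\<lambda>w. ?g w + - 1 * f w) \<in> carrier tensor_algebra"
    using T.a_closed[OF g(1) mf] by (simp only: tensor_algebra_simps(5))
  ultimately have "?g w + - 1 * f w = 0" using evaluate_kernel w by blast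
  then show ?thesis by (simp add: coef_def)
qed

lemma
  assumes w: "length w < N"
  shows coef_add: "a \<in> carrier A \<Longrightarrow> b \<in> carrier A \<Longrightarrow> coef w (a \<oplus> b) = coef w a + coef w b"
    and coef_scale: "a \<in> carrier A \<Longrightarrow> coef w (c \<odot> a) = c * coef w a"
    and coef_one: "coef w \<one> = (if w = [] then 1 else 0)"
    and coef_zero: "coef w \<zero> = 0"
    and coef_gen: "a \<in> carrier A \<Longrightarrow>
      coef w (x i \<otimes> a) = (case w of [] \<Rightarrow> 0 | j # v \<Rightarrow> if j = i then coef v a else 0)"
proof -
  interpret T: ring "tensor_algebra :: ('k, 'q list \<Rightarrow> 'k) module" by (rule ring_tensor_algebra)
  show "coef w (a \<oplus> b) = coef w a + coef w b" if a: "a \<in> carrier A" "b \<in> carrier A"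
  proof -
    obtain f g where f: "f \<in> carrier tensor_algebra" "evaluate A x f = a"
      "g \<in> carrier tensor_algebra" "evaluate A x g = b"
      using evaluate_onto[OF a(1)] evaluate_onto[OF a(2)] by blast
    have "coef w (evaluate A x (\<lambda>w. f w + g w)) = f w + g w"
      using T.a_closed[OF f(1,3)] by (intro coef_evaluate w) (simp only: tensor_algebra_simps(5))
    then show ?thesis using evaluate_add[OF f(1,3)] coef_evaluate[OF f(1) w] coef_evaluate[OF f(3) w] f by simp
  qed
  show scale: "coef w (c \<odot> a) = c * coef w a" if a: "a \<in> carrier A" for c a
  proof -
    obtain f where f: "f \<in> carrier tensor_algebra" "evaluate A x f = a"
      using evaluate_onto[OF a] by blast
    have "(\<lambda>w. c * f w) \<in> carrier tensor_algebra"
      using f(1) by (auto simp: tensor_algebra_simps elim!: rev_finite_subset)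
    from coef_evaluate[OF this w] show ?thesis using evaluate_scale[OF f(1)] coef_evaluate[OF f(1) w] f by simp
  qed
  show "coef w \<one> = (if w = [] then 1 else 0)"
    using coef_evaluate[OF unit_tensor_closed w, of "[]", unfolded evaluate_unit] by (simp add: unit_tensor_def)
  show "coef w \<zero> = 0" using scale[of "\<zero>" 0] by (simp add: smult_0_left)
  show "coef w (x i \<otimes> a) = (case w of [] \<Rightarrow> 0 | j # v \<Rightarrow> if j = i then coef v a else 0)"
    if a: "a \<in> carrier A"
  proof -
    obtain f where f: "f \<in> carrier tensor_algebra" "evaluate A x f = a"
      using evaluate_onto[OF a] by blast
    then show ?thesis
      using coef_evaluate[OF shift_closed[OF f(1)] w, of i] coef_evaluate[OF f(1)] w
      by (auto simp: evaluate_shift shift_def split: list.split)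
  qed
qed

lemma coef_finsum:
  assumes "length w < N" "finite S" "f \<in> S \<rightarrow> carrier A"
  shows "coef w (\<Oplus>i\<in>S. f i) = (\<Sum>i\<in>S. coef w (f i))"
  using assms(2,3)
proof (induction S rule: finite_induct)
  case (insert i S)
  then have "f \<in> S \<rightarrow> carrier A" "f i \<in> carrier A" by auto
  with insert show ?case using assms(1) by (simp add: coef_add)
qed (simp add: assms(1) coef_zero)

text \<open>Every element is a combination of words, and words are built by multiplying by
  generators on the left. This takes the place of an induction on the degree.\<close>

lemma algebra_induct [consumes 1, case_names zero one add scale gen]:
  assumes a: "a \<in> carrier A" and "Q \<zero>" "Q \<one>"
    and add: "\<And>a b. a \<in> carrier A \<Longrightarrow> b \<in> carrier A \<Longrightarrow> Q a \<Longrightarrow> Q b \<Longrightarrow> Q (a \<oplus> b)"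
    and scale: "\<And>c a. a \<in> carrier A \<Longrightarrow> Q a \<Longrightarrow> Q (c \<odot> a)"
    and gen: "\<And>i a. a \<in> carrier A \<Longrightarrow> Q a \<Longrightarrow> Q (x i \<otimes> a)"
  shows "Q a"
proof -
  obtain f where f: "f \<in> carrier tensor_algebra" "evaluate A x f = a"
    using a evaluate_onto by blast
  have word: "Q (word_prod A x w)" for w
    by (induction w) (auto intro: gen \<open>Q \<one>\<close>)
  have "Q (\<Oplus>w\<in>S. f w \<odot> word_prod A x w)" if "finite S" for S
    using that
  proof (induction S rule: finite_induct)
    case (insert w S)
    have "(\<lambda>w. f w \<odot> word_prod A x w) \<in> S \<rightarrow> carrier A" by (auto simp: scale_closed)
    with insert show ?case by (auto simp: scale_closed intro!: add scale word)
  qed (simp add: \<open>Q \<zero>\<close>)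
  from this[of "{w. f w \<noteq> 0}"] show ?thesis
    using f unfolding evaluate_def tensor_algebra_simps mem_Collect_eq by simp
qed

text \<open>So \<open>coef []\<close> is the augmentation, a homomorphism to the ground
  field.\<close>

lemma coef_Nil_mult:
  assumes "a \<in> carrier A" "b \<in> carrier A"
  shows "coef [] (a \<otimes> b) = coef [] a * coef [] b"
proof -
  have N: "length [] < N" using N_ge_2 by simp
  note c = coef_add[OF N] coef_scale[OF N] coef_zero[OF N] coef_one[OF N] coef_gen[OF N]
  show ?thesis using assms
    by (induction a rule: algebra_induct)
      (simp_all add: c l_distr scale_closed scale_mult_left m_assoc algebra_simps)
qed

lemma coef_generator: "coef [] (x i) = 0" "coef [l] (x i) = (if l = i then 1 else 0)"
  using coef_gen[of "[]" "\<one>" i] coef_gen[of "[l]" "\<one>" i] N_ge_2 coef_one[of "[]"] by auto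

text \<open>A Leibniz rule in which the other factor acts through the augmentation. If one factor
  has no constant term, a single summand survives.\<close>

lemma coef_single_mult:
  assumes "a \<in> carrier A" "b \<in> carrier A"
  shows "coef [l] (a \<otimes> b) = coef [l] a * coef [] b + coef [] a * coef [l] b"
proof -
  have N: "length [l] < N" "length [] < N" using N_ge_2 by simp_all
  note c = coef_add[OF N(1)] coef_scale[OF N(1)] coef_zero[OF N(1)] coef_one[OF N(1)] coef_gen[OF N(1)]
    coef_add[OF N(2)] coef_scale[OF N(2)] coef_zero[OF N(2)] coef_one[OF N(2)] coef_gen[OF N(2)]
  show ?thesis using assms
    by (induction a rule: algebra_induct)
      (simp_all add: c l_distr scale_closed scale_mult_left m_assoc algebra_simps coef_Nil_mult coef_generator)
qed

lemma augmentation_ideal_iff: "a \<in> augmentation_ideal A x \<longleftrightarrow> a \<in> carrier A \<and> coef [] a = 0"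
proof
  assume "a \<in> augmentation_ideal A x"
  then show "a \<in> carrier A \<and> coef [] a = 0"
    using coef_evaluate[of _ "[]"] N_ge_2 by (auto simp: augmentation_ideal_def)
next
  assume a: "a \<in> carrier A \<and> coef [] a = 0"
  then obtain f where f: "f \<in> carrier tensor_algebra" "evaluate A x f = a" using evaluate_onto by meson
  then show "a \<in> augmentation_ideal A x"
    using a coef_evaluate[OF f(1), of "[]"] N_ge_2 by (auto simp: augmentation_ideal_def)
qed

text \<open>The generators stand on the right: the augmentation ideal is generated by them as a left
  ideal. This is exactness of the Koszul complex in homological degree 0, which
  \<open>koszul\<close> does not cover.\<close>

lemma right_generators:
  assumes "a \<in> carrier A"
  shows "\<exists>b. (\<forall>i. b i \<in> carrier A) \<and> a = coef [] a \<odot> \<one> \<oplus> (\<Oplus>i\<in>UNIV. b i \<otimes> x i)"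
proof -
  have N: "length [] < N" using N_ge_2 by simp
  note c = coef_add[OF N] coef_scale[OF N] coef_zero[OF N] coef_one[OF N] coef_gen[OF N]
  show ?thesis using assms
  proof (induction a rule: algebra_induct)
    case zero
    show ?case by (rule exI[of _ "\<lambda>_. \<zero>"]) (simp add: c smult_0_left)
  next
    case one
    show ?case by (rule exI[of _ "\<lambda>_. \<zero>"]) (simp add: c scale_one)
  next
    case (add a a')
    then obtain b b' where b: "\<forall>i. b i \<in> carrier A" "a = coef [] a \<odot> \<one> \<oplus> (\<Oplus>i\<in>UNIV. b i \<otimes> x i)"
      and b': "\<forall>i. b' i \<in> carrier A" "a' = coef [] a' \<odot> \<one> \<oplus> (\<Oplus>i\<in>UNIV. b' i \<otimes> x i)" by blast
    have "(\<Oplus>i\<in>UNIV. (b i \<oplus> b' i) \<otimes> x i) = (\<Oplus>i\<in>UNIV. b i \<otimes> x i \<oplus> b' i \<otimes> x i)"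
      using b(1) b'(1) by (intro finsum_cong') (auto simp: l_distr)
    also have "\<dots> = (\<Oplus>i\<in>UNIV. b i \<otimes> x i) \<oplus> (\<Oplus>i\<in>UNIV. b' i \<otimes> x i)"
      using b(1) b'(1) by (intro finsum_addf) auto
    finally have "coef [] (a \<oplus> a') \<odot> \<one> \<oplus> (\<Oplus>i\<in>UNIV. (b i \<oplus> b' i) \<otimes> x i) =
      (coef [] a \<odot> \<one> \<oplus> coef [] a' \<odot> \<one>) \<oplus> ((\<Oplus>i\<in>UNIV. b i \<otimes> x i) \<oplus> (\<Oplus>i\<in>UNIV. b' i \<otimes> x i))"
      using add.hyps by (simp add: c scale_add_left)
    also have "\<dots> = (coef [] a \<odot> \<one> \<oplus> (\<Oplus>i\<in>UNIV. b i \<otimes> x i)) \<oplus> (coef [] a' \<odot> \<one> \<oplus> (\<Oplus>i\<in>UNIV. b' i \<otimes> x i))"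
      using b(1) b'(1) scale_closed[OF one_closed] by (simp add: a_ac Pi_iff)
    finally show ?case using b b' by (intro exI[of _ "\<lambda>i. b i \<oplus> b' i"]) auto
  next
    case (scale d a)
    then obtain b where b: "\<forall>i. b i \<in> carrier A" "a = coef [] a \<odot> \<one> \<oplus> (\<Oplus>i\<in>UNIV. b i \<otimes> x i)" by blast
    have "(\<Oplus>i\<in>UNIV. (d \<odot> b i) \<otimes> x i) = (\<Oplus>i\<in>UNIV. d \<odot> (b i \<otimes> x i))"
      using b(1) by (intro finsum_cong') (auto simp: scale_mult_left scale_closed)
    also have "\<dots> = d \<odot> (\<Oplus>i\<in>UNIV. b i \<otimes> x i)"
      using b(1) by (intro scale_finsum[symmetric]) auto
    finally have "coef [] (d \<odot> a) \<odot> \<one> \<oplus> (\<Oplus>i\<in>UNIV. (d \<odot> b i) \<otimes> x i) =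
      d \<odot> (coef [] a \<odot> \<one> \<oplus> (\<Oplus>i\<in>UNIV. b i \<otimes> x i))"
      using scale.hyps b(1) scale_closed[OF one_closed]
      by (simp add: c scale_add_right scale_assoc Pi_iff)
    then show ?case using b scale_closed by (intro exI[of _ "\<lambda>i. d \<odot> b i"]) auto
  next
    case (gen j a)
    then obtain b where b: "\<forall>i. b i \<in> carrier A" "a = coef [] a \<odot> \<one> \<oplus> (\<Oplus>i\<in>UNIV. b i \<otimes> x i)" by blast
    \<comment> \<open>In \<open>x j a\<close> the constant term of \<open>a\<close> leaves a
      multiple of \<open>x j\<close> itself, which has to be added to the coefficient at index
      \<open>j\<close>.\<close>
    let ?d = "\<lambda>i. if j = i then coef [] a \<odot> \<one> else \<zero>"
    have d: "?d i \<in> carrier A" for i by (simp add: scale_closed)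
    have "(\<Oplus>i\<in>UNIV. (x j \<otimes> b i \<oplus> ?d i) \<otimes> x i) = (\<Oplus>i\<in>UNIV. x j \<otimes> (b i \<otimes> x i) \<oplus> ?d i \<otimes> x i)"
      using b(1) d by (intro finsum_cong') (auto simp: l_distr m_assoc)
    also have "\<dots> = (\<Oplus>i\<in>UNIV. x j \<otimes> (b i \<otimes> x i)) \<oplus> (\<Oplus>i\<in>UNIV. ?d i \<otimes> x i)"
      using b(1) d by (intro finsum_addf) auto
    also have "(\<Oplus>i\<in>UNIV. ?d i \<otimes> x i) = (\<Oplus>i\<in>UNIV. if j = i then coef [] a \<odot> x i else \<zero>)"
      by (intro finsum_cong') (auto simp: scale_mult_left scale_closed)
    also have "\<dots> = coef [] a \<odot> x j"
      by (rule finsum_singleton) (auto simp: scale_closed)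
    also have "(\<Oplus>i\<in>UNIV. x j \<otimes> (b i \<otimes> x i)) = x j \<otimes> (\<Oplus>i\<in>UNIV. b i \<otimes> x i)"
      using b(1) by (intro finsum_rdistr[symmetric]) auto
    finally have "coef [] (x j \<otimes> a) \<odot> \<one> \<oplus> (\<Oplus>i\<in>UNIV. (x j \<otimes> b i \<oplus> ?d i) \<otimes> x i) =
      x j \<otimes> (coef [] a \<odot> \<one> \<oplus> (\<Oplus>i\<in>UNIV. b i \<otimes> x i))"
      using gen.hyps b(1)
      by (simp add: c smult_0_left r_distr scale_mult_right scale_closed a_comm Pi_iff)
    then show ?case using b d by (intro exI[of _ "\<lambda>i. x j \<otimes> b i \<oplus> ?d i"]) auto
  qed
qed

end

section \<open>The Koszul complex as a projective resolution\<close>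

text \<open>The definition of projectivity wants basis indices of the same type as the elements of
  \<open>P\<close>. An arbitrary index set \<open>Y\<close> is transported there along the injection
  \<open>e\<close>, by reindexing in both directions.\<close>

lemma projective_moduleI:
  fixes P :: "('a, 'm) module" and e :: "'y \<Rightarrow> 'm"
  assumes P: "left_module A P" and e: "inj_on e Y"
    and \<iota>: "\<iota> \<in> left_module_hom A P (free_module A Y)"
    and \<pi>: "\<pi> \<in> left_module_hom A (free_module A Y) P"
    and \<pi>\<iota>: "\<And>m. m \<in> carrier P \<Longrightarrow> \<pi> (\<iota> m) = m"
  shows "projective_module A P"
proof -
  interpret P: left_module A P by fact
  let ?up = "\<lambda>f j. if j \<in> e ` Y then f (inv_into Y e j) else \<zero>\<^bsub>A\<^esub>"
  let ?down = "\<lambda>g i. if i \<in> Y then g (e i) else \<zero>\<^bsub>A\<^esub>"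
  have up: "?up \<in> left_module_hom A (free_module A Y) (free_module A (e ` Y))"
  proof (rule left_module_homI)
    fix f assume f: "f \<in> carrier (free_module A Y)"
    have "{j. ?up f j \<noteq> \<zero>\<^bsub>A\<^esub>} \<subseteq> e ` {i. f i \<noteq> \<zero>\<^bsub>A\<^esub>}" using e by (auto split: if_splits)
    then have "finite {j. ?up f j \<noteq> \<zero>\<^bsub>A\<^esub>}" using f finite_subset unfolding free_module_carrier by blast
    then show "?up f \<in> carrier (free_module A (e ` Y))"
      using f by (simp add: free_module_carrier)
  qed (auto simp: free_module_ops fun_eq_iff)
  have down: "?down \<in> left_module_hom A (free_module A (e ` Y)) (free_module A Y)"
  proof (rule left_module_homI)
    fix g assume g: "g \<in> carrier (free_module A (e ` Y))"
    have "e ` {i. ?down g i \<noteq> \<zero>\<^bsub>A\<^esub>} \<subseteq> {j. g j \<noteq> \<zero>\<^bsub>A\<^esub>}" by (auto split: if_splits)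
    then have "finite (e ` {i. ?down g i \<noteq> \<zero>\<^bsub>A\<^esub>})"
      using g finite_subset unfolding free_module_carrier by blast
    moreover have "inj_on e {i. ?down g i \<noteq> \<zero>\<^bsub>A\<^esub>}"
      by (rule inj_on_subset[OF e]) (auto split: if_splits)
    ultimately have "finite {i. ?down g i \<noteq> \<zero>\<^bsub>A\<^esub>}" by (rule finite_imageD)
    then show "?down g \<in> carrier (free_module A Y)"
      using g by (simp add: free_module_carrier)
  qed (auto simp: free_module_ops fun_eq_iff)
  have du: "?down (?up f) = f" if "f \<in> carrier (free_module A Y)" for f
  proof
    fix i show "?down (?up f) i = f i"
      using that e by (cases "f i = \<zero>\<^bsub>A\<^esub>") (auto simp: free_module_carrier)
  qed
  show ?thesis
    unfolding projective_module_def
  proof (intro conjI exI ballI)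
    show "(\<lambda>m. ?up (\<iota> m)) \<in> left_module_hom A P (free_module A (e ` Y))"
      by (rule left_module_hom_comp[OF \<iota> up])
    show "(\<lambda>g. \<pi> (?down g)) \<in> left_module_hom A (free_module A (e ` Y)) P"
      by (rule left_module_hom_comp[OF down \<pi>])
    show "\<pi> (?down (?up (\<iota> m))) = m" if "m \<in> carrier P" for m
      unfolding du[OF left_module_homD(1)[OF \<iota> that]] by (rule \<pi>\<iota>[OF that])
  qed (rule P)
qed

lemma subspace_tensor_power: "tens.subspace (tensor_power n :: ('q::finite list \<Rightarrow> 'k::field) set)"
proof (rule tens.subspaceI)
  fix f g :: "'q list \<Rightarrow> 'k" assume "f \<in> tensor_power n" "g \<in> tensor_power n"
  then show "f + g \<in> tensor_power n" unfolding tensor_power_def plus_fun_def by force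
qed (auto simp: tensor_power_def)

lemma tensor_power_mult:
  fixes f g :: "'q::finite list \<Rightarrow> 'k::field"
  assumes "f \<in> tensor_power m" "g \<in> tensor_power n"
  shows "f \<otimes>\<^bsub>tensor_algebra\<^esub> g \<in> tensor_power (m + n)"
proof -
  have "length w = m + n" if "conv f g w \<noteq> 0" for w
    using that conv_support[of f g] assms by (fastforce simp: tensor_power_def)
  then show ?thesis by (simp add: tensor_algebra_simps tensor_power_def)
qed

lemma
  assumes R: "R \<subseteq> tensor_power N" "tens.subspace R"
  shows subspace_koszul_space: "tens.subspace (koszul_space N R n)"
    and koszul_space_subset: "koszul_space N R n \<subseteq> tensor_power n"
proof -
  show "tens.subspace (koszul_space N R n)"
    by (auto simp: koszul_space_def subspace_tensor_power intro!: tens.subspace_Inter)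
  show "koszul_space N R n \<subseteq> tensor_power n"
  proof (cases "n < N")
    case True
    then show ?thesis by (simp add: koszul_space_def)
  next
    case False
    let ?G = "\<lambda>r. {u \<otimes>\<^bsub>tensor_algebra\<^esub> \<rho> \<otimes>\<^bsub>tensor_algebra\<^esub> v | u \<rho> v.
      u \<in> tensor_power r \<and> \<rho> \<in> R \<and> v \<in> tensor_power (n - N - r)}"
    \<comment> \<open>One member of the intersection already has the right degree;
      \<open>r = 0\<close> always belongs to the index range.\<close>
    have "tens.span (?G 0) \<subseteq> tensor_power n"
    proof (rule tens.span_minimal[OF _ subspace_tensor_power], rule subsetI)
      fix \<eta> assume "\<eta> \<in> ?G 0"
      then obtain u \<rho> v where "\<eta> = u \<otimes>\<^bsub>tensor_algebra\<^esub> \<rho> \<otimes>\<^bsub>tensor_algebra\<^esub> v"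
        "u \<in> tensor_power 0" "\<rho> \<in> tensor_power N" "v \<in> tensor_power (n - N)" using R(1) by auto
      then show "\<eta> \<in> tensor_power n"
        using tensor_power_mult[OF tensor_power_mult, of u 0 \<rho> N v "n - N"] False by simp
    qed
    then have "(\<Inter>r\<in>{0..n - N}. tens.span (?G r)) \<subseteq> tensor_power n"
      by (rule INF_lower2[rotated]) simp
    then show ?thesis using False by (simp only: koszul_space_def if_False)
  qed
qed

lemma sum_fun_apply: "(\<Sum>i\<in>S. f i) w = (\<Sum>i\<in>S. f i w)"
  by (induction S rule: infinite_finite_induct) (simp_all add: plus_fun_def zero_fun_def)

text \<open>A linear projector onto \<open>K\<close> recorded as a matrix: its columns lie in
  \<open>K\<close>, and it fixes \<open>K\<close>. In matrix form it can also be applied to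
  functions with values in \<open>A\<close>.\<close>

lemma tensor_projector:
  fixes K :: "('q::finite list \<Rightarrow> 'k::field) set"
  assumes K: "tens.subspace K" "K \<subseteq> tensor_power n"
  obtains p where "\<And>v. (\<lambda>w. p w v) \<in> K"
    and "\<And>\<eta> w. \<eta> \<in> K \<Longrightarrow> \<eta> w = (\<Sum>v | length v = n. p w v * \<eta> v)"
proof -
  let ?s = "\<lambda>(c::'k) (f::'q list \<Rightarrow> 'k) w. c * f w"
  interpret vector_space_pair ?s ?s by unfold_locales
  obtain g where g: "range g \<subseteq> K" "Vector_Spaces.linear ?s ?s g" "\<And>v. v \<in> K \<Longrightarrow> g v = v"
    using linear_exists_left_inverse_on[OF tens.linear_ident K(1)] by auto
  interpret g: Vector_Spaces.linear ?s ?s g by fact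
  let ?u = "\<lambda>v w. if w = v then 1 else (0::'k)"
  show ?thesis
  proof (rule that[of "\<lambda>w v. g (?u v) w"])
    show "(\<lambda>w. g (?u v) w) \<in> K" for v using g(1) by auto
    fix \<eta> w assume \<eta>: "\<eta> \<in> K"
    then have "\<eta> = (\<Sum>v | length v = n. ?s (\<eta> v) (?u v))"
      using K(2) by (auto simp: fun_eq_iff sum_fun_apply tensor_power_def if_distrib sum.delta cong: if_cong)
    then have "g \<eta> = g (\<Sum>v | length v = n. ?s (\<eta> v) (?u v))" by (rule arg_cong)
    also have "\<dots> = (\<Sum>v | length v = n. ?s (\<eta> v) (g (?u v)))"
      by (simp only: g.sum g.scale)
    finally have "g \<eta> = (\<Sum>v | length v = n. ?s (\<eta> v) (g (?u v)))" .
    then have "\<eta> w = (\<Sum>v | length v = n. ?s (\<eta> v) (g (?u v))) w"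
      unfolding g(3)[OF \<eta>] by (rule fun_cong)
    then show "\<eta> w = (\<Sum>v | length v = n. g (?u v) w * \<eta> v)"
      by (simp only: sum_fun_apply mult.commute)
  qed
qed

section \<open>The modules \<open>A (x) K_n\<close> as direct summands of free modules\<close>

context homogeneous
begin

text \<open>The map \<open>id (x) c\<close> from \<open>A (x) E^n\<close> to \<open>A\<close>, for a
  scalar functional \<open>c\<close> given by its values on words.\<close>

definition pair :: "nat \<Rightarrow> ('q list \<Rightarrow> 'k) \<Rightarrow> ('q list \<Rightarrow> 'a) \<Rightarrow> 'a" where
  "pair n c f = (\<Oplus>w\<in>{w. length w = n}. c w \<odot> f w)"

lemma pair_closed [simp]: "(\<And>w. f w \<in> carrier A) \<Longrightarrow> pair n c f \<in> carrier A"
  unfolding pair_def by (intro finsum_closed) (auto simp: scale_closed)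

lemma pair_add:
  assumes "\<And>w. f w \<in> carrier A" "\<And>w. g w \<in> carrier A"
  shows "pair n c (\<lambda>w. f w \<oplus> g w) = pair n c f \<oplus> pair n c g"
proof -
  have "pair n c (\<lambda>w. f w \<oplus> g w) = (\<Oplus>w\<in>{w. length w = n}. c w \<odot> f w \<oplus> c w \<odot> g w)"
    unfolding pair_def using assms by (intro finsum_cong') (auto simp: scale_add_right scale_closed)
  also have "\<dots> = pair n c f \<oplus> pair n c g"
    unfolding pair_def using assms by (intro finsum_addf) (auto simp: scale_closed)
  finally show ?thesis .
qed

lemma pair_mult:
  assumes "\<And>w. f w \<in> carrier A" "a \<in> carrier A"
  shows "pair n c (\<lambda>w. a \<otimes> f w) = a \<otimes> pair n c f"
proof -
  have "pair n c (\<lambda>w. a \<otimes> f w) = (\<Oplus>w\<in>{w. length w = n}. a \<otimes> (c w \<odot> f w))"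
    unfolding pair_def using assms by (intro finsum_cong') (auto simp: scale_mult_right scale_closed)
  also have "\<dots> = a \<otimes> pair n c f"
    unfolding pair_def using assms by (intro finsum_rdistr[symmetric]) (auto simp: scale_closed)
  finally show ?thesis .
qed

lemma finsum_scalars:
  assumes "finite S" "a \<in> carrier A"
  shows "(\<Oplus>i\<in>S. c i \<odot> a) = (\<Sum>i\<in>S. c i) \<odot> a"
  using assms(1)
proof (induction S rule: finite_induct)
  case (insert i S)
  have "(\<lambda>i. c i \<odot> a) \<in> S \<rightarrow> carrier A" using assms by (auto simp: scale_closed)
  with insert show ?case using assms by (simp add: scale_add_left scale_closed)
qed (simp add: assms smult_0_left)

lemma pair_elementary:
  assumes "a \<in> carrier A"
  shows "pair n c (\<lambda>w. k w \<odot> a) = (\<Sum>w | length w = n. c w * k w) \<odot> a"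
  unfolding finsum_scalars[OF finite_words assms, symmetric] pair_def
  using assms by (intro finsum_cong') (auto simp: scale_assoc scale_closed)

lemma pair_zero: "pair n c (\<lambda>w. \<zero>) = \<zero>"
  using pair_elementary[OF zero_closed, of n c "\<lambda>_. 0"] by (simp add: smult_0_left)

lemma pair_finsum:
  fixes l :: nat
  assumes "\<And>j. j < l \<Longrightarrow> a j \<in> carrier A"
  shows "pair n c (\<lambda>w. \<Oplus>j\<in>{..<l}. k j w \<odot> a j) = (\<Oplus>j\<in>{..<l}. (\<Sum>w | length w = n. c w * k j w) \<odot> a j)"
  using assms
proof (induction l)
  case 0
  show ?case by (simp add: pair_zero)
next
  case (Suc l)
  have a: "a l \<in> carrier A" "(\<lambda>j. k j w \<odot> a j) \<in> {..<l} \<rightarrow> carrier A"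
    "(\<lambda>j. c' j \<odot> a j) \<in> {..<l} \<rightarrow> carrier A" for w c'
    using Suc.prems by (auto simp: scale_closed)
  have "pair n c (\<lambda>w. \<Oplus>j\<in>{..<Suc l}. k j w \<odot> a j) =
      pair n c (\<lambda>w. k l w \<odot> a l \<oplus> (\<Oplus>j\<in>{..<l}. k j w \<odot> a j))"
    using a by (simp add: lessThan_Suc scale_closed)
  also have "\<dots> = pair n c (\<lambda>w. k l w \<odot> a l) \<oplus> pair n c (\<lambda>w. \<Oplus>j\<in>{..<l}. k j w \<odot> a j)"
    using a by (intro pair_add) (simp_all add: scale_closed)
  also have "\<dots> = (\<Oplus>j\<in>{..<Suc l}. (\<Sum>w | length w = n. c w * k j w) \<odot> a j)"
    using a Suc by (simp add: lessThan_Suc scale_closed pair_elementary)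
  finally show ?case .
qed

lemma R_subset: "R \<subseteq> tensor_power N" and R_subspace: "tens.subspace R"
  using homogeneous by (simp_all add: homogeneous_algebra_def)

abbreviation "K n \<equiv> koszul_space N R n"
abbreviation "AK n \<equiv> koszul_module N A R n"

lemmas K_subspace = subspace_koszul_space[OF R_subset R_subspace]
lemmas K_subset = koszul_space_subset[OF R_subset R_subspace]

lemma koszul_space_zero: "(\<lambda>w. 0) \<in> K n"
  using tens.subspace_0[OF K_subspace] by (simp add: zero_fun_def)

lemma AK_carrier:
  assumes "f \<in> AK n"
  shows "f w \<in> carrier A" "length w \<noteq> n \<Longrightarrow> f w = \<zero>"
proof -
  from assms obtain l a k where f: "f = (\<lambda>w. \<Oplus>j\<in>{..<l::nat}. k j w \<odot> a j)"
    and ak: "\<And>j. j < l \<Longrightarrow> a j \<in> carrier A" "\<And>j. j < l \<Longrightarrow> k j \<in> K n"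
    by (auto simp: koszul_module_def)
  show "f w \<in> carrier A" unfolding f using ak by (intro finsum_closed) (auto simp: scale_closed)
  assume w: "length w \<noteq> n"
  then have "k j w = 0" if "j < l" for j
    using ak(2)[OF that] K_subset[of n] by (auto simp: tensor_power_def)
  then have "f w = (\<Oplus>j\<in>{..<l}. \<zero>)"
    unfolding f using ak by (intro finsum_cong') (auto simp: smult_0_left)
  then show "f w = \<zero>" by simp
qed

lemma elementary_in_AK:
  assumes "k \<in> K n" "a \<in> carrier A"
  shows "(\<lambda>w. k w \<odot> a) \<in> AK n"
  unfolding koszul_module_def mem_Collect_eq
  using assms by (intro exI[of _ 1] exI[of _ "\<lambda>_. a"] exI[of _ "\<lambda>_. k"]) (simp add: scale_closed lessThan_Suc)

text \<open>The rows of a projector onto \<open>K\<^sub>n\<close> cut out \<open>A \<otimes> K\<^sub>n\<close> among the functions on words.\<close>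

lemma AK_projector:
  obtains p where "\<And>v. (\<lambda>w. p w v) \<in> K n"
    and "\<And>f. (\<And>w. f w \<in> carrier A) \<Longrightarrow> (\<lambda>w. pair n (p w) f) \<in> AK n"
    and "\<And>f w. f \<in> AK n \<Longrightarrow> pair n (p w) f = f w"
proof -
  obtain p where p: "\<And>v. (\<lambda>w. p w v) \<in> K n"
    "\<And>\<eta> w. \<eta> \<in> K n \<Longrightarrow> \<eta> w = (\<Sum>v | length v = n. p w v * \<eta> v)"
    using tensor_projector[OF K_subspace K_subset, of n] by blast
  show ?thesis
  proof (rule that[of p])
    fix f :: "'q list \<Rightarrow> 'a" assume f: "\<And>w. f w \<in> carrier A"
    \<comment> \<open>The words are numbered because \<open>koszul_module\<close> takes sums indexed
      by an initial segment of the naturals.\<close>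
    obtain h :: "nat \<Rightarrow> 'q list" where h: "bij_betw h {..<card {w::'q list. length w = n}} {w. length w = n}"
      using ex_bij_betw_nat_finite[OF finite_words, of n] unfolding lessThan_atLeast0 by blast
    have "pair n (p w) f = (\<Oplus>j\<in>{..<card {w::'q list. length w = n}}. p w (h j) \<odot> f (h j))" for w
      unfolding pair_def using h f
      by (subst bij_betw_imp_surj_on[OF h, symmetric], intro finsum_reindex)
        (auto simp: scale_closed bij_betw_def)
    then show "(\<lambda>w. pair n (p w) f) \<in> AK n"
      unfolding koszul_module_def using p(1) f
      by (auto intro!: exI[of _ "card {w::'q list. length w = n}"] exI[of _ "\<lambda>j. f (h j)"] exI[of _ "\<lambda>j w. p w (h j)"])
  next
    fix f w assume "f \<in> AK n"
    then obtain l a k where f: "f = (\<lambda>w. \<Oplus>j\<in>{..<l::nat}. k j w \<odot> a j)"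
      and ak: "\<And>j. j < l \<Longrightarrow> a j \<in> carrier A" "\<And>j. j < l \<Longrightarrow> k j \<in> K n"
      by (auto simp: koszul_module_def)
    have "pair n (p w) f = (\<Oplus>j\<in>{..<l}. (\<Sum>v | length v = n. p w v * k j v) \<odot> a j)"
      unfolding f by (rule pair_finsum) (rule ak)
    also have "\<dots> = f w"
      unfolding f using ak p(2) by (intro finsum_cong') (auto simp: scale_closed p(2)[symmetric])
    finally show "pair n (p w) f = f w" .
  qed (rule p)
qed

definition KM :: "nat \<Rightarrow> ('a, 'q list \<Rightarrow> 'a) module" where
  "KM n = (free_module A {w. length w = n}) \<lparr>carrier := AK n\<rparr>"

lemma KM_simps:
  "carrier (KM n) = AK n" "\<zero>\<^bsub>KM n\<^esub> = (\<lambda>w. \<zero>)"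
  "f \<oplus>\<^bsub>KM n\<^esub> g = (\<lambda>w. f w \<oplus> g w)" "a \<odot>\<^bsub>KM n\<^esub> f = (\<lambda>w. a \<otimes> f w)"
  by (simp_all add: KM_def free_module_def)

lemma AK_in_free: "f \<in> AK n \<Longrightarrow> f \<in> carrier (free_module A {w. length w = n})"
  using AK_carrier[of f n] by (auto simp: free_module_carrier intro!: finite_subset[OF _ finite_words[of n]])

text \<open>Membership is tested by the projector: a carrier-valued function that it fixes lies in
  its image. No families of elementary tensors have to be merged.\<close>

lemma AK_add:
  assumes "f \<in> AK n" "g \<in> AK n"
  shows "(\<lambda>w. f w \<oplus> g w) \<in> AK n"
proof -
  obtain p where p: "\<And>f. (\<And>w. f w \<in> carrier A) \<Longrightarrow> (\<lambda>w. pair n (p w) f) \<in> AK n"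
    "\<And>f w. f \<in> AK n \<Longrightarrow> pair n (p w) f = f w" using AK_projector by metis
  note c = AK_carrier(1)[OF assms(1)] AK_carrier(1)[OF assms(2)]
  have "pair n (p w) (\<lambda>w. f w \<oplus> g w) = f w \<oplus> g w" for w
    using pair_add[of f g] c p(2)[OF assms(1)] p(2)[OF assms(2)] by simp
  then show ?thesis using p(1)[of "\<lambda>w. f w \<oplus> g w"] c by simp
qed

lemma AK_mult:
  assumes "f \<in> AK n" "a \<in> carrier A"
  shows "(\<lambda>w. a \<otimes> f w) \<in> AK n"
proof -
  obtain p where p: "\<And>f. (\<And>w. f w \<in> carrier A) \<Longrightarrow> (\<lambda>w. pair n (p w) f) \<in> AK n"
    "\<And>f w. f \<in> AK n \<Longrightarrow> pair n (p w) f = f w" using AK_projector by metis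
  note c = AK_carrier(1)[OF assms(1)]
  have "pair n (p w) (\<lambda>w. a \<otimes> f w) = a \<otimes> f w" for w
    using pair_mult[of f a] c p(2)[OF assms(1)] assms(2) by simp
  then show ?thesis using p(1)[of "\<lambda>w. a \<otimes> f w"] c assms(2) by simp
qed

lemma AK_zero: "(\<lambda>w. \<zero>) \<in> AK n"
  unfolding koszul_module_def by (auto intro!: exI[of _ 0])

lemma left_module_KM: "left_module A (KM n)"
proof -
  have "abelian_group (KM n)"
  proof (rule abelian_groupI)
    fix f assume f: "f \<in> carrier (KM n)"
    show "\<exists>g\<in>carrier (KM n). g \<oplus>\<^bsub>KM n\<^esub> f = \<zero>\<^bsub>KM n\<^esub>"
    proof
      show "(\<lambda>w. \<ominus> \<one> \<otimes> f w) \<in> carrier (KM n)" using f by (simp add: KM_simps AK_mult)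
      show "(\<lambda>w. \<ominus> \<one> \<otimes> f w) \<oplus>\<^bsub>KM n\<^esub> f = \<zero>\<^bsub>KM n\<^esub>"
        using AK_carrier(1)[of f n] f by (simp add: KM_simps l_minus l_neg)
    qed
  next
    fix f g h assume f: "f \<in> carrier (KM n)" "g \<in> carrier (KM n)" "h \<in> carrier (KM n)"
    then show "f \<oplus>\<^bsub>KM n\<^esub> g \<oplus>\<^bsub>KM n\<^esub> h = f \<oplus>\<^bsub>KM n\<^esub> (g \<oplus>\<^bsub>KM n\<^esub> h)"
      using AK_carrier(1) by (simp add: KM_simps a_assoc)
  next
    fix f g assume f: "f \<in> carrier (KM n)" "g \<in> carrier (KM n)"
    then show "f \<oplus>\<^bsub>KM n\<^esub> g = g \<oplus>\<^bsub>KM n\<^esub> f" "f \<oplus>\<^bsub>KM n\<^esub> g \<in> carrier (KM n)"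
      using AK_carrier(1) by (simp_all add: KM_simps a_comm AK_add)
  next
    fix f assume f: "f \<in> carrier (KM n)"
    then show "\<zero>\<^bsub>KM n\<^esub> \<oplus>\<^bsub>KM n\<^esub> f = f" using AK_carrier(1) by (simp add: KM_simps)
  qed (simp add: KM_simps AK_zero)
  then show ?thesis
    using AK_carrier(1)
    by (intro left_moduleI[OF ring_axioms])
      (simp_all add: KM_simps AK_mult l_distr r_distr m_assoc)
qed

lemma KM_projector:
  obtains \<pi> where "\<pi> \<in> left_module_hom A (free_module A {w. length w = n}) (KM n)"
    and "\<And>f. f \<in> AK n \<Longrightarrow> \<pi> f = f"
proof -
  obtain p where p: "\<And>f. (\<And>w. f w \<in> carrier A) \<Longrightarrow> (\<lambda>w. pair n (p w) f) \<in> AK n"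
    "\<And>f w. f \<in> AK n \<Longrightarrow> pair n (p w) f = f w" using AK_projector by metis
  show ?thesis
  proof (rule that[of "\<lambda>f w. pair n (p w) f"])
    show "(\<lambda>f w. pair n (p w) f) \<in> left_module_hom A (free_module A {w. length w = n}) (KM n)"
      using p(1)
      by (intro left_module_homI) (simp_all add: KM_simps free_module_carrier free_module_ops pair_add pair_mult)
  qed (simp add: p(2))
qed

lemma one_not_zero: "\<one> \<noteq> \<zero>"
  using coef_one[of "[]"] coef_zero[of "[]"] N_ge_2 by auto

lemma projective_KM: "projective_module A (KM n)"
proof -
  obtain \<pi> where \<pi>: "\<pi> \<in> left_module_hom A (free_module A {w. length w = n}) (KM n)"
    "\<And>f. f \<in> AK n \<Longrightarrow> \<pi> f = f" using KM_projector by blast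
  show ?thesis
  proof (rule projective_moduleI[OF left_module_KM _ _ \<pi>(1)])
    \<comment> \<open>The basis is indexed by words, but indices must have the type of the module
      elements; the unit vectors serve as such, distinct since \<open>1\<close> differs from
      \<open>0\<close> in \<open>A\<close>.\<close>
    show "inj_on (free_unit A) {w :: 'q list. length w = n}"
      using one_not_zero by (auto simp: inj_on_def free_unit_def fun_eq_iff split: if_splits)
    show "(\<lambda>f. f) \<in> left_module_hom A (KM n) (free_module A {w. length w = n})"
      by (rule left_module_homI) (simp_all add: KM_simps AK_in_free free_module_ops)
  qed (simp add: KM_simps \<pi>)
qed

text \<open>Composing with the projector extends a functional to the free module on words, where it
  is a sum of right multiplications by its values on unit vectors.\<close>

lemma KM_hom_coef:
  assumes \<beta>: "\<beta> \<in> functionals (KM n)"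
  obtains b where "\<And>v. b v \<in> carrier A"
    and "\<And>f. f \<in> AK n \<Longrightarrow> \<beta> f = (\<Oplus>v\<in>{v. length v = n}. f v \<otimes> b v)"
proof -
  obtain \<pi> where \<pi>: "\<pi> \<in> left_module_hom A (free_module A {w. length w = n}) (KM n)"
    "\<And>f. f \<in> AK n \<Longrightarrow> \<pi> f = f" using KM_projector by blast
  note h = left_module_hom_comp[OF \<pi>(1) \<beta>]
  \<comment> \<open>The default zero keeps \<open>b v\<close> in the carrier for words of every
    length.\<close>
  define b where "b v = (if length v = n then \<beta> (\<pi> (free_unit A v)) else \<zero>)" for v
  have b: "b v \<in> carrier A" for v
    using left_module_homD(1)[OF h free_unit_closed[OF ring_axioms, of v]] by (simp add: b_def regular_ops)
  show ?thesis
  proof (rule that[of b, OF b])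
    fix f assume f: "f \<in> AK n"
    have "\<beta> (\<pi> f) = finsum (regular_module A) (\<lambda>i. f i \<odot>\<^bsub>regular_module A\<^esub> \<beta> (\<pi> (free_unit A i))) {v. length v = n}"
      by (rule free_module_hom_eval[OF h left_module_regular[OF ring_axioms] AK_in_free[OF f]])
        (use AK_carrier[OF f] in auto)
    also have "\<dots> = (\<Oplus>v\<in>{v. length v = n}. f v \<otimes> \<beta> (\<pi> (free_unit A v)))"
      by (simp add: finsum_def regular_module_def finprod_def)
    also have "\<dots> = (\<Oplus>v\<in>{v. length v = n}. f v \<otimes> b v)"
      using b AK_carrier(1)[OF f] by (intro finsum_cong') (auto simp: b_def)
    finally show "\<beta> f = (\<Oplus>v\<in>{v. length v = n}. f v \<otimes> b v)" using \<pi>(2)[OF f] by simp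
  qed
qed

end

lemma (in abelian_monoid) finsum_swap:
  assumes "finite S" "finite T" "\<And>i j. f i j \<in> carrier G"
  shows "(\<Oplus>i\<in>S. \<Oplus>j\<in>T. f i j) = (\<Oplus>j\<in>T. \<Oplus>i\<in>S. f i j)"
  using assms(1)
proof (induction S rule: finite_induct)
  case (insert i S)
  have c: "(\<lambda>i. \<Oplus>j\<in>T. f i j) \<in> S \<rightarrow> carrier G" "(\<Oplus>j\<in>T. f i j) \<in> carrier G"
    "(\<lambda>j. f i j) \<in> T \<rightarrow> carrier G" "(\<lambda>j. \<Oplus>i\<in>S. f i j) \<in> T \<rightarrow> carrier G"
    using assms(3) by (auto intro!: finsum_closed)
  have "(\<Oplus>i\<in>insert i S. \<Oplus>j\<in>T. f i j) = (\<Oplus>j\<in>T. f i j) \<oplus> (\<Oplus>j\<in>T. \<Oplus>i\<in>S. f i j)"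
    using insert c by simp
  also have "\<dots> = (\<Oplus>j\<in>T. f i j \<oplus> (\<Oplus>i\<in>S. f i j))"
    by (rule finsum_addf[symmetric]) (rule c)+
  also have "\<dots> = (\<Oplus>j\<in>T. \<Oplus>i\<in>insert i S. f i j)"
    using insert.hyps assms(3) by (intro finsum_cong') (auto simp: Pi_iff intro!: finsum_closed)
  finally show ?case .
qed simp

text \<open>The number of letters that the differential leaving homological degree \<open>j\<close>
  removes, i.e. the difference of consecutive Koszul degrees.\<close>

definition gap :: "nat \<Rightarrow> nat \<Rightarrow> nat" where
  "gap N j = (if even j then N - 1 else 1)"

lemma koszul_diff_gap: "koszul_diff N A x j = koszul_d A x ^^ gap N j"
  by (simp add: koszul_diff_def gap_def)

lemma koszul_degree_Suc: "1 \<le> N \<Longrightarrow> koszul_degree N (Suc j) = koszul_degree N j + gap N (Suc j)"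
  by (cases "even j") (auto simp: koszul_degree_def gap_def elim!: oddE)

section \<open>The Koszul differential in coefficients, and the trivial module\<close>

context homogeneous
begin

lemma koszul_d_closed [simp]: "(\<And>w. f w \<in> carrier A) \<Longrightarrow> koszul_d A x f w \<in> carrier A"
  unfolding koszul_d_def by (intro finsum_closed) auto

lemma koszul_d_add:
  assumes "\<And>w. f w \<in> carrier A" "\<And>w. g w \<in> carrier A"
  shows "koszul_d A x (\<lambda>w. f w \<oplus> g w) = (\<lambda>w. koszul_d A x f w \<oplus> koszul_d A x g w)"
proof
  fix w
  have "koszul_d A x (\<lambda>w. f w \<oplus> g w) w = (\<Oplus>i\<in>UNIV. f (i # w) \<otimes> x i \<oplus> g (i # w) \<otimes> x i)"
    unfolding koszul_d_def using assms by (intro finsum_cong') (auto simp: l_distr)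
  also have "\<dots> = koszul_d A x f w \<oplus> koszul_d A x g w"
    unfolding koszul_d_def using assms by (intro finsum_addf) auto
  finally show "koszul_d A x (\<lambda>w. f w \<oplus> g w) w = koszul_d A x f w \<oplus> koszul_d A x g w" .
qed

lemma koszul_d_mult:
  assumes "\<And>w. f w \<in> carrier A" "a \<in> carrier A"
  shows "koszul_d A x (\<lambda>w. a \<otimes> f w) = (\<lambda>w. a \<otimes> koszul_d A x f w)"
proof
  fix w
  have "koszul_d A x (\<lambda>w. a \<otimes> f w) w = (\<Oplus>i\<in>UNIV. a \<otimes> (f (i # w) \<otimes> x i))"
    unfolding koszul_d_def using assms by (intro finsum_cong') (auto simp: m_assoc)
  also have "\<dots> = a \<otimes> koszul_d A x f w"
    unfolding koszul_d_def using assms by (intro finsum_rdistr[symmetric]) auto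
  finally show "koszul_d A x (\<lambda>w. a \<otimes> f w) w = a \<otimes> koszul_d A x f w" .
qed

lemma koszul_d_pow_closed: "(\<And>w. f w \<in> carrier A) \<Longrightarrow> (koszul_d A x ^^ s) f w \<in> carrier A"
  by (induction s arbitrary: w) auto

lemma koszul_d_pow_add:
  assumes "\<And>w. f w \<in> carrier A" "\<And>w. g w \<in> carrier A"
  shows "(koszul_d A x ^^ s) (\<lambda>w. f w \<oplus> g w) = (\<lambda>w. (koszul_d A x ^^ s) f w \<oplus> (koszul_d A x ^^ s) g w)"
  by (induction s) (simp_all add: koszul_d_add koszul_d_pow_closed assms)

lemma koszul_d_pow_mult:
  assumes "\<And>w. f w \<in> carrier A" "a \<in> carrier A"
  shows "(koszul_d A x ^^ s) (\<lambda>w. a \<otimes> f w) = (\<lambda>w. a \<otimes> (koszul_d A x ^^ s) f w)"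
  by (induction s) (simp_all add: koszul_d_mult koszul_d_pow_closed assms)

lemma coef_Nil_koszul_d:
  assumes "\<And>w. f w \<in> carrier A"
  shows "coef [] (koszul_d A x f w) = 0"
  unfolding koszul_d_def using assms N_ge_2
  by (subst coef_finsum) (auto simp: coef_Nil_mult coef_generator)

text \<open>By the Leibniz rule for \<open>f (i # w) x^i\<close> only the constant term of the first
  factor survives, since generators have no constant term. The linear part of \<open>d f\<close>
  thus recovers the constant part of \<open>f\<close>.\<close>

lemma coef_single_koszul_d:
  assumes "\<And>w. f w \<in> carrier A"
  shows "coef [l] (koszul_d A x f w) = coef [] (f (l # w))"
  unfolding koszul_d_def using assms N_ge_2
  by (subst coef_finsum) (auto simp: coef_single_mult coef_generator if_distrib cong: if_cong)

lemma AK_finsum: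
  assumes "finite S" "\<And>i. i \<in> S \<Longrightarrow> g i \<in> AK n"
  shows "(\<lambda>w. \<Oplus>i\<in>S. g i w) \<in> AK n"
  using assms
proof (induction S rule: finite_induct)
  case (insert i S)
  have "(\<lambda>i. g i w) \<in> S \<rightarrow> carrier A" "g i w \<in> carrier A" for w
    using insert.prems AK_carrier(1) by blast+
  then have "(\<lambda>w. \<Oplus>i\<in>insert i S. g i w) = (\<lambda>w. g i w \<oplus> (\<Oplus>i\<in>S. g i w))"
    using insert.hyps by simp
  then show ?case using insert by (simp add: AK_add)
qed (simp add: AK_zero)

text \<open>Below \<open>N\<close> the space \<open>K_n\<close> is the whole tensor power, so
  membership reduces to a condition on the support. This handles degrees 0 and 1.\<close>

lemma AK_small:
  assumes n: "n < N" and f: "\<And>w. f w \<in> carrier A" "\<And>w. length w \<noteq> n \<Longrightarrow> f w = \<zero>"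
  shows "f \<in> AK n"
proof -
  have "(\<lambda>w. \<Oplus>v\<in>{v. length v = n}. unit_tensor v w \<odot> f v) \<in> AK n"
    using n by (intro AK_finsum[OF finite_words] elementary_in_AK f)
      (auto simp: koszul_space_def tensor_power_def unit_tensor_def split: if_splits)
  moreover have "(\<Oplus>v\<in>{v. length v = n}. unit_tensor v w \<odot> f v) = f w" for w
  proof (cases "length w = n")
    case True
    have "(\<Oplus>v\<in>{v. length v = n}. unit_tensor v w \<odot> f v) =
      (\<Oplus>v\<in>{v. length v = n}. if w = v then f v else \<zero>)"
      using f(1) by (intro finsum_cong') (auto simp: unit_tensor_def scale_one smult_0_left)
    also have "\<dots> = f w" using True f(1) by (intro finsum_singleton) auto
    finally show ?thesis .
  next
    case False
    have "(\<Oplus>v\<in>{v. length v = n}. unit_tensor v w \<odot> f v) = \<zero>"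
      using f(1) False by (intro add.finprod_one_eqI) (auto simp: unit_tensor_def smult_0_left)
    then show ?thesis using f(2)[OF False] by simp
  qed
  ultimately show ?thesis by simp
qed

lemma additive_subgroup_augmentation:
  "additive_subgroup (augmentation_ideal A x) (regular_module A)"
proof -
  interpret M: left_module A "regular_module A" by (rule left_module_regular) (rule ring_axioms)
  have N: "length [] < N" using N_ge_2 by simp
  show ?thesis
  proof (rule additive_subgroup.intro, rule M.M.add.subgroupI)
    fix a assume "a \<in> augmentation_ideal A x"
    then have a: "a \<in> carrier A" "coef [] a = 0" by (auto simp: augmentation_ideal_iff)
    have "\<ominus>\<^bsub>regular_module A\<^esub> a = \<ominus> a"
      using a by (intro M.M.minus_equality) (simp_all add: regular_ops l_neg)
    then show "\<ominus>\<^bsub>regular_module A\<^esub> a \<in> augmentation_ideal A x"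
      using a coef_scale[OF N a(1), of "- 1"] by (simp add: augmentation_ideal_iff smult_neg_one)
  next
    show "augmentation_ideal A x \<noteq> {}" using coef_zero[OF N] augmentation_ideal_iff[of \<zero>] by auto
  qed (auto simp: augmentation_ideal_iff regular_ops coef_add[OF N])
qed

abbreviation aug_class :: "'a \<Rightarrow> 'a set" where
  "aug_class a \<equiv> augmentation_ideal A x +>\<^bsub>regular_module A\<^esub> a"

lemma augmentation_coset:
  shows "a \<in> carrier A \<Longrightarrow> aug_class a \<in> carrier (trivial_module A x)"
    and "X \<in> carrier (trivial_module A x) \<Longrightarrow>
      \<exists>a\<in>carrier A. X = aug_class a"
    and "a \<in> carrier A \<Longrightarrow> b \<in> carrier A \<Longrightarrow>
      (aug_class a) \<oplus>\<^bsub>trivial_module A x\<^esub>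
        (aug_class b) = aug_class (a \<oplus> b)"
    and "a \<in> carrier A \<Longrightarrow> b \<in> carrier A \<Longrightarrow>
      a \<odot>\<^bsub>trivial_module A x\<^esub> (aug_class b) =
        aug_class (a \<otimes> b)"
    and "a \<in> carrier A \<Longrightarrow>
      aug_class a = \<zero>\<^bsub>trivial_module A x\<^esub> \<longleftrightarrow> coef [] a = 0"
proof -
  interpret M: left_module A "regular_module A" by (rule left_module_regular) (rule ring_axioms)
  note Q = quotient_module_ops[where S = "carrier A", OF M.M.abelian_group_axioms
      additive_subgroup_augmentation M.smult_closed M.smult_r_distr,
      folded trivial_module_def, unfolded regular_ops]
  have U: "\<And>c u. c \<in> carrier A \<Longrightarrow> u \<in> augmentation_ideal A x \<Longrightarrow> c \<otimes> u \<in> augmentation_ideal A x"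
    by (simp add: augmentation_ideal_iff coef_Nil_mult)
  show "a \<in> carrier A \<Longrightarrow> aug_class a \<in> carrier (trivial_module A x)"
    using Q(1) U by blast
  show "X \<in> carrier (trivial_module A x) \<Longrightarrow>
      \<exists>a\<in>carrier A. X = aug_class a"
    using Q(2) U by blast
  show "a \<in> carrier A \<Longrightarrow> b \<in> carrier A \<Longrightarrow>
      (aug_class a) \<oplus>\<^bsub>trivial_module A x\<^esub>
        (aug_class b) = aug_class (a \<oplus> b)"
    using Q(3) U by blast
  show "a \<in> carrier A \<Longrightarrow> b \<in> carrier A \<Longrightarrow>
      a \<odot>\<^bsub>trivial_module A x\<^esub> (aug_class b) =
        aug_class (a \<otimes> b)"
    using Q(4) U by blast
  show "a \<in> carrier A \<Longrightarrow>
      aug_class a = \<zero>\<^bsub>trivial_module A x\<^esub> \<longleftrightarrow> coef [] a = 0"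
    using Q(5)[of a] U augmentation_ideal_iff[of a] by blast
qed

end

section \<open>The Koszul complex as a minimal projective resolution of the trivial module\<close>

locale koszul_algebra = homogeneous A x R N
  for A :: "('k::field, 'a) module" (structure) and x :: "'q::finite \<Rightarrow> 'a" and R N +
  assumes koszul: "koszul N A x R"
begin

abbreviation "deg \<equiv> koszul_degree N"
abbreviation "C n \<equiv> KM (deg n)"
abbreviation "\<delta> n \<equiv> koszul_diff N A x (Suc n)"

lemma koszul_exact:
  "{f \<in> AK (deg (Suc n)). \<delta> n f = (\<lambda>w. \<zero>)} = \<delta> (Suc n) ` AK (deg (Suc (Suc n)))"
  using koszul unfolding koszul_def by (auto dest!: spec[of _ "Suc n"])

text \<open>For \<open>n \<ge> 1\<close> this is contained in Koszulity, which is an equality of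
  sets: the image of the differential is a set of cycles inside \<open>AK\<close>. Only the last
  differential, into \<open>A (x) K_0\<close>, has to be checked by hand.\<close>

lemma koszul_diff_closed:
  assumes "f \<in> AK (deg (Suc n))"
  shows "\<delta> n f \<in> AK (deg n)"
proof (cases n)
  case 0
  have "koszul_d A x f w = \<zero>" if "w \<noteq> []" for w
  proof -
    have "koszul_d A x f w = (\<Oplus>i\<in>(UNIV :: 'q set). \<zero>)"
      unfolding koszul_d_def using AK_carrier(2)[OF assms] that N_ge_2
      by (intro finsum_cong') (auto simp: 0 koszul_degree_def)
    then show ?thesis by simp
  qed
  then show ?thesis
    unfolding 0 using N_ge_2 AK_carrier(1)[OF assms]
    by (intro AK_small) (auto simp: koszul_diff_def koszul_degree_def)
next
  case (Suc m)
  then show ?thesis using koszul_exact[of m] assms by auto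
qed

text \<open>Koszulity gives exactness in homological degrees at least 1. At \<open>C 0\<close> the
  kernel of the augmentation is the left ideal generated by the \<open>x i\<close>, which is the
  image of \<open>A (x) K_1\<close>.\<close>

lemma koszul_resolution:
  "projective_resolution A (trivial_module A x) C \<delta>
    (\<lambda>f. aug_class (f []))"
  unfolding projective_resolution_def
proof (intro conjI allI)
  let ?\<epsilon> = "\<lambda>f :: 'q list \<Rightarrow> 'a. aug_class (f [])"
  have N: "length [] < N" using N_ge_2 by simp
  note c = coef_add[OF N] coef_scale[OF N] coef_zero[OF N] coef_one[OF N]
  show "projective_module A (C n)" for n by (rule projective_KM)
  show "\<delta> n \<in> left_module_hom A (C (Suc n)) (C n)" for n
    using AK_carrier(1) koszul_diff_closed
    by (intro left_module_homI) (simp_all add: KM_simps koszul_diff_gap koszul_d_pow_add koszul_d_pow_mult)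
  show "?\<epsilon> \<in> left_module_hom A (C 0) (trivial_module A x)"
    using AK_carrier(1) by (intro left_module_homI) (simp_all add: KM_simps augmentation_coset(1,3,4))
  have deg0: "deg 0 = 0" and deg1: "deg (Suc 0) = 1" by (simp_all add: koszul_degree_def)
  show "?\<epsilon> ` carrier (C 0) = carrier (trivial_module A x)"
  proof
    show "?\<epsilon> ` carrier (C 0) \<subseteq> carrier (trivial_module A x)"
      using AK_carrier(1) by (auto simp: KM_simps augmentation_coset(1))
    show "carrier (trivial_module A x) \<subseteq> ?\<epsilon> ` carrier (C 0)"
    proof
      fix X assume "X \<in> carrier (trivial_module A x)"
      then obtain a where a: "a \<in> carrier A" "X = aug_class a"
        using augmentation_coset(2) by blast
      have "(\<lambda>w. if w = [] then a else \<zero>) \<in> AK 0"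
        using N_ge_2 a(1) by (intro AK_small) auto
      then show "X \<in> ?\<epsilon> ` carrier (C 0)"
        unfolding KM_simps deg0 a(2) by (rule rev_image_eqI) simp
    qed
  qed
  show "{y \<in> carrier (C 0). ?\<epsilon> y = \<zero>\<^bsub>trivial_module A x\<^esub>} = \<delta> 0 ` carrier (C 1)"
  proof
    show "\<delta> 0 ` carrier (C 1) \<subseteq> {y \<in> carrier (C 0). ?\<epsilon> y = \<zero>\<^bsub>trivial_module A x\<^esub>}"
    proof (rule image_subsetI)
      fix f assume "f \<in> carrier (C 1)"
      then have f: "f \<in> AK (deg (Suc 0))" by (simp add: KM_simps)
      show "\<delta> 0 f \<in> {y \<in> carrier (C 0). ?\<epsilon> y = \<zero>\<^bsub>trivial_module A x\<^esub>}"
        using koszul_diff_closed[OF f] AK_carrier(1)[OF f]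
        by (simp add: KM_simps augmentation_coset(5) coef_Nil_koszul_d koszul_diff_def)
    qed
    show "{y \<in> carrier (C 0). ?\<epsilon> y = \<zero>\<^bsub>trivial_module A x\<^esub>} \<subseteq> \<delta> 0 ` carrier (C 1)"
    proof clarify
      fix y assume "y \<in> carrier (C 0)" "?\<epsilon> y = \<zero>\<^bsub>trivial_module A x\<^esub>"
      then have y: "y \<in> AK 0" "coef [] (y []) = 0"
        using AK_carrier(1)[of y] by (auto simp: KM_simps deg0 augmentation_coset(5))
      note yc = AK_carrier[OF y(1)]
      obtain b where b: "\<And>i. b i \<in> carrier A" "y [] = coef [] (y []) \<odot> \<one> \<oplus> (\<Oplus>i\<in>UNIV. b i \<otimes> x i)"
        using right_generators[OF yc(1)] by blast
      have yb: "y [] = (\<Oplus>i\<in>UNIV. b i \<otimes> x i)"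
        using b(2)[unfolded y(2)] b(1) by (simp add: smult_0_left Pi_iff)
      \<comment> \<open>The preimage of \<open>y\<close> carries the left coefficients of
        \<open>right_generators\<close> on the one-letter words.\<close>
      let ?f = "\<lambda>w. if length w = 1 then b (hd w) else \<zero>"
      have f: "?f \<in> AK 1" using N_ge_2 b(1) by (intro AK_small) auto
      have "koszul_d A x ?f w = y w" for w
      proof (cases w)
        case Nil
        then show ?thesis by (simp add: koszul_d_def yb)
      next
        case (Cons j v)
        then have "koszul_d A x ?f w = (\<Oplus>i\<in>(UNIV :: 'q set). \<zero>)"
          unfolding koszul_d_def by (intro finsum_cong') auto
        then show ?thesis using yc(2)[of w] Cons by simp
      qed
      then have "y = \<delta> 0 ?f" by (simp add: koszul_diff_def fun_eq_iff)
      then show "y \<in> \<delta> 0 ` carrier (C 1)" using f by (simp add: KM_simps deg1)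
    qed
  qed
  show "{y \<in> carrier (C (Suc n)). \<delta> n y = \<zero>\<^bsub>C n\<^esub>} = \<delta> (Suc n) ` carrier (C (Suc (Suc n)))" for n
    using koszul_exact[of n] by (simp add: KM_simps)
qed

text \<open>A functional is a sum of right multiplications, and the augmentation is
  multiplicative.\<close>

lemma coef_Nil_hom:
  assumes \<beta>: "\<beta> \<in> functionals (KM n)"
    and f: "f \<in> AK n" "\<And>w. coef [] (f w) = 0"
  shows "coef [] (\<beta> f) = 0"
proof -
  obtain b where b: "\<And>v. b v \<in> carrier A"
    "\<And>f. f \<in> AK n \<Longrightarrow> \<beta> f = (\<Oplus>v\<in>{v. length v = n}. f v \<otimes> b v)" using KM_hom_coef[OF \<beta>] by blast
  show ?thesis
    unfolding b(2)[OF f(1)] using b(1) AK_carrier(1)[OF f(1)] N_ge_2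
    by (subst coef_finsum) (auto simp: coef_Nil_mult f(2))
qed

lemma coef_Nil_diff:
  assumes "\<And>w. f w \<in> carrier A"
  shows "coef [] (\<delta> n f w) = 0"
proof -
  \<comment> \<open>At least one letter is removed, because \<open>N - 1 \<ge> 1\<close>; the
    outermost \<open>koszul_d\<close> then kills constant terms.\<close>
  obtain s where "gap N (Suc n) = Suc s" using N_ge_2 by (cases "gap N (Suc n)") (auto simp: gap_def split: if_splits)
  then show ?thesis
    using coef_Nil_koszul_d[OF koszul_d_pow_closed[OF assms]] by (simp add: koszul_diff_gap)
qed

text \<open>Minimality of the resolution. Contradictions below arise by finding a supposed
  coboundary with a nonzero constant term on some \<open>1 (x) k\<close>.\<close>

lemma coef_Nil_coboundary:
  assumes "coboundary A C \<delta> n h" "f \<in> AK (deg n)"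
  shows "coef [] (h f) = 0"
proof (cases n)
  case 0
  then show ?thesis using assms coef_zero[of "[]"] N_ge_2 by (simp add: coboundary_def KM_simps)
next
  case (Suc m)
  then obtain g where g: "g \<in> functionals (C m)" "h f = g (\<delta> m f)"
    using assms by (auto simp: coboundary_def KM_simps)
  show ?thesis
    unfolding g(2) using assms(2) AK_carrier(1)[OF assms(2)]
    by (intro coef_Nil_hom[OF g(1)]) (simp_all add: Suc koszul_diff_closed coef_Nil_diff)
qed

end

section \<open>Gorenstein Koszul algebras\<close>

text \<open>With \<open>p\<close> a projector onto \<open>U\<close>, the tensor
  \<open>\<kappa>\<close> differs from its projection in some coordinate \<open>w0\<close>. The
  functional is row \<open>w0\<close> of \<open>id - p\<close>, scaled to take the value 1 on
  \<open>\<kappa>\<close>.\<close>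

lemma separating_functional:
  fixes U :: "('q::finite list \<Rightarrow> 'k::field) set"
  assumes U: "tens.subspace U" "U \<subseteq> tensor_power n" and \<kappa>: "\<kappa> \<in> tensor_power n" "\<kappa> \<notin> U"
  obtains c where "\<And>\<eta>. \<eta> \<in> U \<Longrightarrow> (\<Sum>w | length w = n. c w * \<eta> w) = 0"
    and "(\<Sum>w | length w = n. c w * \<kappa> w) = 1"
proof -
  obtain p where p: "\<And>v. (\<lambda>w. p w v) \<in> U"
    "\<And>\<eta> w. \<eta> \<in> U \<Longrightarrow> \<eta> w = (\<Sum>v | length v = n. p w v * \<eta> v)"
    using tensor_projector[OF U] by blast
  let ?p = "\<lambda>w. \<Sum>v | length v = n. p w v * \<kappa> v"
  have "(\<Sum>v | length v = n. (\<lambda>w. \<kappa> v * p w v)) \<in> U"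
    by (intro tens.subspace_sum[OF U(1)] tens.subspace_scale[OF U(1)] p(1))
  moreover have "(\<Sum>v | length v = n. (\<lambda>w. \<kappa> v * p w v)) = ?p"
    by (simp add: fun_eq_iff sum_fun_apply mult.commute)
  ultimately have pU: "?p \<in> U" by simp
  have "\<exists>w0. \<kappa> w0 \<noteq> ?p w0"
  proof (rule ccontr)
    assume "\<nexists>w0. \<kappa> w0 \<noteq> ?p w0"
    then have eq: "\<kappa> = ?p" by (intro ext) blast
    have "\<kappa> \<in> U" by (subst eq) (rule pU)
    with \<kappa>(2) show False ..
  qed
  then obtain w0 where w0: "\<kappa> w0 \<noteq> ?p w0" ..
  have len: "length w0 = n"
  proof (rule ccontr)
    assume "length w0 \<noteq> n"
    moreover have "?p \<in> tensor_power n" using pU U(2) by (rule subsetD[rotated])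
    ultimately have "\<kappa> w0 = 0" "?p w0 = 0" using \<kappa>(1) unfolding tensor_power_def mem_Collect_eq by blast+
    with w0 show False by simp
  qed
  define c where "c v = ((if v = w0 then 1 else 0) - p w0 v) / (\<kappa> w0 - ?p w0)" for v
  have c: "(\<Sum>w | length w = n. c w * \<eta> w) =
    (\<eta> w0 - (\<Sum>v | length v = n. p w0 v * \<eta> v)) / (\<kappa> w0 - ?p w0)" for \<eta>
  proof -
    have "(\<Sum>w | length w = n. c w * \<eta> w) =
      (\<Sum>w | length w = n. (if w = w0 then \<eta> w else 0) - p w0 w * \<eta> w) / (\<kappa> w0 - ?p w0)"
      unfolding sum_divide_distrib c_def by (intro sum.cong) (auto simp: algebra_simps)
    then show ?thesis using len by (simp add: sum_subtractf)
  qed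
  show ?thesis
    by (rule that[of c]) (use c w0 p(2) in simp_all)
qed

section \<open>Contractions against the differential\<close>

context homogeneous
begin

text \<open>Moving \<open>koszul_d\<close> across the pairing prepends a letter to the functional
  and leaves a generator on the right.\<close>

lemma pair_koszul_d:
  assumes f: "\<And>w. f w \<in> carrier A"
  shows "pair n c (koszul_d A x f) = (\<Oplus>i\<in>UNIV. pair (Suc n) (shift i c) f \<otimes> x i)"
proof -
  have row: "pair (Suc n) (shift i c) f = (\<Oplus>w\<in>{w. length w = n}. c w \<odot> f (i # w))" for i
  proof -
    have "pair (Suc n) (shift i c) f = (\<Oplus>v\<in>Cons i ` {w. length w = n}. shift i c v \<odot> f v)"
      unfolding pair_def
    proof (rule add.finprod_mono_neutral_cong_right[OF finite_words])
      show "shift i c v \<odot> f v = \<zero>" if "v \<in> {v. length v = Suc n} - Cons i ` {w. length w = n}" for v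
        using that f by (cases v) (auto simp: shift_def smult_0_left)
    qed (use f in \<open>auto simp: scale_closed\<close>)
    also have "\<dots> = (\<Oplus>w\<in>{w. length w = n}. shift i c (i # w) \<odot> f (i # w))"
      using f by (intro finsum_reindex) (auto simp: scale_closed)
    finally show ?thesis by (simp add: shift_def)
  qed
  have "pair n c (koszul_d A x f) = (\<Oplus>w\<in>{w. length w = n}. \<Oplus>i\<in>UNIV. c w \<odot> (f (i # w) \<otimes> x i))"
    unfolding pair_def koszul_d_def using f
    by (intro finsum_cong') (auto simp: scale_finsum Pi_iff scale_closed intro!: finsum_closed)
  also have "\<dots> = (\<Oplus>i\<in>UNIV. \<Oplus>w\<in>{w. length w = n}. c w \<odot> (f (i # w) \<otimes> x i))"
    using f by (intro finsum_swap) (auto simp: scale_closed)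
  also have "\<dots> = (\<Oplus>i\<in>UNIV. \<Oplus>w\<in>{w. length w = n}. (c w \<odot> f (i # w)) \<otimes> x i)"
    using f by (simp add: scale_mult_left)
  also have "\<dots> = (\<Oplus>i\<in>UNIV. pair (Suc n) (shift i c) f \<otimes> x i)"
    unfolding row using f
    by (intro finsum_cong' finsum_ldistr[symmetric]) (auto simp: scale_closed intro!: finsum_closed)
  finally show ?thesis .
qed

text \<open>Iterating the previous rule gives contractions by \<open>c\<close> preceded by words
  \<open>u\<close> of length \<open>s\<close>, each multiplied by generators on the right; if all
  these contractions vanish, so does the whole.\<close>

lemma pair_koszul_d_pow:
  assumes "\<And>w. f w \<in> carrier A"
    and "\<And>u. length u = s \<Longrightarrow> pair (s + n) (foldr shift u c) f = \<zero>"
  shows "pair n c ((koszul_d A x ^^ s) f) = \<zero>"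
  using assms
proof (induction s arbitrary: f)
  case 0
  from 0(2)[of "[]"] show ?case by simp
next
  case (Suc s)
  have "pair (s + n) (foldr shift u c) (koszul_d A x f) = \<zero>" if u: "length u = s" for u
  proof -
    have "pair (Suc (s + n)) (shift i (foldr shift u c)) f = \<zero>" for i
      using Suc.prems(2)[of "i # u"] u by simp
    then show ?thesis using pair_koszul_d[OF Suc.prems(1)] by simp
  qed
  from Suc.IH[OF koszul_d_closed[OF Suc.prems(1)] this] show ?case
    by (simp only: funpow_Suc_right o_apply)
qed

lemma foldr_shift:
  "foldr shift u c v = (if take (length u) v = u then c (drop (length u) v) else 0)"
proof (induction u arbitrary: v)
  case (Cons i u)
  then show ?case by (cases v) (auto simp: shift_def)
qed simp

text \<open>Prefixing the functional by \<open>u\<close> amounts to contracting the tensor by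
  \<open>u\<close> on the left.\<close>

lemma sum_foldr_shift:
  assumes "length u = s"
  shows "(\<Sum>v | length v = s + n. foldr shift u c v * k v) = (\<Sum>w | length w = n. c w * k (u @ w))"
proof -
  have "(\<Sum>v | length v = s + n. foldr shift u c v * k v) =
    (\<Sum>v\<in>(\<lambda>w. u @ w) ` {w. length w = n}. foldr shift u c v * k v)"
  proof (rule sum.mono_neutral_right)
    show "\<forall>v\<in>{v. length v = s + n} - (\<lambda>w. u @ w) ` {w. length w = n}. foldr shift u c v * k v = 0"
    proof
      fix v assume v: "v \<in> {v. length v = s + n} - (\<lambda>w. u @ w) ` {w. length w = n}"
      have "take (length u) v \<noteq> u"
      proof
        assume "take (length u) v = u"
        then have "v = u @ drop (length u) v" by (metis append_take_drop_id)
        moreover have "length (drop (length u) v) = n" using v assms by simp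
        ultimately show False using v by blast
      qed
      then show "foldr shift u c v * k v = 0" by (simp add: foldr_shift)
    qed
  qed (use assms in auto)
  also have "\<dots> = (\<Sum>w | length w = n. c w * k (u @ w))"
    by (subst sum.reindex) (auto simp: inj_on_def foldr_shift)
  finally show ?thesis .
qed

lemma pair_AK_zero:
  assumes "f \<in> AK n" "\<And>k. k \<in> K n \<Longrightarrow> (\<Sum>w | length w = n. c w * k w) = 0"
  shows "pair n c f = \<zero>"
proof -
  from assms(1) obtain l a k where f: "f = (\<lambda>w. \<Oplus>j\<in>{..<l::nat}. k j w \<odot> a j)"
    and ak: "\<And>j. j < l \<Longrightarrow> a j \<in> carrier A" "\<And>j. j < l \<Longrightarrow> k j \<in> K n"
    by (auto simp: koszul_module_def)
  show ?thesis
    unfolding f using ak assms(2)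
    by (subst pair_finsum) (auto intro!: add.finprod_one_eqI simp: smult_0_left)
qed

lemma pair_hom: "pair n c \<in> functionals (KM n)"
  using AK_carrier(1) by (intro left_module_homI) (simp_all add: KM_simps regular_ops pair_add pair_mult)

end

context koszul_algebra
begin

text \<open>The differential removes \<open>gap N (Suc n)\<close> letters, so
  \<open>id (x) c\<close> vanishes on boundaries as soon as \<open>c\<close> vanishes on all left
  contractions by that many letters.\<close>

lemma cocycle_pair:
  assumes "\<And>\<eta> u. \<eta> \<in> K (deg (Suc n)) \<Longrightarrow> length u = gap N (Suc n) \<Longrightarrow>
    (\<Sum>w | length w = deg n. c w * \<eta> (u @ w)) = 0"
  shows "cocycle A C \<delta> n (pair (deg n) c)"
proof -
  have "pair (deg n) c (\<delta> n f) = \<zero>" if f: "f \<in> AK (deg (Suc n))" for f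
    unfolding koszul_diff_gap
  proof (rule pair_koszul_d_pow[OF AK_carrier(1)[OF f]])
    fix u :: "'q list" assume u: "length u = gap N (Suc n)"
    have "deg (Suc n) = gap N (Suc n) + deg n" using koszul_degree_Suc[of N n] N_ge_2 by simp
    then show "pair (gap N (Suc n) + deg n) (foldr shift u c) f = \<zero>"
      using f assms u by (intro pair_AK_zero) (simp_all add: sum_foldr_shift)
  qed
  then show ?thesis using pair_hom by (simp add: cocycle_def KM_simps)
qed

text \<open>The element \<open>1 (x) k\<close>, on which \<open>id (x) c\<close> takes the scalar
  value of \<open>c\<close> at \<open>k\<close>.\<close>

definition embed :: "('q list \<Rightarrow> 'k) \<Rightarrow> 'q list \<Rightarrow> 'a" where
  "embed k = (\<lambda>w. k w \<odot> \<one>)"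

lemma embed_AK: "k \<in> K n \<Longrightarrow> embed k \<in> AK n"
  unfolding embed_def by (rule elementary_in_AK) auto

lemma pair_embed: "pair n c (embed k) = (\<Sum>w | length w = n. c w * k w) \<odot> \<one>"
  unfolding embed_def by (rule pair_elementary) simp

lemma coef_Nil_scalar: "coef [] (c \<odot> \<one>) = c"
  using coef_scale[of "[]" "\<one>" c] coef_one[of "[]"] N_ge_2 by simp

end

section \<open>Finite dimension and the Gorenstein condition read on the Koszul complex\<close>

locale gorenstein_koszul = koszul_algebra A x R N
  for A :: "('k::field, 'a) module" (structure) and x :: "'q::finite \<Rightarrow> 'a" and R N +
  fixes D :: nat
  assumes dimension: "global_dimension A x = enat D"
    and gorenstein: "gorenstein A x D"
    and D_ge_2: "2 \<le> D"
begin

lemma finite_resolution: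
  obtains d and P :: "nat \<Rightarrow> ('a, 'q list \<Rightarrow> 'a) module" and \<delta>' \<epsilon>
  where "projective_resolution A (trivial_module A x) P \<delta>' \<epsilon>"
    and "\<And>n. n > d \<Longrightarrow> carrier (P n) = {\<zero>\<^bsub>P n\<^esub>}"
proof -
  let ?S = "{enat d | d. \<exists>(P :: nat \<Rightarrow> ('a, 'q list \<Rightarrow> 'a) module) \<delta> \<epsilon>.
    projective_resolution A (trivial_module A x) P \<delta> \<epsilon> \<and> (\<forall>n>d. carrier (P n) = {\<zero>\<^bsub>P n\<^esub>})}"
  have "?S \<noteq> {}"
  proof
    \<comment> \<open>The infimum of the empty set of extended naturals is infinite.\<close>
    assume S: "?S = {}"
    have "global_dimension A x = Inf {}" unfolding global_dimension_def S ..
    then show False using dimension by (simp add: top_enat_def)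
  qed
  then show ?thesis using that by blast
qed

text \<open>Where the finite resolution is zero, the comparison map is zero and the identity of the
  Koszul complex is null-homotopic. Applied to \<open>1 (x) k\<close>, both homotopy terms have zero
  constant parts by minimality, so \<open>k\<close> is zero.\<close>

lemma koszul_space_vanishes:
  obtains d where "\<And>n. n > d \<Longrightarrow> K (deg n) = {\<lambda>w. 0}"
proof -
  obtain d and P :: "nat \<Rightarrow> ('a, 'q list \<Rightarrow> 'a) module" and \<delta>' \<epsilon> where
    P: "projective_resolution A (trivial_module A x) P \<delta>' \<epsilon>"
    and Pz: "\<And>n. n > d \<Longrightarrow> carrier (P n) = {\<zero>\<^bsub>P n\<^esub>}"
    by (rule finite_resolution, rule that; assumption)
  note PD = projective_resolutionD[OF P] and CD = projective_resolutionD[OF koszul_resolution]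
  obtain F G s where F: "\<And>n. F n \<in> left_module_hom A (C n) (P n)"
    and G: "\<And>n. G n \<in> left_module_hom A (P n) (C n)"
    and s: "\<And>n. s n \<in> left_module_hom A (C n) (C (Suc n))"
    and "\<And>n p. p \<in> carrier (C (Suc n)) \<Longrightarrow> \<delta>' n (F (Suc n) p) = F n (\<delta> n p)"
    and "\<And>n p. p \<in> carrier (P (Suc n)) \<Longrightarrow> \<delta> n (G (Suc n) p) = G n (\<delta>' n p)"
    and "\<And>p. p \<in> carrier (C 0) \<Longrightarrow> p = G 0 (F 0 p) \<oplus>\<^bsub>C 0\<^esub> \<delta> 0 (s 0 p)"
    and eq: "\<And>n p. p \<in> carrier (C (Suc n)) \<Longrightarrow> p = G (Suc n) (F (Suc n) p)
      \<oplus>\<^bsub>C (Suc n)\<^esub> (\<delta> (Suc n) (s (Suc n) p) \<oplus>\<^bsub>C (Suc n)\<^esub> s n (\<delta> n p))"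
    by (rule resolution_homotopy_identity[OF koszul_resolution P], rule that; assumption)
  have "k = (\<lambda>w. 0)" if k: "k \<in> K (deg n)" and n: "n > d" for k n
  proof
    fix w
    obtain m where m: "n = Suc m" using n by (cases n) auto
    let ?f = "embed k"
    have f: "?f \<in> AK (deg (Suc m))" using embed_AK k m by simp
    note fc = AK_carrier(1)[OF f]
    have "F (Suc m) ?f = \<zero>\<^bsub>P (Suc m)\<^esub>"
      using left_module_homD(1)[OF F[of "Suc m"], of ?f] f Pz[OF n] m by (simp add: KM_simps)
    then have GF: "G (Suc m) (F (Suc m) ?f) = (\<lambda>w. \<zero>)"
      using left_module_hom_zero[OF G PD(2) CD(2), of "Suc m"] by (simp add: KM_simps)
    have sf: "s (Suc m) ?f \<in> AK (deg (Suc (Suc m)))"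
      using left_module_homD(1)[OF s[of "Suc m"], of ?f] f by (simp add: KM_simps)
    have df: "\<delta> m ?f \<in> AK (deg m)" by (rule koszul_diff_closed[OF f])
    have sdf: "s m (\<delta> m ?f) \<in> AK (deg (Suc m))"
      using left_module_homD(1)[OF s[of m], of "\<delta> m ?f"] df by (simp add: KM_simps)
    note c1 = AK_carrier(1)[OF koszul_diff_closed[OF sf]] and c2 = AK_carrier(1)[OF sdf]
    have fw: "?f w = \<delta> (Suc m) (s (Suc m) ?f) w \<oplus> s m (\<delta> m ?f) w"
      using fun_cong[OF eq[of ?f m], of w] f c1 c2 by (simp add: KM_simps GF)
    \<comment> \<open>A single coordinate of the homotopy is a functional, so
      \<open>coef_Nil_hom\<close> applies to it.\<close>
    have comp: "(\<lambda>g. s m g w) \<in> functionals (C m)"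
      using left_module_homD[OF s[of m]] AK_carrier(1)[of _ "deg (Suc m)"]
      by (intro left_module_homI) (simp_all add: KM_simps regular_ops)
    have "coef [] (s m (\<delta> m ?f) w) = 0"
      using coef_Nil_hom[OF comp df coef_Nil_diff[OF fc]] .
    moreover have "coef [] (\<delta> (Suc m) (s (Suc m) ?f) w) = 0"
      by (rule coef_Nil_diff[OF AK_carrier(1)[OF sf]])
    ultimately have "coef [] (?f w) = 0"
      unfolding fw using coef_add[of "[]"] c1 c2 N_ge_2 by simp
    then show "k w = 0" by (simp add: embed_def coef_Nil_scalar)
  qed
  then show ?thesis using that[of d] koszul_space_zero by blast
qed

text \<open>The Koszul complex shows that the choice in \<open>Ext_algebra\<close> is from a
  nonempty set, so the chosen triple is a resolution. The Gorenstein condition is applied there and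
  transported back by \<open>cohomology_transfer\<close>.\<close>

lemma gorenstein_cocycles:
  shows "n \<noteq> D \<Longrightarrow> cocycle A C \<delta> n h \<Longrightarrow> coboundary A C \<delta> n h"
    and "cocycle A C \<delta> D g \<Longrightarrow> cocycle A C \<delta> D h \<Longrightarrow>
      \<exists>c d. (c \<noteq> 0 \<or> d \<noteq> 0) \<and> coboundary A C \<delta> D (\<lambda>y. c \<odot> g y \<oplus> d \<odot> h y)"
proof -
  let ?M = "trivial_module A x"
  \<comment> \<open>The predicate under the choice operator of \<open>Ext_algebra\<close>, stated in
    the same form so that the chosen triple can be named.\<close>
  define S where "S = (\<lambda>(P :: nat \<Rightarrow> ('a, 'q list \<Rightarrow> 'a) module, \<delta>', \<epsilon>).
    projective_resolution A ?M P \<delta>' \<epsilon>)"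
  have "S (C, \<delta>, \<lambda>f. aug_class (f []))"
    using koszul_resolution by (simp add: S_def)
  then have "S (SOME t. S t)" by (rule someI)
  moreover obtain P \<delta>' \<epsilon> where t: "(SOME t. S t) = (P, \<delta>', \<epsilon>)" by (cases "SOME t. S t") auto
  ultimately have P: "projective_resolution A ?M P \<delta>' \<epsilon>" by (simp add: S_def)
  define E where "E n = quotient_module ((hom_to_algebra A (P n)) \<lparr>carrier := dual_cocycles A P \<delta>' n\<rparr>)
    (dual_coboundaries A P \<delta>' n)" for n
  have Ext: "(Ext_algebra A ?M :: nat \<Rightarrow> ('k, (('q list \<Rightarrow> 'a) \<Rightarrow> 'a) set) module) n = E n" for n
    unfolding Ext_algebra_def S_def[symmetric] t E_def by simp
  obtain G where G: "\<And>n h. cocycle A C \<delta> n h \<Longrightarrow> cocycle A P \<delta>' n (\<lambda>y. h (G n y))"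
    "\<And>n h. cocycle A C \<delta> n h \<Longrightarrow> coboundary A P \<delta>' n (\<lambda>y. h (G n y)) \<Longrightarrow> coboundary A C \<delta> n h"
    using cohomology_transfer[OF koszul_resolution P] by metis
  note gor = gorenstein[unfolded gorenstein_def Let_def Ext]
  show "coboundary A C \<delta> n h" if n: "n \<noteq> D" and h: "cocycle A C \<delta> n h"
  proof -
    have "carrier (E n) = {\<zero>\<^bsub>E n\<^esub>}" using gor n by blast
    from cocycle_is_coboundary[OF P this[unfolded E_def] G(1)[OF h]] show ?thesis by (rule G(2)[OF h])
  qed
  show "\<exists>c d. (c \<noteq> 0 \<or> d \<noteq> 0) \<and> coboundary A C \<delta> D (\<lambda>y. c \<odot> g y \<oplus> d \<odot> h y)"
    if gh: "cocycle A C \<delta> D g" "cocycle A C \<delta> D h"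
  proof -
    have "\<exists>\<phi>. bij_betw \<phi> (carrier (E D)) (UNIV :: 'k set) \<and>
      (\<forall>u\<in>carrier (E D). \<forall>v\<in>carrier (E D). \<phi> (u \<oplus>\<^bsub>E D\<^esub> v) = \<phi> u + \<phi> v) \<and>
      (\<forall>c. \<forall>u\<in>carrier (E D). \<phi> (c \<odot>\<^bsub>E D\<^esub> u) = c * \<phi> u)"
      using gor by (rule conjunct2)
    then obtain \<phi> where \<phi>: "bij_betw \<phi> (carrier (E D)) (UNIV :: 'k set)"
      "\<forall>u\<in>carrier (E D). \<forall>v\<in>carrier (E D). \<phi> (u \<oplus>\<^bsub>E D\<^esub> v) = \<phi> u + \<phi> v"
      "\<forall>c. \<forall>u\<in>carrier (E D). \<phi> (c \<odot>\<^bsub>E D\<^esub> u) = c * \<phi> u" by (elim exE conjE)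
    obtain c d where cd: "c \<noteq> 0 \<or> d \<noteq> 0"
      "coboundary A P \<delta>' D (\<lambda>y. c \<odot> g (G D y) \<oplus> d \<odot> h (G D y))"
      by (rule cocycles_dependent[OF P \<phi>(1)[unfolded E_def]
          \<phi>(2)[unfolded E_def, rule_format] \<phi>(3)[unfolded E_def, rule_format] G(1)[OF gh(1)] G(1)[OF gh(2)]])
    have "coboundary A C \<delta> D (\<lambda>y. c \<odot> g y \<oplus> d \<odot> h y)"
      by (rule G(2)[OF cocycle_combination[OF gh]]) (rule cd)
    then show ?thesis using cd(1) by blast
  qed
qed

end

section \<open>Contractions of Koszul spaces by letters\<close>

lemma tensor_power_0_apply: "b \<in> tensor_power 0 \<Longrightarrow> w \<noteq> [] \<Longrightarrow> b w = 0"
  by (auto simp: tensor_power_def)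

lemma conv_left_homogeneous:
  assumes "f \<in> tensor_power (length u)"
  shows "conv f g (u @ w) = f u * g w"
proof -
  have "conv f g (u @ w) = (\<Sum>i\<le>length (u @ w). if i = length u then f u * g w else 0)"
    unfolding conv_def
  proof (rule sum.cong)
    fix i assume "i \<in> {..length (u @ w)}"
    then show "f (take i (u @ w)) * g (drop i (u @ w)) = (if i = length u then f u * g w else 0)"
      using assms by (auto simp: tensor_power_def)
  qed simp
  then show ?thesis by simp
qed

lemma conv_right_scalar:
  assumes "b \<in> tensor_power 0"
  shows "conv f b w = f w * b []"
proof -
  have "conv f b w = (\<Sum>i\<le>length w. if i = length w then f w * b [] else 0)"
    unfolding conv_def
    by (rule sum.cong) (use assms in \<open>auto simp: tensor_power_0_apply\<close>)
  then show ?thesis by simp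
qed

lemma conv_snoc: "conv f g (w @ [i]) = conv f (\<lambda>v. g (v @ [i])) w + f (w @ [i]) * g []"
  by (induction w arbitrary: f) (simp_all add: algebra_simps)

text \<open>Precomposition with a map of words is linear. With this, a statement about contractions
  of a span need only be checked on generators.\<close>

lemma linear_contraction:
  fixes V :: "('q list \<Rightarrow> 'k::field) set" and e :: "'q list \<Rightarrow> 'q list"
  assumes "tens.subspace V"
  shows "tens.subspace {\<eta>. (\<lambda>w. \<eta> (e w)) \<in> V}"
proof (rule tens.subspaceI)
  show "0 \<in> {\<eta>. (\<lambda>w. \<eta> (e w)) \<in> V}"
    using tens.subspace_0[OF assms] by (simp add: zero_fun_def)
  show "f + g \<in> {\<eta>. (\<lambda>w. \<eta> (e w)) \<in> V}"
    if "f \<in> {\<eta>. (\<lambda>w. \<eta> (e w)) \<in> V}" "g \<in> {\<eta>. (\<lambda>w. \<eta> (e w)) \<in> V}" for f g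
    using tens.subspace_add[OF assms, of "\<lambda>w. f (e w)" "\<lambda>w. g (e w)"] that by (simp add: plus_fun_def)
  show "(\<lambda>w. c * f w) \<in> {\<eta>. (\<lambda>w. \<eta> (e w)) \<in> V}"
    if "f \<in> {\<eta>. (\<lambda>w. \<eta> (e w)) \<in> V}" for c f
    using tens.subspace_scale[OF assms, of "\<lambda>w. f (e w)" c] that by simp
qed

context homogeneous
begin

lemma relations_in_koszul_space: "R \<subseteq> K N"
proof
  fix \<rho> assume \<rho>: "\<rho> \<in> R"
  let ?e = "(\<lambda>w. if w = [] then 1 else 0) :: 'q list \<Rightarrow> 'k"
  have "?e \<in> tensor_power 0" by (auto simp: tensor_power_def)
  moreover have "\<rho> = ?e \<otimes>\<^bsub>tensor_algebra\<^esub> \<rho> \<otimes>\<^bsub>tensor_algebra\<^esub> ?e"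
    by (simp add: tensor_algebra_simps(2) fun_eq_iff conv_one_left conv_one_right)
  ultimately have "\<rho> \<in> {u \<otimes>\<^bsub>tensor_algebra\<^esub> \<rho> \<otimes>\<^bsub>tensor_algebra\<^esub> v | u \<rho> v.
    u \<in> tensor_power 0 \<and> \<rho> \<in> R \<and> v \<in> tensor_power 0}" using \<rho> by blast
  then show "\<rho> \<in> K N" by (simp add: koszul_space_def tens.span_base)
qed

text \<open>Of the spaces intersected in \<open>K n\<close>, the one with \<open>r = n - N\<close>
  is used: there the relation occupies the last \<open>N\<close> places, and removing the letters
  before it leaves a relation.\<close>

lemma koszul_space_left_contraction:
  assumes \<eta>: "\<eta> \<in> K n" and n: "N \<le> n" and u: "length u = n - N"
  shows "(\<lambda>w. \<eta> (u @ w)) \<in> R"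
proof -
  let ?G = "\<lambda>r. {a \<otimes>\<^bsub>tensor_algebra\<^esub> \<rho> \<otimes>\<^bsub>tensor_algebra\<^esub> b | a \<rho> b.
    a \<in> tensor_power r \<and> \<rho> \<in> R \<and> b \<in> tensor_power (n - N - r)}"
  have "\<eta> \<in> (\<Inter>r\<in>{0..n - N}. tens.span (?G r))"
    using \<eta> n unfolding koszul_space_def by (simp only: not_less[symmetric] if_False)
  then have "\<eta> \<in> tens.span (?G (n - N))"
    by (rule INT_D) simp
  also have "\<dots> \<subseteq> {\<eta>. (\<lambda>w. \<eta> (u @ w)) \<in> R}"
  proof (rule tens.span_minimal[OF _ linear_contraction[OF R_subspace]], rule subsetI)
    fix \<eta> assume "\<eta> \<in> ?G (n - N)"
    then obtain a \<rho> b where g: "\<eta> = conv (conv a \<rho>) b" "a \<in> tensor_power (length u)"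
      "\<rho> \<in> R" "b \<in> tensor_power 0" using u by (auto simp: tensor_algebra_simps(2))
    have "(\<lambda>w. \<eta> (u @ w)) = (\<lambda>w. (a u * b []) * \<rho> w)"
      using g by (simp add: fun_eq_iff conv_right_scalar conv_left_homogeneous)
    then show "\<eta> \<in> {\<eta>. (\<lambda>w. \<eta> (u @ w)) \<in> R}"
      using tens.subspace_scale[OF R_subspace g(3), of "a u * b []"] by simp
  qed
  finally show ?thesis by simp
qed

text \<open>For \<open>r \<le> n - N\<close> at least one free letter follows the relation in length
  \<open>Suc n\<close>. Removing the last letter leaves the relation intact, and these values of
  \<open>r\<close> are all that \<open>K n\<close> asks for.\<close>

lemma koszul_space_right_contraction:
  assumes \<eta>: "\<eta> \<in> K (Suc n)"
  shows "(\<lambda>w. \<eta> (w @ [i])) \<in> K n"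
proof (cases "n < N")
  case True
  have "\<eta> \<in> tensor_power (Suc n)"
    using K_subset[of "Suc n"] \<eta> by blast
  then have "length (w @ [i]) = Suc n" if "\<eta> (w @ [i]) \<noteq> 0" for w
    using that unfolding tensor_power_def by blast
  then show ?thesis using True by (simp add: koszul_space_def[of N R n] tensor_power_def)
next
  case False
  let ?G = "\<lambda>n r. {a \<otimes>\<^bsub>tensor_algebra\<^esub> \<rho> \<otimes>\<^bsub>tensor_algebra\<^esub> b | a \<rho> b.
    a \<in> tensor_power r \<and> \<rho> \<in> R \<and> b \<in> tensor_power (n - N - r)}"
  have "\<eta> \<in> (\<Inter>r\<in>{0..Suc n - N}. tens.span (?G (Suc n) r))"
    using \<eta> False unfolding koszul_space_def by (simp split: if_splits)
  then have "\<eta> \<in> tens.span (?G (Suc n) r)" if "r \<le> n - N" for r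
    by (rule INT_D) (use that False in auto)
  moreover have "tens.span (?G (Suc n) r) \<subseteq> {\<eta>. (\<lambda>w. \<eta> (w @ [i])) \<in> tens.span (?G n r)}"
    if r: "r \<le> n - N" for r
  proof (rule tens.span_minimal[OF _ linear_contraction[OF tens.subspace_span]], rule subsetI)
    fix \<eta> assume "\<eta> \<in> ?G (Suc n) r"
    then obtain a \<rho> b where g: "\<eta> = conv (conv a \<rho>) b" "a \<in> tensor_power r"
      "\<rho> \<in> R" "b \<in> tensor_power (Suc (n - N - r))"
      using r False by (auto simp: tensor_algebra_simps(2) Suc_diff_le)
    \<comment> \<open>The right factor has positive degree; \<open>b [] = 0\<close> removes the
      summand of \<open>conv_snoc\<close> in which the last letter would be taken from the
      relation.\<close>
    have "(\<lambda>v. b (v @ [i])) \<in> tensor_power (n - N - r)" "b [] = 0"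
      using g(4) by (auto simp: tensor_power_def)
    then have "(\<lambda>w. \<eta> (w @ [i])) \<in> ?G n r"
      using g(2,3) unfolding g(1) tensor_algebra_simps(2) conv_snoc by auto
    then show "\<eta> \<in> {\<eta>. (\<lambda>w. \<eta> (w @ [i])) \<in> tens.span (?G n r)}" by (simp add: tens.span_base)
  qed
  ultimately have "(\<lambda>w. \<eta> (w @ [i])) \<in> tens.span (?G n r)" if "r \<le> n - N" for r
    using that by blast
  then have "(\<lambda>w. \<eta> (w @ [i])) \<in> (\<Inter>r\<in>{0..n - N}. tens.span (?G n r))" by simp
  then show ?thesis using False unfolding koszul_space_def by (simp only: if_False)
qed

end

section \<open>The top tensor: uniqueness, spanning by contractions, left nondegeneracy\<close>

context gorenstein_koszul
begin

lemma deg_Suc: "deg (Suc n) = deg n + gap N (Suc n)"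
  using koszul_degree_Suc[of N n] N_ge_2 by simp

text \<open>Otherwise a functional \<open>c\<close> vanishes on all the contractions and is 1 on
  \<open>\<kappa>\<close>. Then \<open>id (x) c\<close> is a cocycle in a degree other than
  \<open>D\<close>, hence a coboundary, although its constant term on \<open>1 (x) \<kappa>\<close>
  is 1.\<close>

lemma koszul_space_contractions:
  assumes n: "n < D" and \<kappa>: "\<kappa> \<in> K (deg n)"
  shows "\<kappa> \<in> tens.span {\<lambda>w. \<eta> (u @ w) | \<eta> u. \<eta> \<in> K (deg (Suc n)) \<and> length u = gap N (Suc n)}"
    (is "_ \<in> tens.span ?S")
proof (rule ccontr)
  assume no: "\<kappa> \<notin> tens.span ?S"
  have sub: "K k \<subseteq> tensor_power k" for k by (rule K_subset)
  have "?S \<subseteq> tensor_power (deg n)"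
    using sub[of "deg (Suc n)"] unfolding tensor_power_def deg_Suc by fastforce
  then have S: "tens.span ?S \<subseteq> tensor_power (deg n)"
    by (rule tens.span_minimal[OF _ subspace_tensor_power])
  have "\<kappa> \<in> tensor_power (deg n)" using \<kappa> sub by blast
  obtain c where c: "\<And>\<eta>. \<eta> \<in> tens.span ?S \<Longrightarrow> (\<Sum>w | length w = deg n. c w * \<eta> w) = 0"
    "(\<Sum>w | length w = deg n. c w * \<kappa> w) = 1"
    by (rule separating_functional[OF tens.subspace_span S \<open>\<kappa> \<in> tensor_power (deg n)\<close> no], rule that; assumption)
  have "cocycle A C \<delta> n (pair (deg n) c)"
  proof (rule cocycle_pair)
    fix \<eta> and u :: "'q list" assume "\<eta> \<in> K (deg (Suc n))" "length u = gap N (Suc n)"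
    then have "(\<lambda>w. \<eta> (u @ w)) \<in> tens.span ?S" by (intro tens.span_base) blast
    from c(1)[OF this] show "(\<Sum>w | length w = deg n. c w * \<eta> (u @ w)) = 0" .
  qed
  then have "coboundary A C \<delta> n (pair (deg n) c)" using n by (intro gorenstein_cocycles(1)) auto
  from coef_Nil_coboundary[OF this embed_AK[OF \<kappa>]] show False
    by (simp add: pair_embed c(2) coef_Nil_scalar)
qed

lemma cocycle_pair_last:
  assumes "K (deg (Suc n)) = {\<lambda>w. 0}"
  shows "cocycle A C \<delta> n (pair (deg n) c)"
  by (rule cocycle_pair) (use assms in auto)

lemma nonzero_functional:
  assumes "\<kappa> \<in> K n" "\<kappa> \<noteq> (\<lambda>w. 0)"
  obtains c where "(\<Sum>w | length w = n. c w * \<kappa> w) = 1"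
proof -
  have Z: "tens.subspace {\<lambda>w :: 'q list. 0 :: 'k}"
    using tens.subspace_single_0 by (simp add: zero_fun_def)
  have "{\<lambda>w. 0} \<subseteq> tensor_power n" by (simp add: tensor_power_def)
  moreover have "\<kappa> \<in> tensor_power n"
    using assms(1) K_subset[of n] by blast
  moreover have "\<kappa> \<notin> {\<lambda>w. 0}" using assms(2) by simp
  ultimately show ?thesis
    by (rule separating_functional[OF Z]) (rule that)
qed

text \<open>In the last homological degree with a nonzero Koszul space every \<open>id (x) c\<close>
  is a cocycle. If that degree were not \<open>D\<close>, each would be a coboundary, including one
  with value 1 on a nonzero tensor. The maximum exists because \<open>K_0\<close> is nonzero and the
  spaces vanish eventually.\<close>

lemma koszul_space_beyond:
  shows "n > D \<Longrightarrow> K (deg n) = {\<lambda>w. 0}" and "K (deg D) \<noteq> {\<lambda>w. 0}"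
proof -
  obtain d where d: "\<And>n. n > d \<Longrightarrow> K (deg n) = {\<lambda>w. 0}" using koszul_space_vanishes by blast
  define T where "T = {n. K (deg n) \<noteq> {\<lambda>w. 0}}"
  have "T \<subseteq> {..d}" using d by (auto simp: T_def not_less[symmetric])
  then have T: "finite T" by (rule finite_subset) simp
  have "unit_tensor [] \<in> K (deg 0)" "unit_tensor [] \<noteq> (\<lambda>w. 0)"
    using N_ge_2 by (auto simp: koszul_degree_def koszul_space_def tensor_power_def unit_tensor_def fun_eq_iff)
  then have "0 \<in> T" by (auto simp: T_def)
  then have j: "Max T \<in> T" using T by (intro Max_in) auto
  have beyond: "K (deg n) = {\<lambda>w. 0}" if "n > Max T" for n
    using that T by (metis (mono_tags, lifting) Max_ge T_def mem_Collect_eq not_less)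
  have "Max T = D"
  proof (rule ccontr)
    assume ne: "Max T \<noteq> D"
    obtain \<kappa> where \<kappa>: "\<kappa> \<in> K (deg (Max T))" "\<kappa> \<noteq> (\<lambda>w. 0)"
      using j koszul_space_zero unfolding T_def by blast
    obtain c where c: "(\<Sum>w | length w = deg (Max T). c w * \<kappa> w) = 1"
      using nonzero_functional[OF \<kappa>] by blast
    have "coboundary A C \<delta> (Max T) (pair (deg (Max T)) c)"
      by (rule gorenstein_cocycles(1)[OF ne cocycle_pair_last]) (rule beyond, simp)
    from coef_Nil_coboundary[OF this embed_AK[OF \<kappa>(1)]] show False
      by (simp add: pair_embed c coef_Nil_scalar)
  qed
  then show "n > D \<Longrightarrow> K (deg n) = {\<lambda>w. 0}" using beyond[of n] by simp
  have "D \<in> T" using j \<open>Max T = D\<close> by simp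
  then show "K (deg D) \<noteq> {\<lambda>w. 0}" unfolding T_def by blast
qed

lemma cocycle_top: "cocycle A C \<delta> D (pair (deg D) c)"
  by (rule cocycle_pair_last) (rule koszul_space_beyond, simp)

text \<open>For \<open>\<kappa>\<close> outside the line of \<open>\<omega>\<close>, take
  \<open>c\<close> vanishing on \<open>\<omega>\<close> with value 1 on \<open>\<kappa>\<close>, and
  \<open>c'\<close> with value 1 on \<open>\<omega>\<close>. Evaluating a dependence of their
  cocycles first on \<open>\<omega>\<close> and then on \<open>\<kappa>\<close> makes both
  coefficients zero.\<close>

lemma koszul_space_top:
  assumes \<omega>: "\<omega> \<in> K (deg D)" "\<omega> \<noteq> (\<lambda>w. 0)"
  shows "K (deg D) = tens.span {\<omega>}"
proof (rule ccontr)
  assume ne: "K (deg D) \<noteq> tens.span {\<omega>}"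
  have "tens.span {\<omega>} \<subseteq> K (deg D)"
    by (rule tens.span_minimal) (use \<omega> K_subspace in auto)
  with ne obtain \<kappa> where \<kappa>: "\<kappa> \<in> K (deg D)" "\<kappa> \<notin> tens.span {\<omega>}" by blast
  have tp: "K (deg D) \<subseteq> tensor_power (deg D)" by (rule K_subset)
  obtain c where c: "\<And>\<eta>. \<eta> \<in> tens.span {\<omega>} \<Longrightarrow> (\<Sum>w | length w = deg D. c w * \<eta> w) = 0"
    "(\<Sum>w | length w = deg D. c w * \<kappa> w) = 1"
    using separating_functional[OF tens.subspace_span _ _ \<kappa>(2)] \<kappa>(1) tp \<open>tens.span {\<omega>} \<subseteq> K (deg D)\<close> by blast
  obtain c' where c': "(\<Sum>w | length w = deg D. c' w * \<omega> w) = 1"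
    using nonzero_functional[OF \<omega>] by blast
  obtain a b where ab: "a \<noteq> 0 \<or> b \<noteq> 0"
    and cb: "coboundary A C \<delta> D (\<lambda>y. a \<odot> pair (deg D) c y \<oplus> b \<odot> pair (deg D) c' y)"
    using gorenstein_cocycles(2)[OF cocycle_top[of c] cocycle_top[of c']] by blast
  have N: "length [] < N" using N_ge_2 by simp
  have val: "a * (\<Sum>w | length w = deg D. c w * k w) + b * (\<Sum>w | length w = deg D. c' w * k w) = 0"
    if "k \<in> K (deg D)" for k
    using coef_Nil_coboundary[OF cb embed_AK[OF that]]
    by (simp add: pair_embed coef_Nil_scalar coef_add[OF N] coef_scale[OF N] scale_closed)
  from val[OF \<omega>(1)] have "b = 0" using c(1)[OF tens.span_base, of \<omega>] c' by simp
  moreover from val[OF \<kappa>(1)] this have "a = 0" using c(2) by simp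
  ultimately show False using ab by simp
qed

lemma left_nondegenerate:
  assumes \<omega>: "\<omega> \<in> K (deg D)" "\<omega> \<noteq> (\<lambda>w. 0)"
  shows "gap N D = 1"
    and "(\<And>v. length v = deg (D - 1) \<Longrightarrow> (\<Sum>l\<in>UNIV. X l * \<omega> (l # v)) = 0) \<Longrightarrow> X i = 0"
proof -
  obtain E where E: "D = Suc E" using D_ge_2 by (cases D) auto
  have N: "length [] < N" "length [l] < N" for l :: 'q using N_ge_2 by simp_all
  note cs = coef_add[OF N(1)] coef_scale[OF N(1)] coef_add[OF N(2)] coef_scale[OF N(2)]
    coef_one[OF N(2)] coef_zero[OF N(1)] coef_zero[OF N(2)]
  obtain c where c: "(\<Sum>w | length w = deg D. c w * \<omega> w) = 1"
    using nonzero_functional[OF \<omega>] by blast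
  \<comment> \<open>The linear part of the equation \<open>d x^i = g (\<delta> \<omega>)\<close>:
    the values \<open>b\<close> are the coefficients of the functional \<open>g\<close>.\<close>
  have main: "\<exists>b d. d \<noteq> 0 \<and> (\<forall>v. b v \<in> carrier A) \<and>
      (\<forall>l. (if l = i then d else 0) = (\<Sum>v | length v = deg E. coef [l] (\<delta> E (embed \<omega>) v) * coef [] (b v)))" for i
  proof -
    \<comment> \<open>Right multiplication by \<open>x i\<close> commutes with the left module
      structure and so preserves cocycles.\<close>
    let ?h = "\<lambda>y. pair (deg D) c y \<otimes> x i"
    have "?h \<in> functionals (C D)"
      using left_module_homD[OF pair_hom[of "deg D" c]]
      by (intro left_module_homI) (simp_all add: regular_ops l_distr m_assoc)
    moreover have "?h (\<delta> D f) = \<zero>" if "f \<in> carrier (C (Suc D))" for f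
      using cocycle_top[of c] that by (simp add: cocycle_def)
    ultimately have h: "cocycle A C \<delta> D ?h" by (simp add: cocycle_def)
    obtain a d where ad: "a \<noteq> 0 \<or> d \<noteq> 0" "coboundary A C \<delta> D (\<lambda>y. a \<odot> pair (deg D) c y \<oplus> d \<odot> ?h y)"
      using gorenstein_cocycles(2)[OF cocycle_top[of c] h] by blast
    have val: "a \<odot> pair (deg D) c (embed \<omega>) \<oplus> d \<odot> ?h (embed \<omega>) = a \<odot> \<one> \<oplus> d \<odot> x i"
      by (simp add: pair_embed c scale_one)
    \<comment> \<open>Comparison of constant terms on \<open>1 (x) \<omega>\<close>: a coboundary
      has none, and neither has \<open>x i\<close>.\<close>
    have "a = 0"
      using coef_Nil_coboundary[OF ad(2) embed_AK[OF \<omega>(1)]] unfolding val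
      by (simp add: cs coef_Nil_scalar coef_generator scale_closed)
    with ad have d: "d \<noteq> 0" by simp
    from ad(2) obtain g where g: "g \<in> functionals (C E)"
      "a \<odot> \<one> \<oplus> d \<odot> x i = g (\<delta> E (embed \<omega>))"
      using embed_AK[OF \<omega>(1)] unfolding coboundary_def E by (auto simp: KM_simps val[unfolded E])
    obtain b where b: "\<And>v. b v \<in> carrier A"
      "\<And>f. f \<in> AK (deg E) \<Longrightarrow> g f = (\<Oplus>v\<in>{v. length v = deg E}. f v \<otimes> b v)"
      using KM_hom_coef[OF g(1)] by blast
    have f: "\<delta> E (embed \<omega>) \<in> AK (deg E)"
      using embed_AK[OF \<omega>(1)] E by (intro koszul_diff_closed) simp
    have "(if l = i then d else 0) = (\<Sum>v | length v = deg E. coef [l] (\<delta> E (embed \<omega>) v) * coef [] (b v))" for l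
    proof -
      have "(if l = i then d else 0) = coef [l] (a \<odot> \<one> \<oplus> d \<odot> x i)"
        by (simp add: cs coef_generator scale_closed)
      also have "\<dots> = (\<Sum>v | length v = deg E. coef [l] (\<delta> E (embed \<omega>) v \<otimes> b v))"
        unfolding g(2) b(2)[OF f] using b(1) AK_carrier(1)[OF f] by (intro coef_finsum N) auto
      \<comment> \<open>The values of the differential have no constant term, so the Leibniz rule
        keeps only their linear part times the constant part of \<open>b v\<close>.\<close>
      also have "\<dots> = (\<Sum>v | length v = deg E. coef [l] (\<delta> E (embed \<omega>) v) * coef [] (b v))"
        using b(1) AK_carrier(1)[OF f] coef_Nil_diff[OF AK_carrier(1)[OF embed_AK[OF \<omega>(1)]]]
        by (simp add: coef_single_mult)
      finally show ?thesis .
    qed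
    then show ?thesis using d b(1) by blast
  qed
  note ec = AK_carrier(1)[OF embed_AK[OF \<omega>(1)]]
  show gap: "gap N D = 1"
  proof (rule ccontr)
    assume "gap N D \<noteq> 1"
    then obtain s where s: "gap N D = Suc (Suc s)"
      using N_ge_2 by (cases "gap N D"; cases "gap N D - 1") (auto simp: gap_def split: if_splits)
    \<comment> \<open>With at least two applications of \<open>koszul_d\<close>, the linear part of
      the result is the constant part of another value of \<open>koszul_d\<close>, which is zero.
      This contradicts \<open>d \<noteq> 0\<close> in \<open>main\<close>.\<close>
    have "coef [l] (\<delta> E (embed \<omega>) v) = 0" for l v
      unfolding koszul_diff_gap E[symmetric] s
      using coef_single_koszul_d[of "koszul_d A x ((koszul_d A x ^^ s) (embed \<omega>))" l v]
        coef_Nil_koszul_d[of "(koszul_d A x ^^ s) (embed \<omega>)"] koszul_d_pow_closed[OF ec]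
      by simp
    then show False using spec[of _ i] main[of i] by (auto dest!: spec[of _ i])
  qed
  assume X: "\<And>v. length v = deg (D - 1) \<Longrightarrow> (\<Sum>l\<in>UNIV. X l * \<omega> (l # v)) = 0"
  have \<omega>l: "coef [l] (\<delta> E (embed \<omega>) v) = \<omega> (l # v)" for l v
    unfolding koszul_diff_gap E[symmetric] gap
    using coef_single_koszul_d[OF ec] by (simp add: embed_def coef_Nil_scalar)
  obtain b d where bd: "d \<noteq> 0"
    "\<And>l. (if l = i then d else 0) = (\<Sum>v | length v = deg E. \<omega> (l # v) * coef [] (b v))"
    using main[of i] unfolding \<omega>l by blast
  \<comment> \<open>The vector of linear coefficients in \<open>main\<close> is \<open>d\<close>
    times the \<open>i\<close>-th unit vector; pairing it with \<open>X\<close> isolates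
    \<open>X i\<close>, while exchanging the sums produces the vanishing contractions of
    \<open>\<omega>\<close> by \<open>X\<close>.\<close>
  have "X i * d = (\<Sum>l\<in>UNIV. X l * (if l = i then d else 0))"
    by (simp add: if_distrib cong: if_cong)
  also have "\<dots> = (\<Sum>l\<in>UNIV. \<Sum>v | length v = deg E. X l * \<omega> (l # v) * coef [] (b v))"
    unfolding bd(2) by (simp add: sum_distrib_left mult.assoc)
  also have "\<dots> = (\<Sum>v | length v = deg E. \<Sum>l\<in>UNIV. X l * \<omega> (l # v) * coef [] (b v))"
    by (rule sum.swap)
  also have "\<dots> = 0"
    using X E by (intro sum.neutral) (simp add: sum_distrib_right[symmetric])
  finally show "X i = 0" using bd(1) by simp
qed

text \<open>Downward induction from \<open>D\<close>, where the only contraction is by the empty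
  word. The inequality of degrees is carried along so that the subtractions of naturals are
  genuine.\<close>

lemma koszul_space_spanned:
  assumes \<omega>: "\<omega> \<in> K (deg D)" "\<omega> \<noteq> (\<lambda>w. 0)" and n: "n \<le> D"
  shows "deg n \<le> deg D \<and> K (deg n) \<subseteq> tens.span {\<lambda>w. \<omega> (u @ w) | u. length u = deg D - deg n}"
  using n
proof (induction rule: inc_induct)
  case base
  show ?case using koszul_space_top[OF \<omega>] by simp
next
  case (step n)
  then have le: "deg (Suc n) \<le> deg D"
    and IH: "K (deg (Suc n)) \<subseteq> tens.span {\<lambda>w. \<omega> (u @ w) | u. length u = deg D - deg (Suc n)}" by auto
  let ?V = "tens.span {\<lambda>w. \<omega> (u @ w) | u. length u = deg D - deg n}"
  have "(\<lambda>w. \<eta> (u @ w)) \<in> ?V" if \<eta>: "\<eta> \<in> K (deg (Suc n))" and u: "length u = gap N (Suc n)" for \<eta> u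
  proof -
    have "tens.span {\<lambda>w. \<omega> (v @ w) | v. length v = deg D - deg (Suc n)} \<subseteq> {\<eta>. (\<lambda>w. \<eta> (u @ w)) \<in> ?V}"
    proof (rule tens.span_minimal[OF _ linear_contraction[OF tens.subspace_span]], clarify)
      fix v :: "'q list" assume v: "length v = deg D - deg (Suc n)"
      then have "length (v @ u) = deg D - deg n" using u le deg_Suc[of n] by simp
      \<comment> \<open>Contracting by \<open>v\<close> and then by \<open>u\<close> is contracting
        by the concatenation.\<close>
      moreover have "(\<lambda>w. \<omega> (v @ u @ w)) = (\<lambda>w. \<omega> ((v @ u) @ w))" by simp
      ultimately show "(\<lambda>w. \<omega> (v @ u @ w)) \<in> ?V" by (intro tens.span_base) blast
    qed
    then show ?thesis using IH \<eta> by blast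
  qed
  then have "tens.span {\<lambda>w. \<eta> (u @ w) | \<eta> u. \<eta> \<in> K (deg (Suc n)) \<and> length u = gap N (Suc n)} \<subseteq> ?V"
    by (intro tens.span_minimal[OF _ tens.subspace_span]) blast
  then show ?case
    using koszul_space_contractions[of n] step.hyps le deg_Suc[of n] by auto
qed

end

section \<open>The multilinear form\<close>

text \<open>The multilinear extension of a function on words: \<open>f\<close> gives the components
  in the canonical basis, and the number of arguments selects the length of the words
  involved.\<close>

primrec word_form :: "('q::finite list \<Rightarrow> 'k::field) \<Rightarrow> ('k ^ 'q) list \<Rightarrow> 'k" where
  "word_form f [] = f []"
| "word_form f (X # Xs) = (\<Sum>i\<in>UNIV. X $ i * word_form (\<lambda>w. f (i # w)) Xs)"

lemma word_form_sum:
  "word_form (\<lambda>w. \<Sum>i\<in>S. c i * f i w) Xs = (\<Sum>i\<in>S. c i * word_form (f i) Xs)"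
proof (induction Xs arbitrary: f)
  case (Cons X Xs)
  have "word_form (\<lambda>w. \<Sum>i\<in>S. c i * f i w) (X # Xs) =
    (\<Sum>j\<in>UNIV. \<Sum>i\<in>S. X $ j * (c i * word_form (\<lambda>w. f i (j # w)) Xs))"
    by (simp add: Cons sum_distrib_left)
  also have "\<dots> = (\<Sum>i\<in>S. \<Sum>j\<in>UNIV. X $ j * (c i * word_form (\<lambda>w. f i (j # w)) Xs))"
    by (rule sum.swap)
  also have "\<dots> = (\<Sum>i\<in>S. c i * word_form (f i) (X # Xs))"
    by (simp add: sum_distrib_left mult.left_commute)
  finally show ?case .
qed simp

lemma word_form_snoc:
  "word_form f (Xs @ [X]) = (\<Sum>i\<in>UNIV. X $ i * word_form (\<lambda>w. f (w @ [i])) Xs)"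
proof (induction Xs arbitrary: f)
  case (Cons Y Xs)
  have "word_form f ((Y # Xs) @ [X]) =
    (\<Sum>j\<in>UNIV. \<Sum>i\<in>UNIV. Y $ j * (X $ i * word_form (\<lambda>w. f (j # w @ [i])) Xs))"
    by (simp add: Cons sum_distrib_left)
  also have "\<dots> = (\<Sum>i\<in>UNIV. \<Sum>j\<in>UNIV. Y $ j * (X $ i * word_form (\<lambda>w. f (j # w @ [i])) Xs))"
    by (rule sum.swap)
  also have "\<dots> = (\<Sum>i\<in>UNIV. X $ i * word_form (\<lambda>w. f (w @ [i])) (Y # Xs))"
    by (simp add: sum_distrib_left mult.left_commute)
  finally show ?case .
qed simp

lemma word_form_axis: "word_form f (map (\<lambda>i. axis i 1) ls) = f ls"
proof (induction ls arbitrary: f)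
  case (Cons l ls)
  have "word_form f (map (\<lambda>i. axis i 1) (l # ls)) = (\<Sum>i\<in>UNIV. if i = l then f (i # ls) else 0)"
    unfolding list.map word_form.simps Cons by (intro sum.cong) (auto simp: axis_def)
  then show ?case by simp
qed simp

lemma word_form_linear:
  assumes "i < length Xs"
  shows "word_form f (Xs[i := X + Y]) = word_form f (Xs[i := X]) + word_form f (Xs[i := Y])"
    and "word_form f (Xs[i := c *s X]) = c * word_form f (Xs[i := X])"
proof -
  show "word_form f (Xs[i := X + Y]) = word_form f (Xs[i := X]) + word_form f (Xs[i := Y])"
    using assms
  proof (induction Xs arbitrary: f i)
    case (Cons Z Xs)
    then show ?case by (cases i) (simp_all add: sum.distrib algebra_simps)
  qed simp
  show "word_form f (Xs[i := c *s X]) = c * word_form f (Xs[i := X])"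
    using assms
  proof (induction Xs arbitrary: f i)
    case (Cons Z Xs)
    then show ?case by (cases i) (simp_all add: sum_distrib_left algebra_simps)
  qed simp
qed

lemma multilinear_word_form:
  fixes f :: "'a::finite list \<Rightarrow> 'b::field"
  shows "multilinear_form m (word_form f)"
proof -
  have "Vector_Spaces.linear (*s) (*) (\<lambda>X. word_form f (Xs[i := X]))" if "i < length Xs" for Xs i
    unfolding Vector_Spaces.linear_iff
    by (intro conjI allI word_form_linear[OF that] vec.vector_space_axioms
        vector_space_over_itself.vector_space_axioms)
  then show ?thesis by (auto simp: multilinear_form_def)
qed

context gorenstein_koszul
begin

text \<open>\<open>X\<close> defines a linear condition on tensors of length 1 that holds for all
  contractions of \<open>\<omega>\<close> to its last letter. These span \<open>K 1\<close>, the
  whole space, so the condition holds for each basis vector.\<close>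

lemma right_nondegenerate:
  assumes \<omega>: "\<omega> \<in> K (deg D)" "\<omega> \<noteq> (\<lambda>w. 0)"
    and X: "\<And>v. length v = deg D - 1 \<Longrightarrow> (\<Sum>i\<in>UNIV. X i * \<omega> (v @ [i])) = 0"
  shows "X i = 0"
proof -
  let ?U = "{\<eta>. (\<Sum>i\<in>UNIV. X i * \<eta> [i]) = 0}"
  have U: "tens.subspace ?U"
  proof (rule tens.subspaceI)
    fix c and \<eta> :: "'q list \<Rightarrow> 'k" assume "\<eta> \<in> ?U"
    moreover have "(\<Sum>i\<in>UNIV. X i * (c * \<eta> [i])) = c * (\<Sum>i\<in>UNIV. X i * \<eta> [i])"
      by (simp add: sum_distrib_left mult.left_commute)
    ultimately show "(\<lambda>w. c * \<eta> w) \<in> ?U" by simp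
  qed (auto simp: algebra_simps sum.distrib)
  have "deg 1 = 1" by (simp add: koszul_degree_def)
  then have "K 1 \<subseteq> tens.span {\<lambda>w. \<omega> (u @ w) | u. length u = deg D - 1}"
    using koszul_space_spanned[OF \<omega>, of 1] D_ge_2 by simp
  also have "tens.span {\<lambda>w. \<omega> (u @ w) | u. length u = deg D - 1} \<subseteq> ?U"
    by (rule tens.span_minimal[OF _ U]) (use X in auto)
  finally have "K 1 \<subseteq> ?U" .
  moreover have "unit_tensor [i] \<in> K 1"
    using N_ge_2 by (auto simp: koszul_space_def tensor_power_def unit_tensor_def split: if_splits)
  ultimately have "unit_tensor [i] \<in> ?U" by blast
  then show ?thesis by (simp add: unit_tensor_def if_distrib cong: if_cong)
qed

lemma deg_ge_N: "N \<le> deg D"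
proof -
  have "N * 1 \<le> N * (D div 2)" using D_ge_2 by (intro mult_le_mono) auto
  also have "\<dots> \<le> deg D" by (simp add: koszul_degree_def)
  finally show ?thesis by simp
qed

text \<open>As \<open>deg 2 = N\<close>, \<open>koszul_space_spanned\<close> at 2 gives one
  inclusion; the other holds because contracting an element of a Koszul space down to its last
  \<open>N\<close> letters gives a relation.\<close>

lemma relations_eq:
  assumes \<omega>: "\<omega> \<in> K (deg D)" "\<omega> \<noteq> (\<lambda>w. 0)"
  shows "form_relations (deg D) (word_form \<omega>) N = R"
proof -
  have "\<omega> \<in> tensor_power (deg D)"
    using \<omega>(1) K_subset by blast
  then have \<omega>0: "\<omega> w = 0" if "length w \<noteq> deg D" for w
    using that unfolding tensor_power_def by blast
  have fc: "form_component (word_form \<omega>) w = \<omega> w" for w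
    unfolding form_component_def by (rule word_form_axis)
  \<comment> \<open>Since \<open>\<omega>\<close> is homogeneous, the cut-off by length in
    \<open>form_relations\<close> changes nothing.\<close>
  have rel: "(\<lambda>ms. if length ms = N then form_component (word_form \<omega>) (ls @ ms) else 0) = (\<lambda>w. \<omega> (ls @ w))"
    if "length ls = deg D - N" for ls
    using that deg_ge_N \<omega>0 by (auto simp: fun_eq_iff fc)
  then have eq: "form_relations (deg D) (word_form \<omega>) N =
    tens.span {\<lambda>w. \<omega> (u @ w) | u. length u = deg D - N}"
    unfolding form_relations_def by (intro arg_cong[of _ _ tens.span]) (metis (no_types, opaque_lifting))
  have "deg 2 = N" by (simp add: koszul_degree_def)
  then have "R \<subseteq> tens.span {\<lambda>w. \<omega> (u @ w) | u. length u = deg D - N}"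
    using koszul_space_spanned[OF \<omega> D_ge_2] relations_in_koszul_space by auto
  moreover have "tens.span {\<lambda>w. \<omega> (u @ w) | u. length u = deg D - N} \<subseteq> R"
    using koszul_space_left_contraction[OF \<omega>(1) deg_ge_N]
    by (intro tens.span_minimal[OF _ R_subspace]) auto
  ultimately show ?thesis using eq by simp
qed

lemma preregular_word_form:
  assumes \<omega>: "\<omega> \<in> K (deg D)" "\<omega> \<noteq> (\<lambda>w. 0)"
  shows "preregular (deg D) (word_form \<omega>)"
proof -
  let ?m = "deg D"
  note gap = left_nondegenerate(1)[OF \<omega>]
  have m: "?m = Suc (deg (D - 1))" using deg_Suc[of "D - 1"] gap D_ge_2 by simp
  \<comment> \<open>An identity between forms yields the identity between their components by
    evaluation on the canonical basis.\<close>
  have axis_test: "(\<Sum>i\<in>UNIV. c i * f i v) = 0"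
    if "\<And>Xs. length Xs = n \<Longrightarrow> (\<Sum>i\<in>UNIV. c i * word_form (f i) Xs) = 0" "length v = n"
    for c :: "'q \<Rightarrow> 'k" and f :: "'q \<Rightarrow> 'q list \<Rightarrow> 'k" and v n
    using that(1)[of "map (\<lambda>i. axis i 1) v"] that(2) by (simp add: word_form_axis)
  have left: "X = 0" if "\<And>Xs. length Xs = ?m - 1 \<Longrightarrow> word_form \<omega> (X # Xs) = 0" for X
  proof -
    have "X $ i = 0" for i
      by (rule left_nondegenerate(2)[OF \<omega>], rule axis_test) (use that m in auto)
    then show ?thesis by (simp add: vec_eq_iff)
  qed
  \<comment> \<open>Removing the last letter of \<open>\<omega>\<close> gives an element of
    \<open>K (deg (D - 1))\<close>. As \<open>gap N D = 1\<close>, this space is spanned by the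
    contractions of \<open>\<omega>\<close> by one first letter.\<close>
  have "\<exists>q. (\<lambda>w. \<omega> (w @ [i])) = (\<lambda>w. \<Sum>j\<in>UNIV. q j * \<omega> (j # w))" for i
  proof -
    let ?F = "\<lambda>q w. \<Sum>j\<in>UNIV. q j * \<omega> (j # w)"
    have V: "tens.subspace (range ?F)"
    proof (rule tens.subspaceI)
      show "0 \<in> range ?F" by (rule range_eqI[of _ _ "\<lambda>_. 0"]) (simp add: zero_fun_def)
      fix f g assume "f \<in> range ?F" "g \<in> range ?F"
      then obtain q r where "f = ?F q" "g = ?F r" by blast
      then show "f + g \<in> range ?F"
        by (intro range_eqI[of _ _ "\<lambda>j. q j + r j"]) (simp add: plus_fun_def algebra_simps sum.distrib)
    next
      fix c f assume "f \<in> range ?F"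
      then obtain q where "f = ?F q" by blast
      then show "(\<lambda>w. c * f w) \<in> range ?F"
        by (intro range_eqI[of _ _ "\<lambda>j. c * q j"]) (simp add: sum_distrib_left mult.assoc)
    qed
    have "(\<lambda>w. \<omega> (w @ [i])) \<in> K (deg (D - 1))"
      using koszul_space_right_contraction[of \<omega> "deg (D - 1)" i] \<omega>(1) m by simp
    also have "\<dots> \<subseteq> tens.span {\<lambda>w. \<omega> (u @ w) | u. length u = 1}"
      using koszul_space_spanned[OF \<omega>, of "D - 1"] m by simp
    also have "\<dots> \<subseteq> range ?F"
    proof (rule tens.span_minimal[OF _ V], rule subsetI)
      fix \<eta> assume "\<eta> \<in> {\<lambda>w. \<omega> (u @ w) | u. length u = 1}"
      then obtain u where "length u = 1" "\<eta> = (\<lambda>w. \<omega> (u @ w))" by blast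
      then obtain j where "\<eta> = (\<lambda>w. \<omega> (j # w))" by (cases u) auto
      then show "\<eta> \<in> range ?F"
        by (intro range_eqI[of _ _ "\<lambda>l. if l = j then 1 else 0"])
          (simp add: if_distrib[of "\<lambda>c. c * _"] cong: if_cong)
    qed
    finally show ?thesis by blast
  qed
  then obtain q where q: "\<And>i. (\<lambda>w. \<omega> (w @ [i])) = (\<lambda>w. \<Sum>j\<in>UNIV. q i j * \<omega> (j # w))" by metis
  \<comment> \<open>The indices are transposed: \<open>Q\<close> sends the basis vector
    \<open>i\<close> to the vector with entries \<open>q i j\<close>, which trades a last argument
    for a first one.\<close>
  define Q :: "'k ^ 'q \<Rightarrow> 'k ^ 'q" where "Q X = (\<chi> j i. q i j) *v X" for X
  have cyc: "word_form \<omega> (Xs @ [X]) = word_form \<omega> (Q X # Xs)" for Xs X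
  proof -
    have "word_form \<omega> (Xs @ [X]) = (\<Sum>i\<in>UNIV. \<Sum>j\<in>UNIV. X $ i * (q i j * word_form (\<lambda>w. \<omega> (j # w)) Xs))"
      unfolding word_form_snoc q word_form_sum by (simp add: sum_distrib_left)
    also have "\<dots> = (\<Sum>j\<in>UNIV. \<Sum>i\<in>UNIV. X $ i * (q i j * word_form (\<lambda>w. \<omega> (j # w)) Xs))"
      by (rule sum.swap)
    also have "\<dots> = word_form \<omega> (Q X # Xs)"
      by (simp add: Q_def matrix_vector_mult_def sum_distrib_right sum_distrib_left mult_ac)
    finally show ?thesis .
  qed
  have lin: "Vector_Spaces.linear (*s) (*s) Q"
    unfolding Q_def by (rule matrix_vector_mul_linear_gen)
  have ker: "X = 0" if "Q X = 0" for X
  proof -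
    \<comment> \<open>By cyclicity, a vector killed by \<open>Q\<close> annihilates the form in its
      last argument, so right nondegeneracy applies.\<close>
    have z: "(\<Sum>i\<in>UNIV. X $ i * word_form (\<lambda>w. \<omega> (w @ [i])) Xs) = 0" for Xs
      using cyc[of Xs X] that by (simp add: word_form_snoc)
    have "X $ i = 0" for i
      by (rule right_nondegenerate[OF \<omega>], rule axis_test[OF z refl])
    then show ?thesis by (simp add: vec_eq_iff)
  qed
  have inj: "inj Q"
  proof (rule injI)
    fix X Y assume "Q X = Q Y"
    then have "Q (X - Y) = 0" by (simp add: Q_def matrix_vector_mult_diff_distrib)
    from ker[OF this] show "X = Y" by simp
  qed
  then have "bij Q" using vec.linear_inj_imp_surj[OF lin] by (simp add: bij_def)
  moreover have "2 \<le> ?m" using deg_ge_N N_ge_2 by simp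
  ultimately show ?thesis
    unfolding preregular_def using left multilinear_word_form lin cyc
    by (intro conjI allI impI exI[of _ Q]) simp_all
qed

end

theorem theorem4p3:
  fixes A :: "('k::{alg_closed_field, field_char_0}, 'a) module"
    and x :: "'q::finite \<Rightarrow> 'a"
    and R :: "('q list \<Rightarrow> 'k) set"
    and N D :: nat
  assumes "2 \<le> N" and "2 \<le> D"
    and "homogeneous_algebra N A x R"
    and "koszul N A x R"
    and "global_dimension A x = enat D"
    and "gorenstein A x D"
    and "2 \<le> CARD('q)"
  shows "\<exists>m (W :: ('k ^ 'q) list \<Rightarrow> 'k).
           preregular m W \<and> is_form_algebra A x m W N \<and>
           (3 \<le> N \<longrightarrow> (\<exists>p\<ge>1. m = N * p + 1 \<and> D = 2 * p + 1)) \<and>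
           (N = 2 \<longrightarrow> m = D)"
proof -
  have "unital_algebra A" using assms(3) by (simp add: homogeneous_algebra_def)
  then interpret gorenstein_koszul A x R N D
    using assms
    by (intro gorenstein_koszul.intro koszul_algebra.intro homogeneous.intro
        homogeneous_axioms.intro koszul_algebra_axioms.intro gorenstein_koszul_axioms.intro)
  obtain \<omega> where \<omega>: "\<omega> \<in> K (deg D)" "\<omega> \<noteq> (\<lambda>w. 0)"
    using koszul_space_beyond(2) koszul_space_zero by blast
  let ?W = "word_form \<omega>"
  obtain v where v: "\<omega> v \<noteq> 0" using \<omega>(2) by blast
  have "\<omega> \<in> tensor_power (deg D)"
    using \<omega>(1) K_subset by blast
  then have "length v = deg D" using v unfolding tensor_power_def by blast
  then have "\<exists>Xs. length Xs = deg D \<and> ?W Xs \<noteq> 0"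
    using v by (intro exI[of _ "map (\<lambda>i. axis i 1) v"]) (simp add: word_form_axis)
  then have form: "is_form_algebra A x (deg D) ?W N"
    using assms(1,3) deg_ge_N multilinear_word_form relations_eq[OF \<omega>] by (simp add: is_form_algebra_def)
  have "\<exists>p\<ge>1. deg D = N * p + 1 \<and> D = 2 * p + 1" if "3 \<le> N"
  proof -
    \<comment> \<open>For even \<open>D\<close> the top differential would remove
      \<open>N - 1 \<ge> 2\<close> letters, against \<open>gap N D = 1\<close>.\<close>
    have "odd D" using left_nondegenerate(1)[OF \<omega>] that by (auto simp: gap_def split: if_splits)
    then show ?thesis using assms(2)
      by (intro exI[of _ "D div 2"]) (auto simp: koszul_degree_def elim!: oddE)
  qed
  moreover have "deg D = D" if "N = 2"
    unfolding that koszul_degree_def by simp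
  ultimately show ?thesis using preregular_word_form[OF \<omega>] form by blast
qed

end
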